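(* Let $(Y_t,X_t)_{t\in\mathbb Z}$ be a process satisfying $\mathbb E[Y_t\mid\mathcal F_{t-1}]=g(\eta_t(\theta_0))$ a.s. for all $t$, with the notation of the context. Suppose: (i) $(Y_t,X_t)_{t\in\mathbb Z}$ is stationary and ergodic, and there exist $q\ge 3$, $\delta\in(0,2q]$, $\rho\in(0,1)$, $C<\infty$ such that $\Theta_{m,q+\delta}(Y)\le C\rho^m$ and $\Theta_{m,q+\delta}(X)\le C\rho^m$ for all $m\ge 0$, and $\mathbb E|Y_0|^{2q(q+\delta)/\delta}<\infty$, $\mathbb E\|X_0\|^{2q(q+\delta)/\delta}<\infty$; (ii) $g:\mathbb R\to\mathbb R$ is of class $\mathcal C^1$ and there is $C'>0$ such that $|g(u)-g(v)|\le C'|u-v|$ and $|g'(u)-g'(v)|\le C'|u-v|$ for all $u,v\in\mathbb R$; (iii) for every $u\in\mathbb R^d$, $\mathbb P(u^\top Z_0=0)=1$ implies $u=0$; and $g'>0$ on $\mathbb R$. Then there exists $a>0$ such that, with probability $1-o(n^{-1/2})$ as $n\to\infty$, the estimating equation $$\frac1n\sum_{t=1}^n\big(Y_t-g(\eta_t(\theta))\big)Z_{t-1}=0,\qquad \theta\in\mathbb R^d,$$ admits a unique solution $\theta=\widehat\theta_n$, and it satisfies $\|\widehat\theta_n-\theta_0\|\le a\sqrt{\log n/n}$.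
   Context: Setting. $Y_t$ is real-valued, $X_t$ takes values in a finite-dimensional space $\mathbb R^{k}$, $\mathcal F_t=\sigma(Y_s,X_s:s\le t)$, $p$ is the fixed autoregressive order, $d=1+p+k$, $Z_{t-1}=(1,Y_{t-1},\dots,Y_{t-p},X_{t-1}^\top)^\top\in\mathbb R^d$, and for $\theta=(\omega,\alpha_1,\dots,\alpha_p,\gamma^\top)^\top\in\mathbb R^d$, $\eta_t(\theta)=\theta^\top Z_{t-1}=\omega+\sum_{i=1}^p\alpha_iY_{t-i}+\gamma^\top X_{t-1}$. The link $g$ is known and $\theta_0\in\mathbb R^d$ is the fixed true parameter. $\|\cdot\|$ is the Euclidean norm. Functional dependence coefficients. The process has a causal representation $(Y_t,X_t)=f(\varepsilon_t,\varepsilon_{t-1},\dots)$ with $f$ measurable and $(\varepsilon_t)_{t\in\mathbb Z}$ i.i.d. Let $(\widetilde Y_t,\widetilde X_t)$ be obtained by replacing $\varepsilon_0$ by an independent copy and leaving the other innovations unchanged. For a (scalar or vector) causal process $(U_t)$ with coupled version $(\widetilde U_t)$, and $s\ge1$, $\theta_{s,t}(U)=\|U_t-\widetilde U_t\|_s=(\mathbb E\|U_t-\widetilde U_t\|^s)^{1/s}$ for $t\ge0$ and $\Theta_{m,s}(U)=\sum_{t=m}^\infty\theta_{s,t}(U)$. *)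

theory Defs
  imports "HOL-Probability.Probability" "HOL-Library.Landau_Symbols"
begin

text \<open>
  The covariate space \<open>\<real>\<^sup>k\<close> is the library product space \<open>\<Pi>\<^sub>M i\<in>{..<k}. borel\<close> with the Euclidean norm
  \<open>\<lambda>x. L2_set x {..<k}\<close>, so that \<open>k = 0\<close> (no covariate) is allowed.
\<close>

definition covariate_space :: "nat \<Rightarrow> (nat \<Rightarrow> real) measure" where
  "covariate_space k = PiM {..<k} (\<lambda>_. borel)"

definition observation_space :: "nat \<Rightarrow> (real \<times> (nat \<Rightarrow> real)) measure" where
  "observation_space k = borel \<Otimes>\<^sub>M covariate_space k"

definition past :: "'w measure \<Rightarrow> 'v measure \<Rightarrow> (int \<Rightarrow> 'w \<Rightarrow> 'v) \<Rightarrow> int \<Rightarrow> 'w measure" where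
  "past M N V t = sigma (space M) (\<Union>s\<in>{..t}. {V s -` A \<inter> space M |A. A \<in> sets N})"

definition process_law :: "'w measure \<Rightarrow> 'v measure \<Rightarrow> (int \<Rightarrow> 'w \<Rightarrow> 'v) \<Rightarrow> (int \<Rightarrow> 'v) measure" where
  "process_law M N V = distr M (PiM UNIV (\<lambda>_. N)) (\<lambda>w t. V t w)"

definition stationary_process :: "'w measure \<Rightarrow> 'v measure \<Rightarrow> (int \<Rightarrow> 'w \<Rightarrow> 'v) \<Rightarrow> bool" where
  "stationary_process M N V \<longleftrightarrow>
     (\<forall>h. process_law M N (\<lambda>t. V (t + h)) = process_law M N V)"

definition ergodic_process :: "'w measure \<Rightarrow> 'v measure \<Rightarrow> (int \<Rightarrow> 'w \<Rightarrow> 'v) \<Rightarrow> bool" where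
  "ergodic_process M N V \<longleftrightarrow>
     (\<forall>A \<in> sets (PiM UNIV (\<lambda>_::int. N)).
        {v \<in> space (PiM UNIV (\<lambda>_::int. N)). (\<lambda>t. v (t + 1)) \<in> A} = A \<longrightarrow>
        measure (process_law M N V) A \<in> {0, 1})"

definition causal_representation ::
    "'w measure \<Rightarrow> 'v measure \<Rightarrow> (int \<Rightarrow> 'w \<Rightarrow> 'v) \<Rightarrow>
     'e measure \<Rightarrow> (int \<Rightarrow> 'w \<Rightarrow> 'e) \<Rightarrow> ((nat \<Rightarrow> 'e) \<Rightarrow> 'v) \<Rightarrow> bool" where
  "causal_representation M N V S \<epsilon> f \<longleftrightarrow>
     prob_space.indep_vars M (\<lambda>_. S) \<epsilon> UNIV \<and>
     (\<forall>t. distr M S (\<epsilon> t) = distr M S (\<epsilon> 0)) \<and>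
     f \<in> measurable (PiM UNIV (\<lambda>_. S)) N \<and>
     (\<forall>t. AE w in M. V t w = f (\<lambda>j. \<epsilon> (t - int j) w))"

text \<open>
  The independent copy of \<open>\<epsilon>\<^sub>0\<close> is the second coordinate of the product of the base space with the
  law of \<open>\<epsilon>\<^sub>0\<close>; the base space itself need not carry such a copy.
\<close>

definition coupling_space :: "'w measure \<Rightarrow> 'e measure \<Rightarrow> (int \<Rightarrow> 'w \<Rightarrow> 'e) \<Rightarrow> ('w \<times> 'e) measure" where
  "coupling_space M S \<epsilon> = M \<Otimes>\<^sub>M distr M S (\<epsilon> 0)"

definition coupled :: "(int \<Rightarrow> 'w \<Rightarrow> 'e) \<Rightarrow> ((nat \<Rightarrow> 'e) \<Rightarrow> 'v) \<Rightarrow> int \<Rightarrow> 'w \<times> 'e \<Rightarrow> 'v" where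
  "coupled \<epsilon> f t = (\<lambda>(w, e). f (\<lambda>j. if t - int j = 0 then e else \<epsilon> (t - int j) w))"

definition Ls_norm :: "'a measure \<Rightarrow> real \<Rightarrow> ('a \<Rightarrow> real) \<Rightarrow> ennreal" where
  "Ls_norm M s h =
     (let I = (\<integral>\<^sup>+ z. ennreal (\<bar>h z\<bar> powr s) \<partial>M)
      in if I = \<infinity> then \<infinity> else ennreal (enn2real I powr (1 / s)))"

text \<open>
  Below, \<open>U\<close> is a coordinate process, \<open>\<pi>\<close> extracts it from the joint process, and \<open>dst\<close> is the
  Euclidean distance on the value space of \<open>U\<close>.
\<close>

definition dep_coeff ::
    "'w measure \<Rightarrow> 'e measure \<Rightarrow> (int \<Rightarrow> 'w \<Rightarrow> 'e) \<Rightarrow> ((nat \<Rightarrow> 'e) \<Rightarrow> 'v) \<Rightarrow>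
     ('v \<Rightarrow> 'u) \<Rightarrow> ('u \<Rightarrow> 'u \<Rightarrow> real) \<Rightarrow> (int \<Rightarrow> 'w \<Rightarrow> 'u) \<Rightarrow> real \<Rightarrow> nat \<Rightarrow> ennreal" where
  "dep_coeff M S \<epsilon> f \<pi> dst U s t =
     Ls_norm (coupling_space M S \<epsilon>) s
       (\<lambda>z. dst (U (int t) (fst z)) (\<pi> (coupled \<epsilon> f (int t) z)))"

definition dep_tail ::
    "'w measure \<Rightarrow> 'e measure \<Rightarrow> (int \<Rightarrow> 'w \<Rightarrow> 'e) \<Rightarrow> ((nat \<Rightarrow> 'e) \<Rightarrow> 'v) \<Rightarrow>
     ('v \<Rightarrow> 'u) \<Rightarrow> ('u \<Rightarrow> 'u \<Rightarrow> real) \<Rightarrow> (int \<Rightarrow> 'w \<Rightarrow> 'u) \<Rightarrow> nat \<Rightarrow> real \<Rightarrow> ennreal" where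
  "dep_tail M S \<epsilon> f \<pi> dst U m s = (\<Sum>t. dep_coeff M S \<epsilon> f \<pi> dst U s (m + t))"

definition covariate_dist :: "nat \<Rightarrow> (nat \<Rightarrow> real) \<Rightarrow> (nat \<Rightarrow> real) \<Rightarrow> real" where
  "covariate_dist k x x' = L2_set (\<lambda>i. x i - x' i) {..<k}"

text \<open>
  Vectors of \<open>\<real>\<^sup>d\<close>, \<open>d = 1 + p + k\<close>, have type \<open>real ^ 'd\<close>; \<open>pos\<close> is a bijection from \<open>'d\<close> onto
  \<open>{..<d}\<close> giving the position of a coordinate: position \<open>0\<close> is the intercept, positions \<open>1..p\<close>
  are the lags, and positions \<open>p+1..p+k\<close> are the covariates. The vector at time \<open>t\<close> is
  \<open>Z\<^sub>t = (1, Y\<^sub>t, \<dots>, Y\<^bsub>t-p+1\<^esub>, X\<^sub>t)\<close>.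
\<close>

definition regressor ::
    "nat \<Rightarrow> ('d::finite \<Rightarrow> nat) \<Rightarrow> (int \<Rightarrow> 'w \<Rightarrow> real) \<Rightarrow> (int \<Rightarrow> 'w \<Rightarrow> nat \<Rightarrow> real) \<Rightarrow>
     int \<Rightarrow> 'w \<Rightarrow> real ^ 'd" where
  "regressor p pos Y X t w =
     (\<chi> i. if pos i = 0 then 1
           else if pos i \<le> p then Y (t + 1 - int (pos i)) w
           else X t w (pos i - p - 1))"

definition linear_predictor ::
    "nat \<Rightarrow> ('d::finite \<Rightarrow> nat) \<Rightarrow> (int \<Rightarrow> 'w \<Rightarrow> real) \<Rightarrow> (int \<Rightarrow> 'w \<Rightarrow> nat \<Rightarrow> real) \<Rightarrow>
     int \<Rightarrow> real ^ 'd \<Rightarrow> 'w \<Rightarrow> real" where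
  "linear_predictor p pos Y X t \<theta> w = \<theta> \<bullet> regressor p pos Y X (t - 1) w"

definition estimating_function ::
    "nat \<Rightarrow> ('d::finite \<Rightarrow> nat) \<Rightarrow> (int \<Rightarrow> 'w \<Rightarrow> real) \<Rightarrow> (int \<Rightarrow> 'w \<Rightarrow> nat \<Rightarrow> real) \<Rightarrow>
     (real \<Rightarrow> real) \<Rightarrow> nat \<Rightarrow> real ^ 'd \<Rightarrow> 'w \<Rightarrow> real ^ 'd" where
  "estimating_function p pos Y X g n \<theta> w =
     (1 / real n) *\<^sub>R
       (\<Sum>t = 1..n. (Y (int t) w - g (linear_predictor p pos Y X (int t) \<theta> w))
                      *\<^sub>R regressor p pos Y X (int t - 1) w)"

end

theory Submission
  imports Defs
begin

text \<open>
  Existence and uniqueness of the zero are deterministic: the estimating function is strictly monotone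
  as soon as the empirical information at \<open>\<theta>\<^sub>0\<close> is positive definite, and Brouwer's theorem gives a zero
  in the ball of radius \<open>r\<close> around \<open>\<theta>\<^sub>0\<close> when the score at \<open>\<theta>\<^sub>0\<close> is small compared with \<open>r\<close> and the
  Taylor remainder, controlled by an empirical third moment, is small.

  The empirical information and the empirical moments are averages of locally Lipschitz functions of the
  process. Their variance is \<open>O(1/n)\<close> by an Efron--Stein inequality over all innovations, the influence of
  one innovation being bounded by the functional dependence coefficients; Chebyshev's inequality then
  gives probability \<open>1 - O(1/n)\<close>. The score is a martingale, for which the elementary bound
  \<open>exp (x - 2 x\<^sup>2) \<le> 1 + x + 4 x\<^sup>4\<close> yields a self-normalised exponential supermartingale; with \<open>x\<close> of
  order \<open>sqrt (ln n / n)\<close> the quartic correction costs only probability \<open>O(ln\<^sup>2 n / n)\<close>.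
\<close>

section \<open>Hybrids of two i.i.d. sequences\<close>

text \<open>The required rate leaves room: a failure probability of order \<open>ln^2 n / n\<close>
  is far below \<open>n^(-1/2)\<close>. For deviations of fixed size, second moments are therefore
  enough. The score is different: at its level \<open>sqrt (ln n / n)\<close> Chebyshev would only
  give \<open>1 / ln n\<close>, while its increments are only known to have finitely many moments,
  so ordinary exponential inequalities do not apply. Keeping \<open>2 * x\<^sup>2\<close> inside the
  exponent leaves a random sum of squares, which the empirical fourth moments of response and
  regressor bound by a multiple of \<open>n\<close>.

  All observations up to time \<open>n\<close> are functions of one innovation sequence read
  backwards from \<open>n\<close>, so a product measure over \<open>nat\<close> carries every
  variance computation. The independent copies that coupling requires may not exist on the base
  space; two-copy arguments therefore live on a product over \<open>nat \<times> bool\<close>, and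
  only laws are transported between the spaces.

  The moment order in the hypotheses enters twice: as an exponent of at least 8 for squares of
  functions of quartic growth, and through the conjugate exponent \<open>s / (s - 2)\<close> that
  pairs a cubic Lipschitz factor with increments in \<open>L^s\<close>.\<close>

lemma distr_PiM_UNIV_reindex:
  fixes \<phi> :: "'i \<Rightarrow> 'j"
  assumes "prob_space N" "inj \<phi>"
  shows "distr (PiM UNIV (\<lambda>_. N)) (PiM UNIV (\<lambda>_. N)) (\<lambda>\<omega> i. \<omega> (\<phi> i)) = PiM UNIV (\<lambda>_. N)"
  using distr_PiM_reindex[of UNIV "\<lambda>_. N" \<phi> UNIV] assms by (simp add: restrict_def)

lemma measurable_PiM_UNIV_reindex:
  "(\<lambda>\<omega> i. \<omega> (\<phi> i)) \<in> measurable (PiM UNIV (\<lambda>_. N)) (PiM UNIV (\<lambda>_. N))"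
  by (rule measurable_PiM_single') (auto simp: space_PiM)

lemma
  fixes h :: "_ \<Rightarrow> 'b::{banach, second_countable_topology}"
  assumes "prob_space N" "inj \<phi>" and [measurable]: "h \<in> borel_measurable (PiM UNIV (\<lambda>_. N))"
  shows integral_PiM_UNIV_reindex:
      "(\<integral>\<omega>. h (\<lambda>i. \<omega> (\<phi> i)) \<partial>PiM UNIV (\<lambda>_. N)) = (\<integral>x. h x \<partial>PiM UNIV (\<lambda>_. N))"
    and integrable_PiM_UNIV_reindex:
      "integrable (PiM UNIV (\<lambda>_. N)) (\<lambda>\<omega>. h (\<lambda>i. \<omega> (\<phi> i))) \<longleftrightarrow> integrable (PiM UNIV (\<lambda>_. N)) h"
proof -
  let ?D = "distr (PiM UNIV (\<lambda>_. N)) (PiM UNIV (\<lambda>_. N)) (\<lambda>\<omega> i. \<omega> (\<phi> i))"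
  have e: "?D = PiM UNIV (\<lambda>_. N)"
    using distr_PiM_UNIV_reindex[OF assms(1,2)] by simp
  have "integral\<^sup>L ?D h = (\<integral>\<omega>. h (\<lambda>i. \<omega> (\<phi> i)) \<partial>PiM UNIV (\<lambda>_. N))"
    by (rule integral_distr) (rule measurable_PiM_UNIV_reindex, rule assms)
  then show "(\<integral>\<omega>. h (\<lambda>i. \<omega> (\<phi> i)) \<partial>PiM UNIV (\<lambda>_. N)) = (\<integral>x. h x \<partial>PiM UNIV (\<lambda>_. N))"
    unfolding e by simp
  have "integrable ?D h \<longleftrightarrow> integrable (PiM UNIV (\<lambda>_. N)) (\<lambda>\<omega>. h (\<lambda>i. \<omega> (\<phi> i)))"
    by (rule integrable_distr_eq) (rule measurable_PiM_UNIV_reindex, rule assms)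
  then show "integrable (PiM UNIV (\<lambda>_. N)) (\<lambda>\<omega>. h (\<lambda>i. \<omega> (\<phi> i))) \<longleftrightarrow> integrable (PiM UNIV (\<lambda>_. N)) h"
    unfolding e by simp
qed

text \<open>
  A point \<open>\<omega> :: nat \<times> bool \<Rightarrow> 'e\<close> encodes two sequences, and \<open>hybrid J \<omega>\<close> takes the coordinates in
  \<open>J\<close> from the second one and the others from the first one.
\<close>

definition hybrid :: "nat set \<Rightarrow> (nat \<times> bool \<Rightarrow> 'e) \<Rightarrow> nat \<Rightarrow> 'e" where
  "hybrid J \<omega> = (\<lambda>i. \<omega> (i, i \<in> J))"

locale iid_pair = prob_space N for N :: "'e measure"
begin

abbreviation P :: "(nat \<Rightarrow> 'e) measure" where "P \<equiv> PiM UNIV (\<lambda>_. N)"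
abbreviation R :: "(nat \<times> bool \<Rightarrow> 'e) measure" where "R \<equiv> PiM UNIV (\<lambda>_. N)"

lemma prob_space_P: "prob_space P" and prob_space_R: "prob_space R"
  by (auto intro!: prob_space_PiM prob_space_axioms)

sublocale P: prob_space P by (rule prob_space_P)
sublocale R: prob_space R by (rule prob_space_R)

lemma hybrid_measurable [measurable]: "hybrid J \<in> measurable R P"
  unfolding hybrid_def by (rule measurable_PiM_UNIV_reindex)

lemma
  fixes h :: "_ \<Rightarrow> 'b::{banach, second_countable_topology}"
  assumes "h \<in> borel_measurable P"
  shows integral_hybrid: "(\<integral>\<omega>. h (hybrid J \<omega>) \<partial>R) = (\<integral>x. h x \<partial>P)"
    and integrable_hybrid: "integrable R (\<lambda>\<omega>. h (hybrid J \<omega>)) \<longleftrightarrow> integrable P h"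
proof -
  have i: "inj (\<lambda>i. (i, i \<in> J))" by (auto intro: inj_onI)
  show "(\<integral>\<omega>. h (hybrid J \<omega>) \<partial>R) = (\<integral>x. h x \<partial>P)"
    unfolding hybrid_def by (rule integral_PiM_UNIV_reindex[OF prob_space_axioms i assms])
  show "integrable R (\<lambda>\<omega>. h (hybrid J \<omega>)) \<longleftrightarrow> integrable P h"
    unfolding hybrid_def by (rule integrable_PiM_UNIV_reindex[OF prob_space_axioms i assms])
qed

lemma integrable_hybridI:
  fixes h :: "_ \<Rightarrow> 'b::{banach, second_countable_topology}"
  shows "integrable P h \<Longrightarrow> integrable R (\<lambda>\<omega>. h (hybrid J \<omega>))"
  by (simp add: integrable_hybrid borel_measurable_integrable)

text \<open>The comparison by \<open>\<noteq>\<close> is an exclusive or: over \<open>J\<close> the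
  copy bit is flipped. This is a permutation of the index set, so the law of the two copies is
  invariant.\<close>

definition swap :: "nat set \<Rightarrow> (nat \<times> bool \<Rightarrow> 'e) \<Rightarrow> nat \<times> bool \<Rightarrow> 'e" where
  "swap J \<omega> = (\<lambda>ib. \<omega> (fst ib, snd ib \<noteq> (fst ib \<in> J)))"

lemma integral_swap:
  fixes h :: "_ \<Rightarrow> real"
  assumes "h \<in> borel_measurable R"
  shows "(\<integral>\<omega>. h (swap J \<omega>) \<partial>R) = (\<integral>\<omega>. h \<omega> \<partial>R)"
proof -
  have i: "inj (\<lambda>ib. (fst ib, snd ib \<noteq> (fst ib \<in> J)))" by (auto intro!: inj_onI simp: prod_eq_iff)
  show ?thesis
    unfolding swap_def by (rule integral_PiM_UNIV_reindex[OF prob_space_axioms i assms])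
qed

text \<open>The index set on the right is the symmetric difference of \<open>K\<close> and
  \<open>J\<close>; every symmetrisation of hybrids below is an instance.\<close>

lemma hybrid_swap: "hybrid K (swap J \<omega>) = hybrid {i. (i \<in> K) \<noteq> (i \<in> J)} \<omega>"
  by (auto simp: hybrid_def swap_def)

text \<open>Cylinder functions do not notice the replacement of late coordinates, and they are dense.\<close>

definition tail_defect :: "((nat \<Rightarrow> 'e) \<Rightarrow> real) \<Rightarrow> nat \<Rightarrow> real" where
  "tail_defect h m = (\<integral>\<omega>. \<bar>h (hybrid {..<m} \<omega>) - h (hybrid UNIV \<omega>)\<bar> \<partial>R)"

definition tail_negligible :: "((nat \<Rightarrow> 'e) \<Rightarrow> real) \<Rightarrow> bool" where
  "tail_negligible h \<longleftrightarrow> integrable P h \<and> tail_defect h \<longlonglongrightarrow> 0"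

lemma tail_defect_nonneg: "0 \<le> tail_defect h m"
  unfolding tail_defect_def by (rule Bochner_Integration.integral_nonneg) simp

lemma tail_negligible_add:
  assumes "tail_negligible a" "tail_negligible b"
  shows "tail_negligible (\<lambda>x. a x + b x)"
proof -
  have i[simp]: "integrable P a" "integrable P b" using assms by (auto simp: tail_negligible_def)
  have [simp]: "integrable R (\<lambda>\<omega>. a (hybrid J \<omega>))" "integrable R (\<lambda>\<omega>. b (hybrid J \<omega>))" for J
    by (intro integrable_hybridI i)+
  have le: "tail_defect (\<lambda>x. a x + b x) m \<le> tail_defect a m + tail_defect b m" for m
  proof -
    have "tail_defect (\<lambda>x. a x + b x) m
       \<le> (\<integral>\<omega>. \<bar>a (hybrid {..<m} \<omega>) - a (hybrid UNIV \<omega>)\<bar> + \<bar>b (hybrid {..<m} \<omega>) - b (hybrid UNIV \<omega>)\<bar> \<partial>R)"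
      unfolding tail_defect_def by (rule integral_mono) auto
    then show ?thesis by (simp add: tail_defect_def)
  qed
  have "(\<lambda>m. tail_defect a m + tail_defect b m) \<longlonglongrightarrow> 0"
    using assms by (intro tendsto_add_zero) (simp_all add: tail_negligible_def)
  then have "tail_defect (\<lambda>x. a x + b x) \<longlonglongrightarrow> 0"
    by (rule tendsto_sandwich[OF always_eventually always_eventually tendsto_const, rotated 2]) (simp_all add: tail_defect_nonneg le)
  then show ?thesis by (simp add: tail_negligible_def)
qed

lemma tail_negligible_cmult:
  assumes "tail_negligible a" shows "tail_negligible (\<lambda>x. a x * c)"
proof -
  have "\<bar>a x * c - a y * c\<bar> = \<bar>a x - a y\<bar> * \<bar>c\<bar>" for x y
    by (simp add: abs_mult left_diff_distrib[symmetric])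
  then have "tail_defect (\<lambda>x. a x * c) = (\<lambda>m. tail_defect a m * \<bar>c\<bar>)"
    by (simp add: tail_defect_def fun_eq_iff)
  then show ?thesis using assms by (simp add: tail_negligible_def tendsto_mult_left_zero)
qed

lemma tail_negligible_lim:
  assumes s: "\<And>k. tail_negligible (s k)" and h: "integrable P h"
    and lim: "(\<lambda>k. \<integral>x. \<bar>s k x - h x\<bar> \<partial>P) \<longlonglongrightarrow> 0"
  shows "tail_negligible h"
  unfolding tail_negligible_def
proof (intro conjI h, rule LIMSEQ_I)
  fix r :: real assume "r > 0"
  then obtain k where k: "(\<integral>x. \<bar>s k x - h x\<bar> \<partial>P) < r / 4"
    using order_tendstoD(2)[OF lim, of "r/4"] by (auto simp: eventually_sequentially)
  have "tail_defect (s k) \<longlonglongrightarrow> 0" using s by (simp add: tail_negligible_def)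
  then obtain m0 where m0: "\<And>m. m \<ge> m0 \<Longrightarrow> tail_defect (s k) m < r / 4"
    using order_tendstoD(2)[of _ 0 sequentially "r/4"] \<open>r > 0\<close> by (auto simp: eventually_sequentially)
  have sk[simp]: "integrable P (s k)" using s by (simp add: tail_negligible_def)
  note [measurable] = borel_measurable_integrable[OF sk] borel_measurable_integrable[OF h]
  have [simp]: "integrable R (\<lambda>\<omega>. s k (hybrid J \<omega>))" "integrable R (\<lambda>\<omega>. h (hybrid J \<omega>))" for J
    by (intro integrable_hybridI h sk)+
  \<comment> \<open>Every hybrid has law \<open>P\<close>, so the approximation error is the same
    for all \<open>J\<close>; hence one \<open>k\<close> serves all \<open>m\<close>.\<close>
  have d: "(\<integral>\<omega>. \<bar>s k (hybrid J \<omega>) - h (hybrid J \<omega>)\<bar> \<partial>R) < r/4" for J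
    using k by (subst integral_hybrid[of "\<lambda>x. \<bar>s k x - h x\<bar>"]) auto
  have "norm (tail_defect h m - 0) < r" if "m \<ge> m0" for m
  proof -
    have "tail_defect h m \<le>
       (\<integral>\<omega>. \<bar>s k (hybrid {..<m} \<omega>) - h (hybrid {..<m} \<omega>)\<bar> + \<bar>s k (hybrid {..<m} \<omega>) - s k (hybrid UNIV \<omega>)\<bar>
          + \<bar>s k (hybrid UNIV \<omega>) - h (hybrid UNIV \<omega>)\<bar> \<partial>R)"
      unfolding tail_defect_def by (rule integral_mono) auto
    also have "\<dots> = (\<integral>\<omega>. \<bar>s k (hybrid {..<m} \<omega>) - h (hybrid {..<m} \<omega>)\<bar> \<partial>R) + tail_defect (s k) m
          + (\<integral>\<omega>. \<bar>s k (hybrid UNIV \<omega>) - h (hybrid UNIV \<omega>)\<bar> \<partial>R)"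
      by (simp add: tail_defect_def)
    also have "\<dots> < r" using d[of "{..<m}"] d[of UNIV] m0[OF that] \<open>r > 0\<close> by linarith
    finally show ?thesis using tail_defect_nonneg[of h m] by simp
  qed
  then show "\<exists>m0. \<forall>m\<ge>m0. norm (tail_defect h m - 0) < r" by blast
qed

text \<open>Cylinders form an intersection-stable generator, a complement has the same defect, and a
  countable disjoint union is an L1 limit of finite ones.\<close>

lemma tail_negligible_indicator:
  assumes "A \<in> sets P" shows "tail_negligible (indicator A)"
proof -
  have hs: "hybrid J \<omega> \<in> space P" if "\<omega> \<in> space R" for J \<omega>
    using that by (auto simp: space_PiM hybrid_def)
  have "A \<in> sigma_sets (\<Pi>\<^sub>E i\<in>UNIV. space N) (prod_algebra UNIV (\<lambda>_. N))"
    using assms by (simp add: sets_PiM)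
  then show ?thesis
  proof (induction rule: sigma_sets_induct_disjoint[OF Int_stable_prod_algebra prod_algebra_sets_into_space, consumes 1,
      case_names basic empty compl union])
    case (basic A)
    then obtain J X where J: "finite J" "A = prod_emb UNIV (\<lambda>_. N) J (Pi\<^sub>E J X)" "X \<in> (\<Pi> j\<in>J. sets N)"
      by (auto elim!: prod_algebraE)
    have A: "A \<in> sets P" using basic by (simp add: sets_PiM)
    \<comment> \<open>A cylinder reads finitely many coordinates; as soon as all of them lie below
      \<open>m\<close>, the hybrids for \<open>{..<m}\<close> and \<open>UNIV\<close> agree on
      it.\<close>
    obtain m0 where m0: "J \<subseteq> {..<m0}" using J(1) finite_nat_iff_bounded by auto
    have "\<forall>\<^sub>F m in sequentially. tail_defect (indicator A) m = 0"
      using eventually_ge_at_top[of m0]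
    proof eventually_elim
      case (elim m)
      have "(hybrid {..<m} \<omega> \<in> A) = (hybrid UNIV \<omega> \<in> A)" if "\<omega> \<in> space R" for \<omega>
      proof -
        have "restrict (hybrid {..<m} \<omega>) J = restrict (hybrid UNIV \<omega>) J"
          using m0 elim by (intro restrict_ext) (auto simp: hybrid_def)
        then show ?thesis using hs[OF that] by (simp add: J(2) prod_emb_def space_PiM)
      qed
      then have "(\<integral>\<omega>. \<bar>indicator A (hybrid {..<m} \<omega>) - indicator A (hybrid UNIV \<omega>)\<bar> \<partial>R) = (\<integral>\<omega>. (0::real) \<partial>R)"
        by (intro Bochner_Integration.integral_cong) (auto simp: indicator_def)
      then show ?case by (simp add: tail_defect_def)
    qed
    then show ?case using A by (simp add: tail_negligible_def tendsto_eventually P.emeasure_eq_measure)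
  next
    case empty
    show ?case by (simp add: tail_negligible_def tail_defect_def[abs_def])
  next
    case (compl A)
    have A[measurable]: "A \<in> sets P" using compl by (simp add: sets_PiM)
    have e: "(\<Pi>\<^sub>E i\<in>UNIV. space N) = space P" by (simp add: space_PiM)
    have "(\<integral>\<omega>. \<bar>indicator (space P - A) (hybrid {..<m} \<omega>) - indicator (space P - A) (hybrid UNIV \<omega>)\<bar> \<partial>R) =
       (\<integral>\<omega>. \<bar>indicator A (hybrid {..<m} \<omega>) - indicator A (hybrid UNIV \<omega>) :: real\<bar> \<partial>R)" for m
      by (rule Bochner_Integration.integral_cong) (use hs in \<open>auto simp: indicator_def\<close>)
    then show ?case using compl.IH A unfolding e
      by (simp add: tail_negligible_def tail_defect_def[abs_def] P.emeasure_eq_measure)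
  next
    case (union A)
    have A[measurable]: "A i \<in> sets P" for i using union by (auto simp: sets_PiM)
    have fin: "tail_negligible (indicator (\<Union>i<k. A i))" for k
    proof (induction k)
      case 0 show ?case by (simp add: tail_negligible_def tail_defect_def[abs_def])
    next
      case (Suc k)
      have "indicator (\<Union>i<Suc k. A i) x = indicator (\<Union>i<k. A i) x + (indicator (A k) x :: real)" for x
      proof -
        have "x \<notin> A i" if "x \<in> A k" "i < k" for i
          using union(1) that by (auto simp: disjoint_family_on_def dest: spec[of _ k] spec[of _ i])
        then show ?thesis by (auto simp: lessThan_Suc split: split_indicator)
      qed
      then show ?case using tail_negligible_add[OF Suc union.IH[of k]] by presburger
    qed
    show ?case
    proof (rule tail_negligible_lim[OF fin])
      show "integrable P (indicator (\<Union> (range A)) :: _ \<Rightarrow> real)" by (simp add: P.emeasure_eq_measure)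
      have "(\<lambda>k. \<integral>x. \<bar>indicator (\<Union>i<k. A i) x - indicator (\<Union> (range A)) x\<bar> \<partial>P) \<longlonglongrightarrow> (\<integral>x. (0::real) \<partial>P)"
      proof (rule integral_dominated_convergence[where w="\<lambda>_. 1"], goal_cases)
        case 4 show ?case
        proof (intro AE_I2)
          fix x
          have "\<forall>\<^sub>F k in sequentially. \<bar>indicator (\<Union>i<k. A i) x - indicator (\<Union> (range A)) x\<bar> = (0::real)"
          proof (cases "x \<in> \<Union> (range A)")
            case True
            then obtain i where "x \<in> A i" by auto
            then show ?thesis
              by (intro eventually_mono[OF eventually_gt_at_top[of i]]) (auto simp: indicator_def)
          qed (auto simp: indicator_def)
          then show "(\<lambda>k. \<bar>indicator (\<Union>i<k. A i) x - indicator (\<Union> (range A)) x\<bar>) \<longlonglongrightarrow> (0::real)"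
            by (rule tendsto_eventually)
        qed
      next
        case 5 show ?case by (intro AE_I2) (simp split: split_indicator)
      qed simp_all
      then show "(\<lambda>k. \<integral>x. \<bar>indicator (\<Union>i<k. A i) x - indicator (\<Union> (range A)) x\<bar> \<partial>P) \<longlonglongrightarrow> (0::real)" by simp
    qed
  qed
qed

lemma tail_negligible:
  assumes "integrable P h" shows "tail_negligible h"
  using assms
proof induction
  case (base A c)
  then show ?case using tail_negligible_cmult[OF tail_negligible_indicator, of A c] by simp
next
  case (add f g)
  then show ?case by (intro tail_negligible_add)
next
  case (lim f s)
  show ?case
  proof (rule tail_negligible_lim[OF lim.IH \<open>integrable P f\<close>])
    note [measurable] = borel_measurable_integrable[OF lim(1)] borel_measurable_integrable[OF \<open>integrable P f\<close>]
    have "(\<lambda>k. \<integral>x. \<bar>s k x - f x\<bar> \<partial>P) \<longlonglongrightarrow> (\<integral>x. 0 \<partial>P)"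
    proof (rule integral_dominated_convergence[where w="\<lambda>x. 3 * \<bar>f x\<bar>"], goal_cases)
      case 1 show ?case by (rule borel_measurable_const)
    next
      case 2 show ?case by measurable
    next
      case 3 show ?case using \<open>integrable P f\<close> by simp
    next
      case 4 show ?case
      proof (intro AE_I2)
        fix x assume "x \<in> space P"
        then have "(\<lambda>k. s k x) \<longlonglongrightarrow> f x" by (rule lim(2))
        then show "(\<lambda>k. \<bar>s k x - f x\<bar>) \<longlonglongrightarrow> 0" by (intro tendsto_rabs_zero LIM_zero)
      qed
    next
      case (5 i) show ?case
      proof (intro AE_I2)
        fix x assume "x \<in> space P"
        from lim(3)[OF this, of i] have "\<bar>s i x\<bar> \<le> 2 * \<bar>f x\<bar>" unfolding real_norm_def .
        then show "norm \<bar>s i x - f x\<bar> \<le> 3 * \<bar>f x\<bar>" by simp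
      qed
    qed
    then show "(\<lambda>k. \<integral>x. \<bar>s k x - f x\<bar> \<partial>P) \<longlonglongrightarrow> 0" by simp
  qed
qed

end

section \<open>The Efron--Stein inequality for infinitely many coordinates\<close>

context iid_pair
begin

lemma indep_hybrid: "R.indep_var P (hybrid {}) P (hybrid UNIV)"
proof -
  let ?A = "range (\<lambda>i::nat. (i, False))" and ?B = "range (\<lambda>i::nat. (i, True))"
  have rv: "(\<lambda>\<omega>. \<omega> i) \<in> measurable R N" for i by measurable
  have "distr R N (\<lambda>\<omega>. \<omega> i) = N" for i
    using distr_PiM_component[of UNIV "\<lambda>_. N" i] prob_space_axioms by auto
  then have "R.indep_vars (\<lambda>_. N) (\<lambda>i \<omega>. \<omega> i) UNIV"
    by (subst R.indep_vars_iff_distr_eq_PiM) (auto simp: restrict_def rv distr_id2)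
  then have "R.indep_var (PiM ?A (\<lambda>_. N)) (\<lambda>\<omega>. restrict (\<lambda>i. \<omega> i) ?A) (PiM ?B (\<lambda>_. N)) (\<lambda>\<omega>. restrict (\<lambda>i. \<omega> i) ?B)"
    by (rule R.indep_var_restrict) auto
  then have "R.indep_var P ((\<lambda>v i. v (i, False)) \<circ> (\<lambda>\<omega>. restrict (\<lambda>i. \<omega> i) ?A)) P ((\<lambda>v i. v (i, True)) \<circ> (\<lambda>\<omega>. restrict (\<lambda>i. \<omega> i) ?B))"
    by (rule R.indep_var_compose) (rule measurable_PiM_single'; auto simp: space_PiM)+
  moreover have "hybrid {} = (\<lambda>\<omega> i. \<omega> (i, False) :: 'e)" "hybrid UNIV = (\<lambda>\<omega> i. \<omega> (i, True) :: 'e)"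
    by (auto simp: hybrid_def fun_eq_iff)
  ultimately show ?thesis by (simp add: comp_def)
qed

lemma distr_hybrid_pair:
  "distr R (P \<Otimes>\<^sub>M P) (\<lambda>\<omega>. (hybrid {} \<omega>, hybrid UNIV \<omega>)) = P \<Otimes>\<^sub>M P"
proof -
  have "distr R P (hybrid J) = P" for J
    unfolding hybrid_def by (intro distr_PiM_UNIV_reindex prob_space_axioms) (auto intro: inj_onI)
  then show ?thesis using indep_hybrid by (simp add: R.indep_var_distribution_eq)
qed

lemma integral_hybrid_mult:
  fixes h :: "(nat \<Rightarrow> 'e) \<Rightarrow> real"
  assumes h: "integrable P h"
  shows "(\<integral>\<omega>. h (hybrid {} \<omega>) * h (hybrid UNIV \<omega>) \<partial>R) = (\<integral>x. h x \<partial>P) * (\<integral>x. h x \<partial>P)"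
proof -
  note m = borel_measurable_integrable[OF h]
  have "R.indep_var borel (h \<circ> hybrid {}) borel (h \<circ> hybrid UNIV)"
    by (rule R.indep_var_compose[OF indep_hybrid m m])
  then show ?thesis
    using R.indep_var_lebesgue_integral[of "h \<circ> hybrid {}" "h \<circ> hybrid UNIV"] integrable_hybridI[OF h]
    by (simp add: comp_def integral_hybrid[OF m])
qed

text \<open>Translates the coupling behind the dependence coefficients, a fresh draw from
  \<open>N\<close> put into coordinate \<open>j\<close>, into a pair of hybrids. It works because
  \<open>hybrid {j}\<close> reads only coordinate \<open>j\<close> of the second copy, and that
  coordinate is independent of the whole first copy.\<close>

lemma integral_resample_eq:
  fixes h :: "(nat \<Rightarrow> 'e) \<times> (nat \<Rightarrow> 'e) \<Rightarrow> ennreal"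
  assumes [measurable]: "h \<in> borel_measurable (P \<Otimes>\<^sub>M P)"
  shows "(\<integral>\<^sup>+z. h (fst z, (fst z)(j := snd z)) \<partial>(P \<Otimes>\<^sub>M N)) = (\<integral>\<^sup>+\<omega>. h (hybrid {} \<omega>, hybrid {j} \<omega>) \<partial>R)"
proof -
  have upd[measurable]: "(\<lambda>z. (fst z)(j := snd z)) \<in> measurable (P \<Otimes>\<^sub>M N) P"
    by (rule measurable_PiM_single') (auto simp: space_PiM space_pair_measure)
  have d: "distr P N (\<lambda>x. x j) = N"
    using distr_PiM_component[of UNIV "\<lambda>_. N" j] prob_space_axioms by auto
  have "P \<Otimes>\<^sub>M N = distr P P (\<lambda>x. x) \<Otimes>\<^sub>M distr P N (\<lambda>x. x j)"
    by (simp add: d distr_id)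
  also have "\<dots> = distr (P \<Otimes>\<^sub>M P) (P \<Otimes>\<^sub>M N) (\<lambda>(x, y). (x, y j))"
    by (rule pair_measure_distr) (auto simp: d sigma_finite_measure_axioms)
  also have "\<dots> = distr R (P \<Otimes>\<^sub>M N) (\<lambda>\<omega>. (hybrid {} \<omega>, hybrid UNIV \<omega> j))"
    by (subst distr_hybrid_pair[symmetric], subst distr_distr) (auto simp: comp_def)
  finally have e: "P \<Otimes>\<^sub>M N = distr R (P \<Otimes>\<^sub>M N) (\<lambda>\<omega>. (hybrid {} \<omega>, hybrid UNIV \<omega> j))" .
  have u: "(hybrid {} \<omega>)(j := hybrid UNIV \<omega> j) = hybrid {j} \<omega>" for \<omega> :: "nat \<times> bool \<Rightarrow> 'e"
    by (auto simp: hybrid_def fun_eq_iff)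
  have "(\<integral>\<^sup>+z. h (fst z, (fst z)(j := snd z)) \<partial>(P \<Otimes>\<^sub>M N)) =
    (\<integral>\<^sup>+z. h (fst z, (fst z)(j := snd z)) \<partial>distr R (P \<Otimes>\<^sub>M N) (\<lambda>\<omega>. (hybrid {} \<omega>, hybrid UNIV \<omega> j)))"
    using e by simp
  also have "\<dots> = (\<integral>\<^sup>+\<omega>. h (hybrid {} \<omega>, (hybrid {} \<omega>)(j := hybrid UNIV \<omega> j)) \<partial>R)"
    by (subst nn_integral_distr) auto
  finally show ?thesis by (simp only: u)
qed

text \<open>The Efron-Stein influence of coordinate \<open>j\<close>: twice the expected conditional
  variance of \<open>h\<close> given all other coordinates. This is the origin of the factor 1/2 in
  the variance bound.\<close>

definition resample_sq :: "((nat \<Rightarrow> 'e) \<Rightarrow> real) \<Rightarrow> nat \<Rightarrow> real" where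
  "resample_sq h j = (\<integral>\<omega>. (h (hybrid {} \<omega>) - h (hybrid {j} \<omega>))\<^sup>2 \<partial>R)"

text \<open>
  The variance telescopes over the hybrids that interpolate between the two copies, and exchanging
  coordinate \<open>j\<close> of the two copies symmetrises the \<open>j\<close>-th term.
\<close>

lemma efron_stein_bounded:
  fixes h :: "(nat \<Rightarrow> 'e) \<Rightarrow> real"
  assumes [measurable]: "h \<in> borel_measurable P" and K: "\<And>x. \<bar>h x\<bar> \<le> K"
    and a: "\<And>j. resample_sq h j \<le> a j" "summable a"
  shows "P.variance h \<le> (\<Sum>j. a j) / 2"
proof -
  have K0: "K \<ge> 0" using K[of undefined] by linarith
  have KK: "\<bar>h x * h y\<bar> \<le> K * K" for x y
    unfolding abs_mult by (intro mult_mono K K0) simp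
  have int1[simp]: "integrable R (\<lambda>\<omega>. h (hybrid A \<omega>))" for A
    by (rule R.integrable_const_bound[of _ K]) (auto simp: K)
  have int2[simp]: "integrable R (\<lambda>\<omega>. h (hybrid A \<omega>) * h (hybrid B \<omega>))" for A B
    by (rule R.integrable_const_bound[of _ "K * K"]) (auto intro!: AE_I2 KK)
  have intP[simp]: "integrable P h" by (rule P.integrable_const_bound[of _ K]) (auto simp: K)
  have intP2[simp]: "integrable P (\<lambda>x. (h x)\<^sup>2)"
    unfolding power2_eq_square by (rule P.integrable_const_bound[of _ "K * K"]) (auto intro!: AE_I2 abs_le_D1[OF KK])
  \<comment> \<open>Increments of the path from \<open>E {} {}\<close>, the second moment, to
    \<open>E {} {..<m}\<close>; the latter tends to \<open>E {} UNIV\<close>, which is the squared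
    mean because the copies are independent.\<close>
  define T where "T j = (\<integral>\<omega>. h (hybrid {} \<omega>) * (h (hybrid {..<j} \<omega>) - h (hybrid {..<Suc j} \<omega>)) \<partial>R)" for j
  define E where "E A B = (\<integral>\<omega>. h (hybrid A \<omega>) * h (hybrid B \<omega>) \<partial>R)" for A B
  have Tsum: "T j = E {} {..<j} - E {} {..<Suc j}" for j
    unfolding T_def E_def right_diff_distrib by (intro Bochner_Integration.integral_diff int2)
  have Eswap: "E A B = E {i. (i \<in> A) \<noteq> (i \<in> J)} {i. (i \<in> B) \<noteq> (i \<in> J)}" for A B J
    unfolding E_def by (subst integral_swap[of _ J, symmetric]) (auto simp: hybrid_swap)
  have Esq: "(\<integral>\<omega>. (h (hybrid A \<omega>) - h (hybrid B \<omega>))\<^sup>2 \<partial>R) = E A A - 2 * E A B + E B B" for A B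
  proof -
    have "(\<integral>\<omega>. (h (hybrid A \<omega>) - h (hybrid B \<omega>))\<^sup>2 \<partial>R) = (\<integral>\<omega>. h (hybrid A \<omega>) * h (hybrid A \<omega>) - 2 * (h (hybrid A \<omega>) * h (hybrid B \<omega>)) + h (hybrid B \<omega>) * h (hybrid B \<omega>) \<partial>R)"
      by (rule Bochner_Integration.integral_cong) (auto simp: power2_eq_square algebra_simps)
    then show ?thesis by (simp add: E_def)
  qed
  have same: "E A A = E {} {}" for A using Eswap[of A A A] by simp
  have s1: "{i. (i \<in> {}) \<noteq> (i \<in> {j})} = {j}" "{i. (i \<in> {..<j}) \<noteq> (i \<in> {j})} = {..<Suc j}"
    "{i. (i \<in> {..<Suc j}) \<noteq> (i \<in> {j})} = {..<j}" "{i. (i \<in> {}) \<noteq> (i \<in> {..<j})} = {..<j}"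
    "{i. (i \<in> {j}) \<noteq> (i \<in> {..<j})} = {..<Suc j}" for j :: nat by auto
  have Tle: "T j \<le> a j / 2" for j
  proof -
    have t: "T j = E {j} {..<Suc j} - E {j} {..<j}"
      unfolding Tsum using Eswap[of "{}" "{..<j}" "{j}"] Eswap[of "{}" "{..<Suc j}" "{j}"] unfolding s1 by simp
    have c: "E {..<j} {..<Suc j} = E {} {j}"
      using Eswap[of "{}" "{j}" "{..<j}"] unfolding s1 by simp
    \<comment> \<open>This is \<open>2 * u * v \<le> u\<^sup>2 + v\<^sup>2\<close> for the two
      increments across coordinate \<open>j\<close>: by \<open>t\<close> their product has mean
      \<open>2 * T j\<close>, and by the swaps both squares have mean
      \<open>resample_sq h j\<close>.\<close>
    have "0 \<le> (\<integral>\<omega>. ((h (hybrid {} \<omega>) - h (hybrid {j} \<omega>)) - (h (hybrid {..<j} \<omega>) - h (hybrid {..<Suc j} \<omega>)))\<^sup>2 \<partial>R)"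
      by simp
    also have "\<dots> = (\<integral>\<omega>. h (hybrid {} \<omega>) * h (hybrid {} \<omega>) + h (hybrid {j} \<omega>) * h (hybrid {j} \<omega>) + h (hybrid {..<j} \<omega>) * h (hybrid {..<j} \<omega>) + h (hybrid {..<Suc j} \<omega>) * h (hybrid {..<Suc j} \<omega>)
        - 2 * (h (hybrid {} \<omega>) * h (hybrid {j} \<omega>)) - 2 * (h (hybrid {} \<omega>) * h (hybrid {..<j} \<omega>)) + 2 * (h (hybrid {} \<omega>) * h (hybrid {..<Suc j} \<omega>))
        + 2 * (h (hybrid {j} \<omega>) * h (hybrid {..<j} \<omega>)) - 2 * (h (hybrid {j} \<omega>) * h (hybrid {..<Suc j} \<omega>)) - 2 * (h (hybrid {..<j} \<omega>) * h (hybrid {..<Suc j} \<omega>)) \<partial>R)"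
      by (rule Bochner_Integration.integral_cong) (auto simp: power2_eq_square algebra_simps)
    also have "\<dots> = E {} {} + E {j} {j} + E {..<j} {..<j} + E {..<Suc j} {..<Suc j} - 2 * E {} {j} - 2 * E {} {..<j} + 2 * E {} {..<Suc j} + 2 * E {j} {..<j} - 2 * E {j} {..<Suc j} - 2 * E {..<j} {..<Suc j}"
      unfolding E_def by simp
    also have "\<dots> = 2 * (E {} {} - 2 * E {} {j} + E {j} {j}) - 4 * T j"
      using t c unfolding Tsum same[of "{j}"] same[of "{..<j}"] same[of "{..<Suc j}"] by simp
    finally have "2 * T j \<le> resample_sq h j" unfolding resample_sq_def Esq by simp
    then show ?thesis using a(1)[of j] by simp
  qed
  have a0: "a j \<ge> 0" for j
  proof -
    have "0 \<le> resample_sq h j" unfolding resample_sq_def by simp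
    then show ?thesis using a(1)[of j] by simp
  qed
  have telescope: "E {} {} - E {} {..<m} = (\<Sum>j<m. T j)" for m
    unfolding Tsum by (subst sum_lessThan_telescope') simp
  have var: "P.variance h = E {} {} - E {} UNIV"
  proof -
    have "(\<integral>\<omega>. (\<lambda>x. (h x)\<^sup>2) (hybrid {} \<omega>) \<partial>R) = (\<integral>x. (h x)\<^sup>2 \<partial>P)" by (rule integral_hybrid) measurable
    then have "(\<integral>x. (h x)\<^sup>2 \<partial>P) = E {} {}" by (simp add: E_def power2_eq_square)
    then show ?thesis
      using integral_hybrid_mult[OF intP] P.variance_eq[OF intP intP2] by (simp add: E_def power2_eq_square)
  qed
  define r where "r = tail_defect h"
  have r: "r \<longlonglongrightarrow> 0" using tail_negligible[OF intP] unfolding tail_negligible_def r_def by simp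
  have "P.variance h \<le> (\<Sum>j. a j) / 2 + K * r m" for m
  proof -
    \<comment> \<open>The bound \<open>K\<close> on \<open>h\<close> lets the L1 tail defect control
      the missing remainder of the telescoping sum.\<close>
    have "E {} {..<m} - E {} UNIV = (\<integral>\<omega>. h (hybrid {} \<omega>) * (h (hybrid {..<m} \<omega>) - h (hybrid UNIV \<omega>)) \<partial>R)"
      unfolding E_def right_diff_distrib by (intro Bochner_Integration.integral_diff[symmetric] int2)
    also have "\<dots> \<le> (\<integral>\<omega>. K * \<bar>h (hybrid {..<m} \<omega>) - h (hybrid UNIV \<omega>)\<bar> \<partial>R)"
    proof (rule integral_mono)
      show "integrable R (\<lambda>\<omega>. h (hybrid {} \<omega>) * (h (hybrid {..<m} \<omega>) - h (hybrid UNIV \<omega>)))"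
        unfolding right_diff_distrib by (intro Bochner_Integration.integrable_diff int2)
      fix \<omega>
      have "h (hybrid {} \<omega>) * (h (hybrid {..<m} \<omega>) - h (hybrid UNIV \<omega>)) \<le> \<bar>h (hybrid {} \<omega>)\<bar> * \<bar>h (hybrid {..<m} \<omega>) - h (hybrid UNIV \<omega>)\<bar>"
        by (metis abs_ge_self abs_mult)
      also have "\<dots> \<le> K * \<bar>h (hybrid {..<m} \<omega>) - h (hybrid UNIV \<omega>)\<bar>" by (intro mult_right_mono K) simp
      finally show "h (hybrid {} \<omega>) * (h (hybrid {..<m} \<omega>) - h (hybrid UNIV \<omega>)) \<le> K * \<bar>h (hybrid {..<m} \<omega>) - h (hybrid UNIV \<omega>)\<bar>" .
    qed simp
    also have "\<dots> = K * r m" by (simp add: r_def tail_defect_def)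
    finally have "E {} {..<m} - E {} UNIV \<le> K * r m" .
    moreover have "(\<Sum>j<m. T j) \<le> (\<Sum>j<m. a j / 2)" by (intro sum_mono Tle)
    moreover have "(\<Sum>j<m. a j / 2) \<le> (\<Sum>j. a j) / 2"
      using sum_le_suminf[OF a(2), of "{..<m}"] a0 by (simp add: sum_divide_distrib[symmetric])
    ultimately show ?thesis using telescope[of m] var by linarith
  qed
  moreover have "(\<lambda>m. (\<Sum>j. a j) / 2 + K * r m) \<longlonglongrightarrow> (\<Sum>j. a j) / 2 + K * 0"
    by (intro tendsto_intros r)
  ultimately have "P.variance h \<le> (\<Sum>j. a j) / 2 + K * 0"
    by (intro LIMSEQ_le_const[where X="\<lambda>m. (\<Sum>j. a j) / 2 + K * r m"]) auto
  then show ?thesis by simp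
qed

lemma integrable_hybrid_diff_square:
  fixes h :: "(nat \<Rightarrow> 'e) \<Rightarrow> real"
  assumes [measurable]: "h \<in> borel_measurable P" and h2: "integrable P (\<lambda>x. (h x)\<^sup>2)"
  shows "integrable R (\<lambda>\<omega>. (h (hybrid A \<omega>) - h (hybrid B \<omega>))\<^sup>2)"
proof (rule Bochner_Integration.integrable_bound)
  show "integrable R (\<lambda>\<omega>. 2 * (h (hybrid A \<omega>))\<^sup>2 + 2 * (h (hybrid B \<omega>))\<^sup>2)"
    using integrable_hybridI[OF h2] by simp
  have "(a - b)\<^sup>2 \<le> 2 * a\<^sup>2 + 2 * b\<^sup>2" for a b :: real
    using zero_le_power2[of "a + b"] by (simp add: power2_sum power2_diff)
  then show "AE \<omega> in R. norm ((h (hybrid A \<omega>) - h (hybrid B \<omega>))\<^sup>2) \<le> norm (2 * (h (hybrid A \<omega>))\<^sup>2 + 2 * (h (hybrid B \<omega>))\<^sup>2)"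
    by (intro AE_I2) simp
qed simp

text \<open>Clipping at level \<open>K\<close> is 1-Lipschitz, so it does not increase any
  influence; the first two moments of the clipped functions converge by domination.\<close>

lemma efron_stein:
  fixes h :: "(nat \<Rightarrow> 'e) \<Rightarrow> real"
  assumes [measurable]: "h \<in> borel_measurable P" and h2: "integrable P (\<lambda>x. (h x)\<^sup>2)"
    and a: "\<And>j. resample_sq h j \<le> a j" "summable a"
  shows "P.variance h \<le> (\<Sum>j. a j) / 2"
proof -
  define c where "c K x = max (- real K) (min (h x) (real K))" for K :: nat and x
  have [measurable]: "c K \<in> borel_measurable P" for K unfolding c_def by measurable
  have ch: "\<bar>c K x\<bar> \<le> \<bar>h x\<bar>" and cK: "\<bar>c K x\<bar> \<le> real K" for K x by (auto simp: c_def)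
  have lip: "\<bar>c K x - c K y\<bar> \<le> \<bar>h x - h y\<bar>" for K x y by (auto simp: c_def)
  have h1: "integrable P h" using P.square_integrable_imp_integrable[OF _ h2] by simp
  have i2[simp]: "integrable P (\<lambda>x. (c K x)\<^sup>2)" for K
    using ch by (intro Bochner_Integration.integrable_bound[OF h2]) (auto intro!: AE_I2 simp: abs_le_square_iff[symmetric])
  have i1[simp]: "integrable P (c K)" for K
    using ch by (intro Bochner_Integration.integrable_bound[OF h1]) (auto intro!: AE_I2)
  note idiff = integrable_hybrid_diff_square[OF assms(1) h2]
  have "P.variance (c K) \<le> (\<Sum>j. a j) / 2" for K
  proof (rule efron_stein_bounded[OF _ cK _ a(2)])
    fix j
    have le: "(c K x - c K y)\<^sup>2 \<le> (h x - h y)\<^sup>2" for x y using lip by (simp add: abs_le_square_iff[symmetric])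
    have "resample_sq (c K) j \<le> resample_sq h j"
      unfolding resample_sq_def
      by (rule integral_mono[OF Bochner_Integration.integrable_bound[OF idiff] idiff])
        (auto intro!: AE_I2 le)
    then show "resample_sq (c K) j \<le> a j" using a(1)[of j] by simp
  qed simp
  then have v: "(\<integral>x. (c K x)\<^sup>2 \<partial>P) - (\<integral>x. c K x \<partial>P)\<^sup>2 \<le> (\<Sum>j. a j) / 2" for K
    using P.variance_eq[OF i1 i2, of K] by metis
  have cl: "(\<lambda>K. c K x) \<longlonglongrightarrow> h x" for x
  proof (rule tendsto_eventually)
    obtain K0 :: nat where "\<bar>h x\<bar> \<le> real K0" using real_arch_simple by blast
    then show "\<forall>\<^sub>F K in sequentially. c K x = h x"
      by (intro eventually_mono[OF eventually_ge_at_top[of K0]]) (auto simp: c_def)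
  qed
  have "(\<lambda>K. (\<integral>x. (c K x)\<^sup>2 \<partial>P) - (\<integral>x. c K x \<partial>P)\<^sup>2) \<longlonglongrightarrow> (\<integral>x. (h x)\<^sup>2 \<partial>P) - (\<integral>x. h x \<partial>P)\<^sup>2"
  proof (intro tendsto_diff tendsto_power)
    show "(\<lambda>K. \<integral>x. (c K x)\<^sup>2 \<partial>P) \<longlonglongrightarrow> (\<integral>x. (h x)\<^sup>2 \<partial>P)"
      by (rule integral_dominated_convergence[OF _ _ h2])
        (use ch in \<open>auto intro!: AE_I2 tendsto_power cl simp: abs_le_square_iff[symmetric]\<close>)
    show "(\<lambda>K. \<integral>x. c K x \<partial>P) \<longlonglongrightarrow> (\<integral>x. h x \<partial>P)"
      by (rule integral_dominated_convergence[where w="\<lambda>x. \<bar>h x\<bar>"])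
        (use ch h1 in \<open>auto intro!: AE_I2 cl\<close>)
  qed
  then have "(\<integral>x. (h x)\<^sup>2 \<partial>P) - (\<integral>x. h x \<partial>P)\<^sup>2 \<le> (\<Sum>j. a j) / 2"
    by (rule LIMSEQ_le_const2) (use v in auto)
  then show ?thesis using P.variance_eq[OF h1 h2] by simp
qed

end

section \<open>Partial sums and locally Lipschitz functions of dependent vectors\<close>

context iid_pair
begin

lemma measurable_shift [measurable]: "(\<lambda>x l. x (l + i)) \<in> measurable P P" for i :: nat
  by (rule measurable_PiM_UNIV_reindex)

lemma
  fixes h :: "(nat \<Rightarrow> 'e) \<Rightarrow> 'b::{banach, second_countable_topology}"
  assumes "h \<in> borel_measurable P"
  shows integral_shift: "(\<integral>x. h (\<lambda>l. x (l + i)) \<partial>P) = (\<integral>x. h x \<partial>P)"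
    and integrable_shift: "integrable P (\<lambda>x. h (\<lambda>l. x (l + i))) \<longleftrightarrow> integrable P h"
proof -
  have i: "inj (\<lambda>l::nat. l + i)" by (auto intro: inj_onI)
  show "(\<integral>x. h (\<lambda>l. x (l + i)) \<partial>P) = (\<integral>x. h x \<partial>P)"
    by (rule integral_PiM_UNIV_reindex[OF prob_space_axioms i assms])
  show "integrable P (\<lambda>x. h (\<lambda>l. x (l + i))) \<longleftrightarrow> integrable P h"
    by (rule integrable_PiM_UNIV_reindex[OF prob_space_axioms i assms])
qed

text \<open>Stationarity for resampled pairs: after the first \<open>i\<close> coordinates are
  dropped, the resampled coordinate \<open>j + i\<close> sits at position \<open>j\<close>, and the
  joint law of the two copies is the same as before.\<close>

lemma
  fixes F :: "(nat \<Rightarrow> 'e) \<times> (nat \<Rightarrow> 'e) \<Rightarrow> real"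
  assumes [measurable]: "F \<in> borel_measurable (P \<Otimes>\<^sub>M P)"
  shows integral_hybrid_shift:
      "(\<integral>\<omega>. F (\<lambda>l. hybrid {} \<omega> (l + i), \<lambda>l. hybrid {j + i} \<omega> (l + i)) \<partial>R) =
       (\<integral>\<omega>. F (hybrid {} \<omega>, hybrid {j} \<omega>) \<partial>R)"
    and integrable_hybrid_shift:
      "integrable R (\<lambda>\<omega>. F (\<lambda>l. hybrid {} \<omega> (l + i), \<lambda>l. hybrid {j + i} \<omega> (l + i))) \<longleftrightarrow>
       integrable R (\<lambda>\<omega>. F (hybrid {} \<omega>, hybrid {j} \<omega>))"
proof -
  have inj: "inj (\<lambda>lb. (fst lb + i, snd lb) :: nat \<times> bool)" by (auto intro!: inj_onI simp: prod_eq_iff)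
  have m: "(\<lambda>\<omega>. F (hybrid {} \<omega>, hybrid {j} \<omega>)) \<in> borel_measurable R" by measurable
  have e: "(\<lambda>l. hybrid {} \<omega> (l + i)) = hybrid {} (\<lambda>lb. \<omega> (fst lb + i, snd lb))"
    "(\<lambda>l. hybrid {j + i} \<omega> (l + i)) = hybrid {j} (\<lambda>lb. \<omega> (fst lb + i, snd lb))" for \<omega> :: "nat \<times> bool \<Rightarrow> 'e"
    by (auto simp: hybrid_def fun_eq_iff)
  show "(\<integral>\<omega>. F (\<lambda>l. hybrid {} \<omega> (l + i), \<lambda>l. hybrid {j + i} \<omega> (l + i)) \<partial>R) =
       (\<integral>\<omega>. F (hybrid {} \<omega>, hybrid {j} \<omega>) \<partial>R)"
    unfolding e by (rule integral_PiM_UNIV_reindex[OF prob_space_axioms inj m])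
  show "integrable R (\<lambda>\<omega>. F (\<lambda>l. hybrid {} \<omega> (l + i), \<lambda>l. hybrid {j + i} \<omega> (l + i))) \<longleftrightarrow>
       integrable R (\<lambda>\<omega>. F (hybrid {} \<omega>, hybrid {j} \<omega>))"
    unfolding e by (rule integrable_PiM_UNIV_reindex[OF prob_space_axioms inj m])
qed

lemma square_sum_le_sum_square:
  fixes x :: "'i \<Rightarrow> real"
  shows "finite I \<Longrightarrow> (\<Sum>i\<in>I. x i)\<^sup>2 \<le> real (card I) * (\<Sum>i\<in>I. (x i)\<^sup>2)"
  using Cauchy_Schwarz_ineq_sum[of "\<lambda>_. 1" x I] by simp

lemma integrable_sum_square:
  fixes x :: "'i \<Rightarrow> 'a \<Rightarrow> real"
  assumes "finite I" "\<And>i. i \<in> I \<Longrightarrow> integrable M (\<lambda>w. (x i w)\<^sup>2)" "\<And>i. i \<in> I \<Longrightarrow> x i \<in> borel_measurable M"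
  shows "integrable M (\<lambda>w. (\<Sum>i\<in>I. x i w)\<^sup>2)"
proof (rule Bochner_Integration.integrable_bound)
  show "integrable M (\<lambda>w. real (card I) * (\<Sum>i\<in>I. (x i w)\<^sup>2))" using assms by auto
  show "(\<lambda>w. (\<Sum>i\<in>I. x i w)\<^sup>2) \<in> borel_measurable M" using assms by auto
  show "AE w in M. norm ((\<Sum>i\<in>I. x i w)\<^sup>2) \<le> norm (real (card I) * (\<Sum>i\<in>I. (x i w)\<^sup>2))"
    using square_sum_le_sum_square[OF assms(1)] by (intro AE_I2) (simp add: abs_of_nonneg sum_nonneg)
qed

text \<open>The \<open>i\<close>-th summand reads only coordinates from \<open>i\<close> on, so
  resampling coordinate \<open>j\<close> moves it by at most \<open>b (j - i)\<close> in L2. With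
  \<open>s\<close> the sum of these bounds over \<open>i\<close>, the influence of \<open>j\<close>
  on the whole sum is at most \<open>s * s\<close>. One factor is bounded by the total mass of
  \<open>b\<close> for every \<open>j\<close>; the other, summed over \<open>j\<close>, gives that
  mass once for each of the \<open>n\<close> summands. Hence linear growth in
  \<open>n\<close>.\<close>

lemma
  fixes G :: "(nat \<Rightarrow> 'e) \<Rightarrow> real"
  assumes G[measurable]: "G \<in> borel_measurable P" and G2: "integrable P (\<lambda>x. (G x)\<^sup>2)"
    and b: "\<And>j. 0 < b j" "summable b" and dep: "\<And>j. resample_sq G j \<le> (b j)\<^sup>2"
  shows square_integrable_partial_sum: "integrable P (\<lambda>x. (\<Sum>i<n. G (\<lambda>l. x (l + i)))\<^sup>2)"
    and variance_partial_sum: "P.variance (\<lambda>x. \<Sum>i<n. G (\<lambda>l. x (l + i))) \<le> real n * (suminf b)\<^sup>2 / 2"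
proof -
  define H where "H x = (\<Sum>i<n. G (\<lambda>l. x (l + i)))" for x
  have [measurable]: "H \<in> borel_measurable P" unfolding H_def by measurable
  have G2i: "integrable P (\<lambda>x. (G (\<lambda>l. x (l + i)))\<^sup>2)" for i
    using integrable_shift[of "\<lambda>x. (G x)\<^sup>2" i] G2 by simp
  show H2: "integrable P (\<lambda>x. (\<Sum>i<n. G (\<lambda>l. x (l + i)))\<^sup>2)"
    by (rule integrable_sum_square) (auto intro: G2i)
  define B where "B = suminf b"
  have B: "(\<Sum>i\<in>I. b i) \<le> B" if "finite I" for I
    unfolding B_def using b that by (intro sum_le_suminf) (auto simp: less_imp_le)
  have B0: "B > 0" unfolding B_def using b by (intro suminf_pos) auto
  define c where "c i j = (if i \<le> j then b (j - i) else 0)" for i j :: nat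
  have c: "c i sums B" for i
  proof -
    have "(\<lambda>j. c i (j + i)) sums B" unfolding c_def B_def using b(2) by (simp add: summable_sums)
    then show ?thesis by (subst (asm) sums_zero_iff_shift) (auto simp: c_def)
  qed
  note dG = integrable_hybrid_diff_square[OF G G2, of "{}"]
  have "resample_sq H j \<le> B * (\<Sum>i<n. c i j)" for j
  proof -
    define I where "I = {i. i < n \<and> i \<le> j}"
    have I: "finite I" unfolding I_def by simp
    define D where "D i \<omega> = G (\<lambda>l. hybrid {} \<omega> (l + i)) - G (\<lambda>l. hybrid {j} \<omega> (l + i))" for i \<omega>
    have D0: "D i \<omega> = 0" if "i > j" for i \<omega>
    proof -
      have "(\<lambda>l. hybrid {j} \<omega> (l + i)) = (\<lambda>l. hybrid {} \<omega> (l + i))" using that by (auto simp: hybrid_def)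
      then show ?thesis by (simp add: D_def)
    qed
    have Dint: "integrable R (\<lambda>\<omega>. (D i \<omega>)\<^sup>2)" and Dle: "(\<integral>\<omega>. (D i \<omega>)\<^sup>2 \<partial>R) \<le> (b (j - i))\<^sup>2" if "i \<in> I" for i
    proof -
      have ji: "j - i + i = j" using that by (simp add: I_def)
      have m: "(\<lambda>z. (G (fst z) - G (snd z))\<^sup>2) \<in> borel_measurable (P \<Otimes>\<^sub>M P)" by measurable
      show "integrable R (\<lambda>\<omega>. (D i \<omega>)\<^sup>2)"
        using integrable_hybrid_shift[OF m, of i "j - i"] dG[of "{j - i}"] unfolding D_def fst_conv snd_conv ji by simp
      have "(\<integral>\<omega>. (D i \<omega>)\<^sup>2 \<partial>R) = resample_sq G (j - i)"
        using integral_hybrid_shift[OF m, of i "j - i"] unfolding D_def fst_conv snd_conv ji resample_sq_def by simp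
      then show "(\<integral>\<omega>. (D i \<omega>)\<^sup>2 \<partial>R) \<le> (b (j - i))\<^sup>2" using dep[of "j - i"] by simp
    qed
    have HD: "H (hybrid {} \<omega>) - H (hybrid {j} \<omega>) = (\<Sum>i\<in>I. D i \<omega>)" for \<omega>
    proof -
      have "H (hybrid {} \<omega>) - H (hybrid {j} \<omega>) = (\<Sum>i<n. D i \<omega>)"
        unfolding H_def D_def by (simp add: sum_subtractf)
      also have "\<dots> = (\<Sum>i\<in>I. D i \<omega>)"
        using D0 not_le by (intro sum.mono_neutral_right) (auto simp: I_def)
      finally show ?thesis .
    qed
    define s where "s = (\<Sum>i\<in>I. b (j - i))"
    \<comment> \<open>Cauchy-Schwarz with weights \<open>b (j - i)\<close> instead of equal weights:
      this avoids a factor \<open>n\<close>, and it is where strict positivity of \<open>b\<close>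
      enters.\<close>
    have CS: "(\<Sum>i\<in>I. D i \<omega>)\<^sup>2 \<le> s * (\<Sum>i\<in>I. (D i \<omega>)\<^sup>2 / b (j - i))" for \<omega>
    proof -
      have "(\<Sum>i\<in>I. D i \<omega>) = (\<Sum>i\<in>I. sqrt (b (j - i)) * (D i \<omega> / sqrt (b (j - i))))"
        using b(1) by (intro sum.cong refl) (simp add: less_imp_neq[symmetric])
      also have "\<dots>\<^sup>2 \<le> (\<Sum>i\<in>I. (sqrt (b (j - i)))\<^sup>2) * (\<Sum>i\<in>I. (D i \<omega> / sqrt (b (j - i)))\<^sup>2)"
        by (rule Cauchy_Schwarz_ineq_sum)
      also have "\<dots> = s * (\<Sum>i\<in>I. (D i \<omega>)\<^sup>2 / b (j - i))"
        using b(1) by (simp add: s_def power_divide less_imp_le)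
      finally show ?thesis .
    qed
    have s0: "s \<ge> 0" unfolding s_def using b(1) by (intro sum_nonneg) (simp add: less_imp_le)
    have sB: "s \<le> B"
    proof -
      \<comment> \<open>Different \<open>i\<close> give different lags \<open>j - i\<close>, so
        \<open>s\<close> is a finite partial sum of \<open>b\<close>.\<close>
      have "s = (\<Sum>i\<in>(\<lambda>i. j - i) ` I. b i)"
        unfolding s_def by (subst sum.reindex) (auto simp: I_def inj_on_def)
      then show ?thesis using B[of "(\<lambda>i. j - i) ` I"] I by simp
    qed
    have sc: "s = (\<Sum>i<n. c i j)"
      unfolding s_def c_def by (rule sum.mono_neutral_cong_left) (auto simp: I_def)
    have int: "integrable R (\<lambda>\<omega>. s * (\<Sum>i\<in>I. (D i \<omega>)\<^sup>2 / b (j - i)))" using Dint by simp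
    have "resample_sq H j = (\<integral>\<omega>. (\<Sum>i\<in>I. D i \<omega>)\<^sup>2 \<partial>R)" unfolding resample_sq_def HD ..
    also have "\<dots> \<le> (\<integral>\<omega>. s * (\<Sum>i\<in>I. (D i \<omega>)\<^sup>2 / b (j - i)) \<partial>R)"
      using CS int by (intro integral_mono integrable_sum_square Dint I) (auto simp: D_def)
    also have "\<dots> = s * (\<Sum>i\<in>I. (\<integral>\<omega>. (D i \<omega>)\<^sup>2 \<partial>R) / b (j - i))"
      using Dint by simp
    also have "\<dots> \<le> s * (\<Sum>i\<in>I. (b (j - i))\<^sup>2 / b (j - i))"
      using Dle b(1) s0 by (intro mult_left_mono sum_mono divide_right_mono) (auto simp: less_imp_le)
    also have "\<dots> = s * s"
      using b(1) by (simp add: s_def power2_eq_square less_imp_neq[symmetric])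
    also have "\<dots> \<le> B * s" by (intro mult_right_mono sB s0)
    finally show ?thesis unfolding sc .
  qed
  moreover have "(\<lambda>j. B * (\<Sum>i<n. c i j)) sums (B * (\<Sum>i<n. B))"
    by (intro sums_mult sums_sum c)
  ultimately have "P.variance H \<le> (B * (\<Sum>i<n. B)) / 2"
    using efron_stein[of H "\<lambda>j. B * (\<Sum>i<n. c i j)"] H2 unfolding H_def[symmetric]
    by (simp add: sums_iff)
  also have "\<dots> = real n * (suminf b)\<^sup>2 / 2" by (simp add: B_def power2_eq_square)
  finally show "P.variance (\<lambda>x. \<Sum>i<n. G (\<lambda>l. x (l + i))) \<le> real n * (suminf b)\<^sup>2 / 2"
    unfolding H_def .
qed

section \<open>Influence of single innovations on locally Lipschitz functions\<close>

text \<open>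
  Young's inequality, applied to \<open>(1 + norm x + norm y) ^ 6\<close> and the squared increment rescaled by \<open>b j\<close>,
  plays the role of Hoelder's inequality.
\<close>

lemma
  fixes v :: "(nat \<Rightarrow> 'e) \<Rightarrow> 'b::euclidean_space" and \<phi> :: "'b \<Rightarrow> real"
  assumes v[measurable]: "v \<in> borel_measurable P" and \<phi>[measurable]: "\<phi> \<in> borel_measurable borel"
    and lip: "\<And>x y. \<bar>\<phi> x - \<phi> y\<bar> \<le> c * (1 + norm x + norm y) ^ 3 * norm (x - y)"
    and s: "s > 2" and r: "r \<ge> 8" "r \<ge> 6 * s / (s - 2)" and mom: "integrable P (\<lambda>x. norm (v x) powr r)"
    and b: "\<And>j. 0 < b j"
    and dep_int: "\<And>i j. i \<in> Basis \<Longrightarrow> integrable R (\<lambda>\<omega>. \<bar>(v (hybrid {} \<omega>) - v (hybrid {j} \<omega>)) \<bullet> i\<bar> powr s)"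
    and dep: "\<And>i j. i \<in> Basis \<Longrightarrow> (\<integral>\<omega>. \<bar>(v (hybrid {} \<omega>) - v (hybrid {j} \<omega>)) \<bullet> i\<bar> powr s \<partial>R) \<le> b j powr s"
  shows cubic_lipschitz_square_integrable: "integrable P (\<lambda>x. (\<phi> (v x))\<^sup>2)"
    and cubic_lipschitz_resample: "\<exists>C>0. \<forall>j. resample_sq (\<lambda>x. \<phi> (v x)) j \<le> (C * b j)\<^sup>2"
proof -
  have c0: "c \<ge> 0"
  proof -
    obtain i :: 'b where "i \<in> Basis" using SOME_Basis by blast
    have "0 \<le> c * (1 + norm i + norm (0::'b)) ^ 3 * norm (i - 0)" by (rule order_trans[OF abs_ge_zero lip])
    then show ?thesis using \<open>i \<in> Basis\<close> by (simp add: zero_le_mult_iff)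
  qed
  define A where "A J \<omega> = 3 powr r * (1 + norm (v (hybrid {} \<omega>)) powr r + norm (v (hybrid J \<omega>)) powr r)" for J \<omega>
  have Aint: "integrable R (A J)" for J
    unfolding A_def using integrable_hybridI[OF mom] by simp
  have Ale: "(1 + norm (v (hybrid {} \<omega>)) + norm (v (hybrid J \<omega>))) powr r \<le> A J \<omega>" for J \<omega>
  proof -
    let ?m = "max 1 (max (norm (v (hybrid {} \<omega>))) (norm (v (hybrid J \<omega>))))"
    have "(1 + norm (v (hybrid {} \<omega>)) + norm (v (hybrid J \<omega>))) powr r \<le> (3 * ?m) powr r"
      using r by (intro powr_mono2) auto
    also have "\<dots> = 3 powr r * ?m powr r" by (simp add: powr_mult)
    also have "?m powr r \<le> 1 + norm (v (hybrid {} \<omega>)) powr r + norm (v (hybrid J \<omega>)) powr r"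
      by (auto simp: max_def)
    finally show ?thesis unfolding A_def by simp
  qed
  define K where "K = (\<integral>\<omega>. A {} \<omega> \<partial>R)"
  have KJ: "(\<integral>\<omega>. A J \<omega> \<partial>R) = K" for J
  proof -
    have "(\<integral>\<omega>. norm (v (hybrid J \<omega>)) powr r \<partial>R) = (\<integral>x. norm (v x) powr r \<partial>P)" for J
      by (rule integral_hybrid) measurable
    then show ?thesis unfolding K_def A_def using integrable_hybridI[OF mom] by simp
  qed
  have K0: "K \<ge> 0" unfolding K_def A_def by (intro Bochner_Integration.integral_nonneg) simp
  show "integrable P (\<lambda>x. (\<phi> (v x))\<^sup>2)"
  proof (rule Bochner_Integration.integrable_bound)
    show "integrable P (\<lambda>x. 2 * (\<phi> 0)\<^sup>2 + 2 * c\<^sup>2 * (2 powr r * (1 + norm (v x) powr r)))"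
      using mom by simp
    show "AE x in P. norm ((\<phi> (v x))\<^sup>2) \<le> norm (2 * (\<phi> 0)\<^sup>2 + 2 * c\<^sup>2 * (2 powr r * (1 + norm (v x) powr r)))"
    proof (intro AE_I2)
      fix x
      let ?n = "norm (v x)"
      \<comment> \<open>Comparison with the origin gives quartic growth of \<phi>, so its square
        needs the moment of order 8; this is the requirement \<open>r \<ge> 8\<close>.\<close>
      have "\<bar>\<phi> (v x) - \<phi> 0\<bar> \<le> c * (1 + ?n) ^ 3 * ?n" using lip[of "v x" 0] by simp
      also have "\<dots> \<le> c * (1 + ?n) ^ 3 * (1 + ?n)" using c0 by (intro mult_left_mono) auto
      also have "\<dots> = c * (1 + ?n) ^ 4" by (simp add: eval_nat_numeral)
      finally have "\<bar>\<phi> (v x) - \<phi> 0\<bar>\<^sup>2 \<le> (c * (1 + ?n) ^ 4)\<^sup>2" by (intro power_mono) auto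
      also have "\<dots> = c\<^sup>2 * (1 + ?n) powr 8"
        by (simp add: power_mult_distrib power_mult[symmetric] powr_numeral)
      also have "(1 + ?n) powr 8 \<le> (1 + ?n) powr r" using r by (intro powr_mono) auto
      also have "\<dots> \<le> (2 * max 1 ?n) powr r" using r by (intro powr_mono2) auto
      also have "\<dots> = 2 powr r * max 1 ?n powr r" by (simp add: powr_mult)
      also have "max 1 ?n powr r \<le> 1 + ?n powr r" by (auto simp: max_def)
      finally have 1: "(\<phi> (v x) - \<phi> 0)\<^sup>2 \<le> c\<^sup>2 * (2 powr r * (1 + ?n powr r))"
        by (simp add: mult_left_mono)
      have "(\<phi> (v x))\<^sup>2 \<le> 2 * (\<phi> 0)\<^sup>2 + 2 * (\<phi> (v x) - \<phi> 0)\<^sup>2"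
        using zero_le_power2[of "\<phi> (v x) - 2 * \<phi> 0"] by (simp add: power2_diff power2_eq_square algebra_simps)
      then show "norm ((\<phi> (v x))\<^sup>2) \<le> norm (2 * (\<phi> 0)\<^sup>2 + 2 * c\<^sup>2 * (2 powr r * (1 + norm (v x) powr r)))"
        using 1 by simp
    qed
  qed simp
  \<comment> \<open>The square root collects the integral of \<open>W\<close> computed below; the
    summand 1 keeps \<open>C\<close> positive when \<open>c = 0\<close>.\<close>
  define C where "C = c * sqrt (real DIM('b) * (K + 1)) + 1"
  have "C > 0" unfolding C_def using c0 K0 by (intro add_nonneg_pos mult_nonneg_nonneg) auto
  moreover have "resample_sq (\<lambda>x. \<phi> (v x)) j \<le> (C * b j)\<^sup>2" for j
  proof -
    define B where "B i \<omega> = \<bar>(v (hybrid {} \<omega>) - v (hybrid {j} \<omega>)) \<bullet> i\<bar>" for i \<omega>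
    define W where "W \<omega> = (\<Sum>i\<in>Basis. A {j} \<omega> + B i \<omega> powr s / b j powr s)" for \<omega>
    have Bint: "integrable R (\<lambda>\<omega>. B i \<omega> powr s / b j powr s)" if "i \<in> Basis" for i
      unfolding B_def using dep_int[OF that] by simp
    have pt: "(\<phi> (v (hybrid {} \<omega>)) - \<phi> (v (hybrid {j} \<omega>)))\<^sup>2 \<le> c\<^sup>2 * (b j)\<^sup>2 * W \<omega>" for \<omega>
    proof -
      let ?a = "1 + norm (v (hybrid {} \<omega>)) + norm (v (hybrid {j} \<omega>))"
      have young: "?a ^ 6 * (B i \<omega>)\<^sup>2 \<le> (b j)\<^sup>2 * (A {j} \<omega> + B i \<omega> powr s / b j powr s)" for i
      proof -
        let ?y = "(B i \<omega> / b j)\<^sup>2"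
        have a1: "?a \<ge> 1" by simp
        \<comment> \<open>The exponents \<open>s / (s - 2)\<close> and \<open>s / 2\<close> are
          conjugate. The first turns \<open>?a ^ 6\<close> into a power of order
          \<open>6 * s / (s - 2)\<close>, which is at most \<open>r\<close>; the second returns the
          increment to order \<open>s\<close>. Division by \<open>b j\<close> makes both terms of
          order one before integration.\<close>
        have "?a ^ 6 * ?y \<le> (?a ^ 6) powr (s / (s - 2)) / (s / (s - 2)) + ?y powr (s / 2) / (s / 2)"
          using s by (intro Youngs_inequality) (auto simp: field_simps)
        also have "\<dots> \<le> (?a ^ 6) powr (s / (s - 2)) / 1 + ?y powr (s / 2) / 1"
          using s by (intro add_mono divide_left_mono) auto
        also have "(?a ^ 6) powr (s / (s - 2)) = ?a powr (6 * s / (s - 2))"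
          using a1 by (simp add: powr_powr flip: powr_numeral)
        also have "\<dots> \<le> ?a powr r" using r a1 by (intro powr_mono) auto
        also have "\<dots> \<le> A {j} \<omega>" by (rule Ale)
        also have "?y powr (s / 2) = B i \<omega> powr s / b j powr s"
        proof (cases "B i \<omega> = 0")
          case False
          then have "B i \<omega> > 0" by (simp add: B_def)
          then have "?y = (B i \<omega> / b j) powr 2" using b[of j] by (subst powr_numeral) auto
          then have "?y powr (s / 2) = (B i \<omega> / b j) powr s" by (simp only: powr_powr) simp
          then show ?thesis using b[of j] \<open>B i \<omega> > 0\<close> by (simp only: powr_divide less_imp_le)
        qed simp
        finally have "?a ^ 6 * ?y \<le> A {j} \<omega> + B i \<omega> powr s / b j powr s" by simp
        then have "(b j)\<^sup>2 * (?a ^ 6 * ?y) \<le> (b j)\<^sup>2 * (A {j} \<omega> + B i \<omega> powr s / b j powr s)"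
          by (intro mult_left_mono) auto
        moreover have "(b j)\<^sup>2 * (?a ^ 6 * ?y) = ?a ^ 6 * (B i \<omega>)\<^sup>2"
          using b[of j] by (simp add: power_divide)
        ultimately show ?thesis by simp
      qed
      have "\<bar>\<phi> (v (hybrid {} \<omega>)) - \<phi> (v (hybrid {j} \<omega>))\<bar>\<^sup>2 \<le> (c * ?a ^ 3 * norm (v (hybrid {} \<omega>) - v (hybrid {j} \<omega>)))\<^sup>2"
        by (intro power_mono lip) simp
      also have "\<dots> = c\<^sup>2 * ?a ^ 6 * (norm (v (hybrid {} \<omega>) - v (hybrid {j} \<omega>)))\<^sup>2"
        by (simp add: power_mult_distrib power_mult[symmetric])
      also have "(norm (v (hybrid {} \<omega>) - v (hybrid {j} \<omega>)))\<^sup>2 = (\<Sum>i\<in>Basis. (B i \<omega>)\<^sup>2)"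
        unfolding B_def power2_abs power2_norm_eq_inner by (subst euclidean_inner) (simp add: power2_eq_square)
      also have "c\<^sup>2 * ?a ^ 6 * (\<Sum>i\<in>Basis. (B i \<omega>)\<^sup>2) = c\<^sup>2 * (\<Sum>i\<in>Basis. ?a ^ 6 * (B i \<omega>)\<^sup>2)"
        by (simp add: sum_distrib_left mult.assoc)
      also have "\<dots> \<le> c\<^sup>2 * (\<Sum>i\<in>Basis. (b j)\<^sup>2 * (A {j} \<omega> + B i \<omega> powr s / b j powr s))"
        by (intro mult_left_mono sum_mono young) auto
      also have "\<dots> = c\<^sup>2 * (b j)\<^sup>2 * W \<omega>" by (simp add: W_def sum_distrib_left mult.assoc)
      finally show ?thesis by simp
    qed
    have Wint: "integrable R W" unfolding W_def using Aint Bint by auto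
    have "(\<integral>\<omega>. W \<omega> \<partial>R) = (\<Sum>i\<in>(Basis::'b set). K + (\<integral>\<omega>. B i \<omega> powr s \<partial>R) / b j powr s)"
      unfolding W_def using Aint Bint by (simp add: KJ)
    also have "\<dots> \<le> (\<Sum>i\<in>(Basis::'b set). K + b j powr s / b j powr s)"
      using dep unfolding B_def by (intro sum_mono add_left_mono divide_right_mono) auto
    also have "\<dots> = real DIM('b) * (K + 1)" using b[of j] by simp
    finally have W: "(\<integral>\<omega>. W \<omega> \<partial>R) \<le> real DIM('b) * (K + 1)" .
    have "resample_sq (\<lambda>x. \<phi> (v x)) j \<le> (\<integral>\<omega>. c\<^sup>2 * (b j)\<^sup>2 * W \<omega> \<partial>R)"
      unfolding resample_sq_def
    proof (rule integral_mono)
      show "integrable R (\<lambda>\<omega>. (\<phi> (v (hybrid {} \<omega>)) - \<phi> (v (hybrid {j} \<omega>)))\<^sup>2)"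
        using pt by (intro Bochner_Integration.integrable_bound[OF integrable_mult_right[OF Wint, of "c\<^sup>2 * (b j)\<^sup>2"]] AE_I2)
          (auto intro: order_trans[OF _ abs_ge_self])
    qed (use Wint pt in auto)
    also have "\<dots> = c\<^sup>2 * (b j)\<^sup>2 * (\<integral>\<omega>. W \<omega> \<partial>R)" by simp
    also have "\<dots> \<le> c\<^sup>2 * (b j)\<^sup>2 * (real DIM('b) * (K + 1))" by (intro mult_left_mono W) auto
    also have "\<dots> = (c * sqrt (real DIM('b) * (K + 1)) * b j)\<^sup>2"
      using K0 by (simp add: power_mult_distrib)
    also have "\<dots> \<le> (C * b j)\<^sup>2"
      unfolding C_def using b[of j] c0 K0 by (intro power_mono mult_right_mono) (auto simp: less_imp_le)
    finally show ?thesis .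
  qed
  ultimately show "\<exists>C>0. \<forall>j. resample_sq (\<lambda>x. \<phi> (v x)) j \<le> (C * b j)\<^sup>2" by blast
qed

end

section \<open>Martingale tail bound and zeros of monotone maps\<close>

text \<open>On \<open>[-1/2, 1]\<close> the claim follows from
  \<open>x - 2 * x\<^sup>2 \<le> ln (1 + x)\<close>; above 1 the exponent is negative. Below
  \<open>-1/2\<close>, where \<open>1 + x\<close> may be negative, the quartic term has to
  compensate: the constant 4 is what turns \<open>x\<^sup>2\<close> into \<open>4 * x ^ 4\<close>
  once \<open>x\<^sup>2 \<ge> 1/4\<close>.\<close>

lemma exp_minus_square_le:
  fixes x :: real
  shows "exp (x - 2 * x\<^sup>2) \<le> 1 + x + 4 * x ^ 4"
proof -
  consider "x < - (1/2)" | "- (1/2) \<le> x" "x \<le> 0" | "0 < x" "x \<le> 1" | "x > 1" by linarith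
  then show ?thesis
  proof cases
    case 1
    have x2: "x\<^sup>2 \<ge> 1 / 4"
      using power_mono[of "1/2" "-x" 2] 1 by (simp add: power2_eq_square)
    have "exp (x - 2 * x\<^sup>2) \<le> exp (-1)" using x2 1 by simp
    also have "\<dots> \<le> 1 / 2" using exp_ge_add_one_self[of 1] by (simp add: exp_minus field_simps)
    also have "1 / 2 \<le> 1 + x + x\<^sup>2"
      using zero_le_power2[of "x + 1/2"] by (simp add: power2_eq_square algebra_simps)
    also have "x\<^sup>2 \<le> 4 * x ^ 4"
      using mult_right_mono[OF x2, of "x\<^sup>2"] by (simp add: power2_eq_square eval_nat_numeral)
    finally show ?thesis by simp
  next
    case 2
    then have "- (-x) - 2 * (-x)\<^sup>2 \<le> ln (1 - (-x))" by (intro ln_one_minus_pos_lower_bound) auto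
    then have "exp (x - 2 * x\<^sup>2) \<le> exp (ln (1 + x))" by simp
    then show ?thesis using 2 by simp (metis add.commute add_increasing2 mult_nonneg_nonneg zero_le_even_power even_numeral zero_le_numeral)
  next
    case 3
    then have "x - x\<^sup>2 \<le> ln (1 + x)" by (intro ln_one_plus_pos_lower_bound) auto
    then have "x - 2 * x\<^sup>2 \<le> ln (1 + x)" using zero_le_power2[of x] by linarith
    then have "exp (x - 2 * x\<^sup>2) \<le> exp (ln (1 + x))" by simp
    also have "\<dots> \<le> 1 + x + 4 * x ^ 4" using 3 by simp
    finally show ?thesis .
  next
    case 4
    then have "x \<le> 2 * x\<^sup>2" by (simp add: power2_eq_square)
    then have "exp (x - 2 * x\<^sup>2) \<le> 1" by simp
    also have "\<dots> \<le> 1 + x + 4 * x ^ 4" using 4 by simp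
    finally show ?thesis .
  qed
qed

lemma power_le_one_plus_power:
  fixes x :: real
  assumes "0 \<le> x" "m \<le> n"
  shows "x ^ m \<le> 1 + x ^ n"
proof (cases "x \<le> 1")
  case True
  then have "x ^ m \<le> 1" using assms(1) by (intro power_le_one)
  then show ?thesis using assms(1) by (simp add: add_increasing2)
next
  case False
  then have "x ^ m \<le> x ^ n" using assms(2) by (intro power_increasing) auto
  then show ?thesis by simp
qed

text \<open>
  The predictable compensator \<open>4 l\<^sup>4 E[D\<^sub>t\<^sup>4 | F\<^sub>t]\<close> makes the exponential a supermartingale, and Markov's
  inequality removes it again; no truncation is needed since \<open>x - 2 x\<^sup>2\<close> is bounded above.
\<close>

lemma (in prob_space) martingale_exponential_tail:
  fixes F :: "nat \<Rightarrow> 'a measure" and D :: "nat \<Rightarrow> 'a \<Rightarrow> real"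
  assumes subalg: "\<And>t. subalgebra M (F t)" and mono: "\<And>t. sets (F t) \<subseteq> sets (F (Suc t))"
    and D: "\<And>t. D t \<in> borel_measurable (F (Suc t))"
    and D4: "\<And>t. integrable M (\<lambda>w. D t w ^ 4)" "\<And>t. (\<integral>w. D t w ^ 4 \<partial>M) \<le> m"
    and mart: "\<And>t Q K. Q \<in> borel_measurable (F t) \<Longrightarrow> (\<And>w. \<bar>Q w\<bar> \<le> K) \<Longrightarrow> (\<integral>w. Q w * D t w \<partial>M) = 0"
    and l: "0 < l"
  shows "prob {w \<in> space M. L + 1 \<le> (\<Sum>t<n. l * D t w - 2 * (l * D t w)\<^sup>2)} \<le> exp (- L) + 4 * l ^ 4 * (real n * m)"
proof -
  have meas: "f \<in> borel_measurable M" if "f \<in> borel_measurable (F t)" for f :: "'a \<Rightarrow> real" and t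
    using measurable_from_subalg[OF subalg that] .
  have DM[measurable]: "D t \<in> borel_measurable M" for t by (rule meas[OF D])
  have lift: "f \<in> borel_measurable (F (Suc t))" if "f \<in> borel_measurable (F t)" for f :: "'a \<Rightarrow> real" and t
  proof -
    have "subalgebra (F (Suc t)) (F t)" using subalg[of t] subalg[of "Suc t"] mono[of t] by (auto simp: subalgebra_def)
    then show ?thesis using that by (rule measurable_from_subalg)
  qed
  have D1: "integrable M (D t)" for t
  proof (rule Bochner_Integration.integrable_bound)
    show "integrable M (\<lambda>w. 1 + D t w ^ 4)" using D4(1) by simp
    have "\<bar>x\<bar> \<le> 1 + x ^ 4" for x :: real using power_le_one_plus_power[of "\<bar>x\<bar>" 1 4] by simp
    then show "AE w in M. norm (D t w) \<le> norm (1 + D t w ^ 4)"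
      by (intro AE_I2) (simp add: abs_of_nonneg add_nonneg_nonneg)
  qed simp
  \<comment> \<open>A conditional expectation is nonnegative only almost everywhere; the maximum
    with 0 makes the compensator nonnegative at every point while keeping it measurable for
    \<open>F t\<close>.\<close>
  define c where "c t w = max 0 (real_cond_exp M (F t) (\<lambda>w. D t w ^ 4) w)" for t w
  have cF: "c t \<in> borel_measurable (F t)" for t unfolding c_def by measurable
  note cM[measurable] = meas[OF cF]
  have c0: "0 \<le> c t w" for t w by (simp add: c_def)
  have c: "integrable M (\<lambda>w. Q w * c t w)" "(\<integral>w. Q w * c t w \<partial>M) = (\<integral>w. Q w * D t w ^ 4 \<partial>M)"
    "integrable M (\<lambda>w. Q w * D t w ^ 4)"
    if Q: "Q \<in> borel_measurable (F t)" and K: "\<And>w. \<bar>Q w\<bar> \<le> K" for Q t K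
  proof -
    note QM[measurable] = meas[OF Q]
    show QD: "integrable M (\<lambda>w. Q w * D t w ^ 4)"
      using K by (intro Bochner_Integration.integrable_bound[OF integrable_mult_right[OF D4(1)[of t], of K]] AE_I2)
        (auto simp: abs_mult intro!: mult_right_mono order_trans[OF K])
    interpret sigma_finite_subalgebra M "F t"
      using subalg by (intro finite_measure_subalgebra_is_sigma_finite finite_measure_subalgebra.intro finite_measure_axioms finite_measure_subalgebra_axioms.intro)
    have ae: "AE w in M. Q w * real_cond_exp M (F t) (\<lambda>w. D t w ^ 4) w = Q w * c t w"
      using real_cond_exp_pos[of "\<lambda>w. D t w ^ 4"] by (auto simp: c_def max_def)
    have "integrable M (\<lambda>w. Q w * real_cond_exp M (F t) (\<lambda>w. D t w ^ 4) w)"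
      and 2: "(\<integral>w. Q w * real_cond_exp M (F t) (\<lambda>w. D t w ^ 4) w \<partial>M) = (\<integral>w. Q w * D t w ^ 4 \<partial>M)"
      using real_cond_exp_intg[OF QD Q] by auto
    then show "integrable M (\<lambda>w. Q w * c t w)"
      using integrable_cong_AE[OF _ _ ae] by simp
    show "(\<integral>w. Q w * c t w \<partial>M) = (\<integral>w. Q w * D t w ^ 4 \<partial>M)"
      using integral_cong_AE[OF _ _ ae] 2 by simp
  qed
  define U where "U t w = l * D t w - 2 * (l * D t w)\<^sup>2 - 4 * l ^ 4 * c t w" for t w
  define E where "E t w = exp (\<Sum>s<t. U s w)" for t w
  have U1: "U t w \<le> 1" for t w
  proof -
    have "x - 2 * x\<^sup>2 \<le> 1" for x :: real
    proof -
      have "x \<le> x\<^sup>2 + 1 / 4"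
        using zero_le_power2[of "x - 1/2"] by (simp add: power2_eq_square algebra_simps)
      then show ?thesis using zero_le_power2[of x] by linarith
    qed
    moreover have "0 \<le> 4 * l ^ 4 * c t w" using c0[of t w] by simp
    ultimately show ?thesis unfolding U_def by (smt (verit))
  qed
  have EF: "E t \<in> borel_measurable (F t)" for t
  proof (induction t)
    case (Suc t)
    have "E (Suc t) = (\<lambda>w. E t w * exp (U t w))" by (simp add: E_def fun_eq_iff exp_add)
    moreover have [measurable]: "E t \<in> borel_measurable (F (Suc t))" by (rule lift[OF Suc])
    moreover have [measurable]: "c t \<in> borel_measurable (F (Suc t))" by (rule lift[OF cF])
    moreover note D[measurable]
    ultimately show ?case by (simp add: U_def)
  qed (simp add: E_def)
  note EM[measurable] = meas[OF EF]
  have Eb: "\<bar>E t w\<bar> \<le> exp (real t)" for t w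
    using sum_mono[of "{..<t}" "\<lambda>s. U s w" "\<lambda>_. 1"] U1 by (simp add: E_def)
  have E_int[simp]: "integrable M (E t)" for t
    by (rule integrable_const_bound[of _ "exp (real t)"]) (auto simp: Eb[simplified])
  have E_le: "(\<integral>w. E t w \<partial>M) \<le> 1" for t
  proof (induction t)
    case 0
    show ?case by (simp add: E_def prob_space)
  next
    case (Suc t)
    \<comment> \<open>All factors known at time \<open>t\<close> are collected in \<open>Q\<close>,
      so that the linear term in \<open>D t\<close> integrates to zero against it.\<close>
    define Q where "Q w = E t w * exp (- (4 * l ^ 4 * c t w))" for w
    have Q: "Q \<in> borel_measurable (F t)" unfolding Q_def using EF[of t] cF[of t] by measurable
    note QM[measurable] = meas[OF Q]
    have E0: "0 \<le> E t w" for w by (simp add: E_def)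
    have Qle: "Q w \<le> E t w" for w
      unfolding Q_def using E0[of w] c0[of t w] by (intro mult_left_le) auto
    have Q0: "0 \<le> Q w" for w by (simp add: Q_def E0)
    have Qb: "\<bar>Q w\<bar> \<le> exp (real t)" for w using Eb[of t w] Qle[of w] Q0[of w] by linarith
    have Qi: "integrable M Q" by (rule integrable_const_bound[of _ "exp (real t)"]) (auto simp: Qb[simplified])
    have QDi: "integrable M (\<lambda>w. Q w * D t w)"
      by (intro Bochner_Integration.integrable_bound[OF integrable_mult_right[OF D1[of t], of "exp (real t)"]] AE_I2)
        (auto simp: abs_mult intro!: mult_right_mono Qb)
    note cQ = c[OF Q Qb]
    have "(\<integral>w. E (Suc t) w \<partial>M) \<le> (\<integral>w. Q w + l * (Q w * D t w) + 4 * l ^ 4 * (Q w * D t w ^ 4) \<partial>M)"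
    proof (rule integral_mono)
      show "integrable M (\<lambda>w. Q w + l * (Q w * D t w) + 4 * l ^ 4 * (Q w * D t w ^ 4))"
        using Qi QDi cQ(3) by simp
      fix w
      have "E (Suc t) w = Q w * exp (l * D t w - 2 * (l * D t w)\<^sup>2)"
        by (simp add: E_def Q_def U_def exp_add[symmetric] algebra_simps)
      also have "\<dots> \<le> Q w * (1 + l * D t w + 4 * (l * D t w) ^ 4)"
        by (intro mult_left_mono exp_minus_square_le Q0)
      finally show "E (Suc t) w \<le> Q w + l * (Q w * D t w) + 4 * l ^ 4 * (Q w * D t w ^ 4)"
        by (simp add: algebra_simps power_mult_distrib)
    qed simp
    also have "\<dots> = (\<integral>w. Q w \<partial>M) + 4 * l ^ 4 * (\<integral>w. Q w * c t w \<partial>M)"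
      using Qi QDi cQ(2,3) mart[OF Q Qb] by simp
    also have "\<dots> = (\<integral>w. Q w + 4 * l ^ 4 * (Q w * c t w) \<partial>M)"
      using Qi cQ(1) by simp
    also have "\<dots> \<le> (\<integral>w. E t w \<partial>M)"
    proof (rule integral_mono)
      fix w
      \<comment> \<open>By \<open>1 + y \<le> exp y\<close>, the compensator absorbs exactly the
        conditional mean of the quartic term.\<close>
      have "exp (- (4 * l ^ 4 * c t w)) * (1 + 4 * l ^ 4 * c t w) \<le> exp (- (4 * l ^ 4 * c t w)) * exp (4 * l ^ 4 * c t w)"
        by (intro mult_left_mono exp_ge_add_one_self) simp
      also have "\<dots> = 1" by (simp add: exp_add[symmetric])
      finally have "E t w * (exp (- (4 * l ^ 4 * c t w)) * (1 + 4 * l ^ 4 * c t w)) \<le> E t w * 1"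
        by (intro mult_left_mono E0)
      then show "Q w + 4 * l ^ 4 * (Q w * c t w) \<le> E t w" by (simp add: Q_def algebra_simps)
    qed (use Qi cQ(1) in simp_all)
    finally show ?case using Suc by simp
  qed
  have ci: "integrable M (c t)" "(\<integral>w. c t w \<partial>M) \<le> m" for t
    using c[of "\<lambda>_. 1" t 1] D4(2)[of t] by auto
  \<comment> \<open>The extra 1 in the level is the allowance for the compensator: if its sum stays
    below 1, then \<open>E n\<close> reaches \<open>exp L\<close>. Both alternatives are then
    handled by Markov's inequality.\<close>
  have "{w \<in> space M. L + 1 \<le> (\<Sum>t<n. l * D t w - 2 * (l * D t w)\<^sup>2)} \<subseteq>
     {w \<in> space M. E n w \<ge> exp L} \<union> {w \<in> space M. 4 * l ^ 4 * (\<Sum>t<n. c t w) \<ge> 1}"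
  proof safe
    fix w assume 1: "L + 1 \<le> (\<Sum>t<n. l * D t w - 2 * (l * D t w)\<^sup>2)" and 2: "\<not> 4 * l ^ 4 * (\<Sum>t<n. c t w) \<ge> 1"
    have "(\<Sum>s<n. U s w) = (\<Sum>t<n. l * D t w - 2 * (l * D t w)\<^sup>2) - 4 * l ^ 4 * (\<Sum>t<n. c t w)"
      unfolding U_def by (simp add: sum_subtractf sum_distrib_left)
    then show "exp L \<le> E n w" using 1 2 by (simp add: E_def)
  qed
  then have "prob {w \<in> space M. L + 1 \<le> (\<Sum>t<n. l * D t w - 2 * (l * D t w)\<^sup>2)} \<le>
     prob ({w \<in> space M. E n w \<ge> exp L} \<union> {w \<in> space M. 4 * l ^ 4 * (\<Sum>t<n. c t w) \<ge> 1})"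
    by (intro finite_measure_mono) measurable
  also have "\<dots> \<le> prob {w \<in> space M. E n w \<ge> exp L} + prob {w \<in> space M. 4 * l ^ 4 * (\<Sum>t<n. c t w) \<ge> 1}"
    by (intro measure_Un_le) measurable
  also have "prob {w \<in> space M. E n w \<ge> exp L} \<le> (\<integral>w. E n w \<partial>M) / exp L"
    by (rule integral_Markov_inequality_measure[where A="{}"]) (simp_all, simp add: E_def)
  also have "\<dots> \<le> 1 / exp L" by (intro divide_right_mono E_le) simp
  also have "1 / exp L = exp (- L)" by (simp add: exp_minus field_simps)
  also have "prob {w \<in> space M. 4 * l ^ 4 * (\<Sum>t<n. c t w) \<ge> 1} \<le> (\<integral>w. 4 * l ^ 4 * (\<Sum>t<n. c t w) \<partial>M) / 1"
    by (rule integral_Markov_inequality_measure[where A="{}"])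
      (use ci c0 in \<open>auto intro!: AE_I2 mult_nonneg_nonneg sum_nonneg\<close>)
  also have "\<dots> = 4 * l ^ 4 * (\<Sum>t<n. \<integral>w. c t w \<partial>M)" using ci by simp
  also have "\<dots> \<le> 4 * l ^ 4 * (\<Sum>t<n. m)"
    by (intro mult_left_mono sum_mono ci) simp
  finally show ?thesis by simp
qed

section \<open>Zeros of monotone maps and measurability of the zero event\<close>

lemma unique_zero_of_strictly_monotone:
  fixes F :: "'b::euclidean_space \<Rightarrow> 'b"
  assumes cont: "continuous_on UNIV F" and r: "r > 0"
    and mono: "\<And>x y. x \<noteq> y \<Longrightarrow> (F x - F y) \<bullet> (x - y) < 0"
    and sphere: "\<And>x. norm (x - x0) = r \<Longrightarrow> F x \<bullet> (x - x0) \<le> 0"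
  shows "(\<exists>!x. F x = 0) \<and> (\<forall>x. F x = 0 \<longrightarrow> norm (x - x0) \<le> r)"
proof -
  have unique: "x = y" if "F x = 0" "F y = 0" for x y
    using mono[of x y] that by auto
  have "\<exists>x\<in>cball x0 r. F x = 0"
  proof (rule ccontr)
    assume ne: "\<not> (\<exists>x\<in>cball x0 r. F x = 0)"
    \<comment> \<open>Without a zero in the ball, \<open>G\<close> maps the ball continuously to its
      boundary sphere. At a fixed point of \<open>G\<close> the vector \<open>F x\<close> points
      straight outwards, which contradicts the sign condition on the sphere.\<close>
    define G where "G x = x0 + (r / norm (F x)) *\<^sub>R F x" for x
    have "continuous_on (cball x0 r) G"
      unfolding G_def using ne by (intro continuous_intros continuous_on_subset[OF cont]) auto
    moreover have "G \<in> cball x0 r \<rightarrow> cball x0 r"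
      using r ne by (auto simp: G_def dist_norm)
    ultimately obtain x where x: "x \<in> cball x0 r" "G x = x" using brouwer_ball r by metis
    have d: "x - x0 = (r / norm (F x)) *\<^sub>R F x" using x(2) by (auto simp: G_def algebra_simps)
    have F: "norm (F x) > 0" using ne x by auto
    have "norm (x - x0) = r" unfolding d using F r by simp
    then have "F x \<bullet> (x - x0) \<le> 0" by (rule sphere)
    moreover have "F x \<bullet> (x - x0) = r * norm (F x)"
      unfolding d using F by (simp add: power2_norm_eq_inner[symmetric] power2_eq_square)
    ultimately show False using F r by (simp add: mult_le_0_iff)
  qed
  then obtain x where x: "norm (x - x0) \<le> r" "F x = 0" by (auto simp: dist_norm norm_minus_commute)
  have "norm (y - x0) \<le> r" if "F y = 0" for y using unique[OF that x(2)] x(1) by simp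
  then show ?thesis using x(2) unique by blast
qed

text \<open>An uncountable existential is reduced to a countable condition: by compactness and
  continuity a zero exists if and only if the norm takes arbitrarily small values on a countable
  dense subset.\<close>

lemma zero_set_measurable:
  fixes F :: "'b::euclidean_space \<Rightarrow> 'w \<Rightarrow> 'c::euclidean_space"
  assumes K: "compact K" and cont: "\<And>w. continuous_on K (\<lambda>x. F x w)"
    and [measurable]: "\<And>x. F x \<in> borel_measurable M"
  shows "{w \<in> space M. \<exists>x\<in>K. F x w = 0} \<in> sets M"
proof -
  obtain A where A: "countable A" "A \<subseteq> K" "K \<subseteq> closure A" using separable by metis
  have eq: "(\<exists>x\<in>K. F x w = 0) \<longleftrightarrow> (\<forall>m::nat. \<exists>x\<in>A. norm (F x w) < 1 / Suc m)" for w
  proof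
    assume "\<exists>x\<in>K. F x w = 0"
    then obtain x where x: "x \<in> K" "F x w = 0" by auto
    show "\<forall>m::nat. \<exists>x\<in>A. norm (F x w) < 1 / Suc m"
    proof
      fix m :: nat
      obtain d where d: "d > 0" "\<And>x'. x' \<in> K \<Longrightarrow> dist x' x < d \<Longrightarrow> dist (F x' w) (F x w) < 1 / Suc m"
        using cont[of w] x(1) unfolding continuous_on_iff by (metis of_nat_0_less_iff zero_less_Suc zero_less_divide_1_iff)
      obtain y where "y \<in> A" "dist y x < d" using A(3) x(1) d(1) by (meson closure_approachable subsetD)
      then show "\<exists>x\<in>A. norm (F x w) < 1 / Suc m" using d(2)[of y] A(2) x(2) by (auto simp: dist_norm)
    qed
  next
    assume "\<forall>m::nat. \<exists>x\<in>A. norm (F x w) < 1 / Suc m"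
    then have "\<forall>m::nat. \<exists>x. x \<in> K \<and> norm (F x w) < 1 / Suc m" using A(2) by blast
    then obtain y where y: "\<And>m. y m \<in> K" "\<And>m::nat. norm (F (y m) w) < 1 / Suc m" by metis
    obtain l s where l: "l \<in> K" "strict_mono s" "(y \<circ> s) \<longlonglongrightarrow> l"
      using K y(1) unfolding compact_def by blast
    have "(\<lambda>m. F (y (s m)) w) \<longlonglongrightarrow> F l w"
      using continuous_on_tendsto_compose[OF cont[of w] l(3) l(1)] y(1) by (simp add: comp_def)
    moreover have "(\<lambda>m. F (y (s m)) w) \<longlonglongrightarrow> 0"
    proof (rule tendsto_norm_zero_cancel, rule tendsto_sandwich[OF _ _ tendsto_const])
      show "\<forall>\<^sub>F m in sequentially. norm (F (y (s m)) w) \<le> 1 / Suc m"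
      proof (intro always_eventually allI)
        fix m
        have "norm (F (y (s m)) w) \<le> 1 / Suc (s m)" using y(2)[of "s m"] by simp
        also have "\<dots> \<le> 1 / Suc m" using seq_suble[OF l(2), of m] by (simp add: frac_le)
        finally show "norm (F (y (s m)) w) \<le> 1 / Suc m" .
      qed
      show "(\<lambda>m. 1 / real (Suc m)) \<longlonglongrightarrow> 0" using LIMSEQ_inverse_real_of_nat by (simp add: inverse_eq_divide)
    qed simp
    ultimately have "F l w = 0" using LIMSEQ_unique by blast
    then show "\<exists>x\<in>K. F x w = 0" using l(1) by auto
  qed
  show ?thesis unfolding eq using A(1) by measurable
qed

text \<open>Uniqueness ranges over the whole space and excludes coinciding arguments, neither of
  which is compact. Pairs of distinct points are therefore exhausted by compact sets, and on each of
  them a common zero is a zero of the paired map.\<close>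

lemma unique_zero_event_measurable:
  fixes F :: "'b::euclidean_space \<Rightarrow> 'w \<Rightarrow> 'c::euclidean_space"
  assumes cont: "\<And>w. continuous_on UNIV (\<lambda>x. F x w)" and m: "\<And>x. F x \<in> borel_measurable M"
  shows "{w \<in> space M. (\<exists>!x. F x w = 0) \<and> (\<forall>x. F x w = 0 \<longrightarrow> norm (x - x0) \<le> r)} \<in> sets M"
proof -
  \<comment> \<open>Bounded pairs at distance at least \<open>1 / (N + 1)\<close>: the lower bound
    on the distance keeps the diagonal out and the set closed.\<close>
  define K where "K N = (cball 0 (real N) \<times> cball 0 (real N)) \<inter> {z :: 'b \<times> 'b. 1 / real (Suc N) \<le> dist (fst z) (snd z)}" for N :: nat
  have "closed {z :: 'b \<times> 'b. 1 / real (Suc N) \<le> dist (fst z) (snd z)}" for N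
    by (intro closed_Collect_le continuous_intros)
  then have KN: "compact (K N)" for N unfolding K_def by (intro compact_Int_closed compact_Times compact_cball)
  have two: "(\<exists>x y. x \<noteq> y \<and> F x w = 0 \<and> F y w = 0) \<longleftrightarrow> (\<exists>N. \<exists>z\<in>K N. (F (fst z) w, F (snd z) w) = 0)" for w
  proof
    assume "\<exists>x y. x \<noteq> y \<and> F x w = 0 \<and> F y w = 0"
    then obtain x y where xy: "x \<noteq> y" "F x w = 0" "F y w = 0" by auto
    obtain N1 where N1: "norm x + norm y \<le> real N1" using real_arch_simple by blast
    obtain N2 where N2: "1 / real (Suc N2) < dist x y" using xy(1) nat_approx_posE[of "dist x y"] by auto
    have "1 / real (Suc (max N1 N2)) \<le> 1 / real (Suc N2)" by (intro frac_le) auto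
    also note less_imp_le[OF N2]
    finally have d: "1 / real (Suc (max N1 N2)) \<le> dist x y" .
    have "real N1 \<le> real (max N1 N2)" by simp
    then have "norm x \<le> real (max N1 N2)" "norm y \<le> real (max N1 N2)"
      using N1 norm_ge_zero[of x] norm_ge_zero[of y] by linarith+
    with d have "(x, y) \<in> K (max N1 N2)" unfolding K_def mem_Collect_eq Int_iff mem_Times_iff mem_cball_0 fst_conv snd_conv by blast
    then show "\<exists>N. \<exists>z\<in>K N. (F (fst z) w, F (snd z) w) = 0" using xy by (intro exI[of _ "max N1 N2"] bexI[of _ "(x, y)"]) (simp_all add: zero_prod_def)
  next
    assume "\<exists>N. \<exists>z\<in>K N. (F (fst z) w, F (snd z) w) = 0"
    then obtain N z where "z \<in> K N" "F (fst z) w = 0" "F (snd z) w = 0" by (auto simp: zero_prod_def)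
    moreover have "1 / real (Suc N) > 0" by simp
    ultimately show "\<exists>x y. x \<noteq> y \<and> F x w = 0 \<and> F y w = 0"
      by (intro exI[of _ "fst z"] exI[of _ "snd z"]) (auto simp: K_def)
  qed
  have eq: "(\<exists>!x. F x w = 0) \<and> (\<forall>x. F x w = 0 \<longrightarrow> norm (x - x0) \<le> r) \<longleftrightarrow>
      (\<exists>x\<in>cball x0 r. F x w = 0) \<and> \<not> (\<exists>N. \<exists>z\<in>K N. (F (fst z) w, F (snd z) w) = 0)" for w
  proof -
    have "x \<in> cball x0 r \<longleftrightarrow> norm (x - x0) \<le> r" for x by (simp add: dist_norm norm_minus_commute)
    then have "(\<exists>x\<in>cball x0 r. F x w = 0) \<longleftrightarrow> (\<exists>x. norm (x - x0) \<le> r \<and> F x w = 0)" by (simp only: Bex_def)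
    then show ?thesis unfolding two[symmetric] by metis
  qed
  have [measurable]: "{w \<in> space M. \<exists>x\<in>cball x0 r. F x w = 0} \<in> sets M"
    by (rule zero_set_measurable[OF compact_cball continuous_on_subset[OF cont] m]) simp
  have [measurable]: "{w \<in> space M. \<exists>z\<in>K N. (F (fst z) w, F (snd z) w) = 0} \<in> sets M" for N
  proof (rule zero_set_measurable[OF KN])
    show "continuous_on (K N) (\<lambda>z. (F (fst z) w, F (snd z) w))" for w
    proof (rule continuous_on_Pair)
      show "continuous_on (K N) (\<lambda>z. F (fst z) w)"
        by (rule continuous_on_compose2[OF cont[of w] continuous_on_fst[OF continuous_on_id]]) simp
      show "continuous_on (K N) (\<lambda>z. F (snd z) w)"
        by (rule continuous_on_compose2[OF cont[of w] continuous_on_snd[OF continuous_on_id]]) simp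
    qed
    show "(\<lambda>w. (F (fst z) w, F (snd z) w)) \<in> borel_measurable M" for z
      by (rule borel_measurable_Pair[OF m m])
  qed
  have "{w \<in> space M. (\<exists>x\<in>cball x0 r. F x w = 0) \<and> \<not> (\<exists>N. \<exists>z\<in>K N. (F (fst z) w, F (snd z) w) = 0)} =
      {w \<in> space M. \<exists>x\<in>cball x0 r. F x w = 0} - (\<Union>N. {w \<in> space M. \<exists>z\<in>K N. (F (fst z) w, F (snd z) w) = 0})"
    by blast
  then show ?thesis unfolding eq by simp
qed

section \<open>Causal processes\<close>

locale innovations = prob_space M for M :: "'w measure" +
  fixes S :: "'e measure" and \<epsilon> :: "int \<Rightarrow> 'w \<Rightarrow> 'e"
  assumes indep: "indep_vars (\<lambda>_. S) \<epsilon> UNIV"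
    and ident: "\<And>t. distr M S (\<epsilon> t) = distr M S (\<epsilon> 0)"
begin

abbreviation law :: "'e measure" where "law \<equiv> distr M S (\<epsilon> 0)"

lemma innovation_measurable: "\<epsilon> t \<in> measurable M S"
  using indep by (auto simp: indep_vars_def)

lemma prob_space_law: "prob_space law"
  by (rule prob_space_distr[OF innovation_measurable])

sublocale I: iid_pair law
  unfolding iid_pair_def by (rule prob_space_law)

text \<open>Indexing innovations by their lag gives all histories the same law \<open>I.P\<close>
  and turns a step back in time into a shift of the sequence.\<close>

definition history :: "int \<Rightarrow> 'w \<Rightarrow> nat \<Rightarrow> 'e" where
  "history t w = (\<lambda>j. \<epsilon> (t - int j) w)"

lemma measurable_history [measurable]: "history t \<in> measurable M I.P"
  unfolding history_def
  by (rule measurable_PiM_single') (auto simp: innovation_measurable intro: measurable_space[OF innovation_measurable])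

lemma distr_history: "distr M I.P (history t) = I.P"
proof -
  have m: "(\<lambda>w i. \<epsilon> i w) \<in> measurable M (PiM UNIV (\<lambda>_. law))"
    by (rule measurable_PiM_single') (auto simp: innovation_measurable intro: measurable_space[OF innovation_measurable])
  have "distr M (PiM UNIV (\<lambda>_. S)) (\<lambda>w. \<lambda>i\<in>UNIV. \<epsilon> i w) = PiM UNIV (\<lambda>i. distr M S (\<epsilon> i))"
    using indep innovation_measurable by (subst indep_vars_iff_distr_eq_PiM[symmetric]) auto
  also have "distr M (PiM UNIV (\<lambda>_. S)) (\<lambda>w. \<lambda>i\<in>UNIV. \<epsilon> i w) = distr M (PiM UNIV (\<lambda>_. law)) (\<lambda>w i. \<epsilon> i w)"
    by (intro distr_cong sets_PiM_cong) auto
  also have "PiM UNIV (\<lambda>i. distr M S (\<epsilon> i)) = PiM UNIV (\<lambda>_. law)"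
    by (intro PiM_cong refl ident)
  finally have e: "distr M (PiM UNIV (\<lambda>_. law)) (\<lambda>w i. \<epsilon> i w) = PiM UNIV (\<lambda>_. law)" .
  have inj: "inj (\<lambda>j::nat. t - int j)" by (auto intro: inj_onI)
  have "distr M I.P (history t) = distr (distr M (PiM UNIV (\<lambda>_. law)) (\<lambda>w i. \<epsilon> i w)) I.P (\<lambda>\<omega> j. \<omega> (t - int j))"
    by (subst distr_distr[OF measurable_PiM_UNIV_reindex m]) (simp add: comp_def history_def[abs_def])
  also have "\<dots> = I.P" unfolding e by (rule distr_PiM_UNIV_reindex[OF prob_space_law inj])
  finally show ?thesis .
qed

lemma history_shift: "history (t - int i) w = (\<lambda>l. history t w (l + i))"
  by (simp add: history_def algebra_simps)

lemma
  fixes h :: "(nat \<Rightarrow> 'e) \<Rightarrow> 'b::{banach, second_countable_topology}"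
  assumes h: "h \<in> borel_measurable I.P"
  shows integral_history: "(\<integral>w. h (history t w) \<partial>M) = (\<integral>x. h x \<partial>I.P)"
    and integrable_history: "integrable M (\<lambda>w. h (history t w)) \<longleftrightarrow> integrable I.P h"
proof -
  have "integral\<^sup>L (distr M I.P (history t)) h = (\<integral>w. h (history t w) \<partial>M)"
    by (rule integral_distr[OF measurable_history h])
  then show "(\<integral>w. h (history t w) \<partial>M) = (\<integral>x. h x \<partial>I.P)" unfolding distr_history by simp
  have "integrable (distr M I.P (history t)) h \<longleftrightarrow> integrable M (\<lambda>w. h (history t w))"
    by (rule integrable_distr_eq[OF measurable_history h])
  then show "integrable M (\<lambda>w. h (history t w)) \<longleftrightarrow> integrable I.P h" unfolding distr_history by simp
qed

text \<open>The whole sum is one function of the history at its last time, so the variance bound for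
  shifted partial sums applies and Chebyshev finishes. The offset \<open>a\<close> lets the same
  statement serve responses and regressors of the preceding time.\<close>

lemma weak_law_rate:
  fixes G :: "(nat \<Rightarrow> 'e) \<Rightarrow> real" and U :: "int \<Rightarrow> 'w \<Rightarrow> real"
  assumes G[measurable]: "G \<in> borel_measurable I.P" and G2: "integrable I.P (\<lambda>x. (G x)\<^sup>2)"
    and b: "\<And>j. 0 < b j" "summable b" and dep: "\<And>j. I.resample_sq G j \<le> (b j)\<^sup>2"
    and U[measurable]: "\<And>t. U t \<in> borel_measurable M"
    and UG: "\<And>t. AE w in M. U t w = G (history t w)"
    and \<eta>: "\<eta> > 0" and n: "n > 0"
  shows "prob {w \<in> space M. \<eta> \<le> \<bar>(\<Sum>t=1..n. U (int t + a) w) / real n - (\<integral>x. G x \<partial>I.P)\<bar>}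
           \<le> (suminf b)\<^sup>2 / (2 * \<eta>\<^sup>2 * real n)"
proof -
  define H where "H x = (\<Sum>i<n. G (\<lambda>l. x (l + i)))" for x
  have [measurable]: "H \<in> borel_measurable I.P" unfolding H_def by measurable
  have H2: "integrable I.P (\<lambda>x. (H x)\<^sup>2)"
    unfolding H_def by (rule I.square_integrable_partial_sum[OF G G2 b dep])
  have var: "I.P.variance H \<le> real n * (suminf b)\<^sup>2 / 2"
    unfolding H_def by (rule I.variance_partial_sum[OF G G2 b dep])
  have G1: "integrable I.P G" by (rule I.P.square_integrable_imp_integrable[OF G G2])
  have EH: "I.P.expectation H = real n * (\<integral>x. G x \<partial>I.P)"
  proof -
    have "I.P.expectation H = (\<Sum>i<n. (\<integral>x. G (\<lambda>l. x (l + i)) \<partial>I.P))"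
      unfolding H_def using G1 I.integrable_shift[OF G] by (intro Bochner_Integration.integral_sum) auto
    then show ?thesis using I.integral_shift[OF G] by simp
  qed
  have "AE w in M. (\<Sum>t=1..n. U (int t + a) w) = H (history (int n + a) w)"
  proof -
    have "AE w in M. \<forall>t::nat. U (int t + a) w = G (history (int t + a) w)"
      using UG by (simp add: AE_all_countable)
    then show ?thesis
    proof eventually_elim
      case (elim w)
      \<comment> \<open>Reversal of time by \<open>t = n - i\<close>: the summand \<open>i\<close>
        steps before the end is the one that sees the history shifted by \<open>i\<close>.\<close>
      have "(\<Sum>t=1..n. U (int t + a) w) = (\<Sum>i<n. U (int (n - i) + a) w)"
        by (rule sum.reindex_bij_witness[of _ "\<lambda>i. n - i" "\<lambda>t. n - t"]) auto
      also have "\<dots> = (\<Sum>i<n. G (\<lambda>l. history (int n + a) w (l + i)))"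
      proof (rule sum.cong[OF refl])
        fix i assume i: "i \<in> {..<n}"
        then have "int (n - i) + a = (int n + a) - int i" by simp
        then have "history (int (n - i) + a) w = (\<lambda>l. history (int n + a) w (l + i))"
          by (simp only: history_shift)
        then show "U (int (n - i) + a) w = G (\<lambda>l. history (int n + a) w (l + i))"
          using elim[rule_format, of "n - i"] by (simp only:)
      qed
      finally show ?case by (simp add: H_def)
    qed
  qed
  then have "prob {w \<in> space M. \<eta> \<le> \<bar>(\<Sum>t=1..n. U (int t + a) w) / real n - (\<integral>x. G x \<partial>I.P)\<bar>} =
      prob {w \<in> space M. \<eta> \<le> \<bar>H (history (int n + a) w) / real n - (\<integral>x. G x \<partial>I.P)\<bar>}"
    by (intro finite_measure_eq_AE) auto
  also have "{w \<in> space M. \<eta> \<le> \<bar>H (history (int n + a) w) / real n - (\<integral>x. G x \<partial>I.P)\<bar>} =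
      history (int n + a) -` {x \<in> space I.P. real n * \<eta> \<le> \<bar>H x - I.P.expectation H\<bar>} \<inter> space M"
  proof -
    have "\<bar>h - real n * e\<bar> = real n * \<bar>h / real n - e\<bar>" for h e
    proof -
      have "h - real n * e = real n * (h / real n - e)" using n by (simp add: algebra_simps)
      then show ?thesis by (metis abs_mult abs_of_nat)
    qed
    then show ?thesis using n measurable_space[OF measurable_history, of _ "int n + a"] unfolding EH by auto
  qed
  also have "prob \<dots> = measure (distr M I.P (history (int n + a))) {x \<in> space I.P. real n * \<eta> \<le> \<bar>H x - I.P.expectation H\<bar>}"
    by (rule measure_distr[symmetric]) measurable
  also have "\<dots> \<le> I.P.variance H / (real n * \<eta>)\<^sup>2"
    unfolding distr_history using n \<eta> by (intro I.P.Chebyshev_inequality H2) auto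
  also have "\<dots> \<le> (real n * (suminf b)\<^sup>2 / 2) / (real n * \<eta>)\<^sup>2"
    by (intro divide_right_mono var) simp
  also have "\<dots> = (suminf b)\<^sup>2 / (2 * \<eta>\<^sup>2 * real n)"
    using n by (simp add: power2_eq_square field_simps)
  finally show ?thesis .
qed

text \<open>At time \<open>j\<close> the innovation with index 0 has lag \<open>j\<close>. Replacing
  it by an independent copy therefore resamples coordinate \<open>j\<close>, and the dependence
  coefficient at \<open>j\<close> is an \<open>L^s\<close> distance between two hybrids. Finiteness
  excludes the infinite branch of \<open>Ls_norm\<close>.\<close>

lemma nn_integral_dep_coeff:
  fixes dst :: "'u \<Rightarrow> 'u \<Rightarrow> real"
  assumes \<Psi>[measurable]: "(\<lambda>z. dst (\<pi> (f (fst z))) (\<pi> (f (snd z)))) \<in> borel_measurable (I.P \<Otimes>\<^sub>M I.P)"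
    and U: "AE w in M. U (int j) w = \<pi> (f (history (int j) w))"
    and s: "s > 0" and fin: "dep_coeff M S \<epsilon> f \<pi> dst U s j \<noteq> \<infinity>"
  shows "(\<integral>\<^sup>+\<omega>. ennreal (\<bar>dst (\<pi> (f (hybrid {} \<omega>))) (\<pi> (f (hybrid {j} \<omega>)))\<bar> powr s) \<partial>I.R) =
    ennreal (enn2real (dep_coeff M S \<epsilon> f \<pi> dst U s j) powr s)"
proof -
  define h where "h z = ennreal (\<bar>dst (\<pi> (f (fst z))) (\<pi> (f (snd z)))\<bar> powr s)" for z
  have h[measurable]: "h \<in> borel_measurable (I.P \<Otimes>\<^sub>M I.P)" unfolding h_def by measurable
  have upd[measurable]: "(\<lambda>z. (fst z)(j := snd z)) \<in> measurable (I.P \<Otimes>\<^sub>M law) I.P"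
    by (rule measurable_PiM_single') (auto simp: space_PiM space_pair_measure)
  \<comment> \<open>\<open>int j - int l = 0\<close> means \<open>l = j\<close>, so the coupled
    process is a one-point update of the history.\<close>
  have cpl: "coupled \<epsilon> f (int j) z = f ((history (int j) (fst z))(j := snd z))" for z
    by (auto simp: coupled_def history_def case_prod_beta intro!: arg_cong[of _ _ f])
  have "AE w in distr (M \<Otimes>\<^sub>M law) M fst. U (int j) w = \<pi> (f (history (int j) w))"
    using U by (simp only: I.distr_pair_fst)
  then have "AE z in M \<Otimes>\<^sub>M law. U (int j) (fst z) = \<pi> (f (history (int j) (fst z)))"
    by (rule AE_distrD[rotated]) simp
  then have "(\<integral>\<^sup>+z. ennreal (\<bar>dst (U (int j) (fst z)) (\<pi> (coupled \<epsilon> f (int j) z))\<bar> powr s) \<partial>(M \<Otimes>\<^sub>M law)) =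
      (\<integral>\<^sup>+z. h (history (int j) (fst z), (history (int j) (fst z))(j := snd z)) \<partial>(M \<Otimes>\<^sub>M law))"
    by (intro nn_integral_cong_AE) (auto simp: cpl h_def)
  also have "\<dots> = (\<integral>\<^sup>+z. h (fst z, (fst z)(j := snd z)) \<partial>(I.P \<Otimes>\<^sub>M law))"
  proof -
    have "distr M I.P (history (int j)) \<Otimes>\<^sub>M distr law law (\<lambda>x. x) =
        distr (M \<Otimes>\<^sub>M law) (I.P \<Otimes>\<^sub>M law) (\<lambda>(w, e). (history (int j) w, e))"
      by (rule pair_measure_distr) (auto simp: distr_id I.sigma_finite_measure_axioms)
    then have e: "I.P \<Otimes>\<^sub>M law = distr (M \<Otimes>\<^sub>M law) (I.P \<Otimes>\<^sub>M law) (\<lambda>(w, e). (history (int j) w, e))"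
      by (simp add: distr_history distr_id)
    have "(\<integral>\<^sup>+z. h (fst z, (fst z)(j := snd z)) \<partial>distr (M \<Otimes>\<^sub>M law) (I.P \<Otimes>\<^sub>M law) (\<lambda>(w, e). (history (int j) w, e))) =
      (\<integral>\<^sup>+z. h (history (int j) (fst z), (history (int j) (fst z))(j := snd z)) \<partial>(M \<Otimes>\<^sub>M law))"
      by (subst nn_integral_distr) (auto simp: case_prod_beta)
    then show ?thesis using e by simp
  qed
  also have "\<dots> = (\<integral>\<^sup>+\<omega>. h (hybrid {} \<omega>, hybrid {j} \<omega>) \<partial>I.R)"
    by (rule I.integral_resample_eq[OF h])
  finally have eq: "(\<integral>\<^sup>+z. ennreal (\<bar>dst (U (int j) (fst z)) (\<pi> (coupled \<epsilon> f (int j) z))\<bar> powr s) \<partial>(M \<Otimes>\<^sub>M law)) =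
     (\<integral>\<^sup>+\<omega>. h (hybrid {} \<omega>, hybrid {j} \<omega>) \<partial>I.R)" .
  define J where "J = (\<integral>\<^sup>+\<omega>. h (hybrid {} \<omega>, hybrid {j} \<omega>) \<partial>I.R)"
  have d: "dep_coeff M S \<epsilon> f \<pi> dst U s j = (if J = \<infinity> then \<infinity> else ennreal (enn2real J powr (1 / s)))"
    unfolding dep_coeff_def Ls_norm_def coupling_space_def Let_def eq J_def ..
  then have "J \<noteq> \<infinity>" using fin by auto
  then have "J = ennreal (enn2real J)" by (simp add: less_top[symmetric])
  moreover have "enn2real (dep_coeff M S \<epsilon> f \<pi> dst U s j) powr s = enn2real J"
    using \<open>J \<noteq> \<infinity>\<close> s by (simp add: d powr_powr)
  ultimately show ?thesis unfolding J_def h_def by simp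
qed

end

section \<open>The autoregressive model\<close>

lemma norm_powr_le_sum_components:
  fixes x :: "real ^ 'd"
  assumes "r \<ge> 0"
  shows "norm x powr r \<le> real CARD('d) powr r * (\<Sum>i\<in>UNIV. \<bar>x $ i\<bar> powr r)"
proof -
  have "Max (range (\<lambda>i. \<bar>x $ i\<bar>)) \<in> range (\<lambda>i. \<bar>x $ i\<bar>)" by (rule Max_in) auto
  then obtain i where "Max (range (\<lambda>i. \<bar>x $ i\<bar>)) = \<bar>x $ i\<bar>" by (rule rangeE)
  then have i: "\<bar>x $ j\<bar> \<le> \<bar>x $ i\<bar>" for j using Max_ge[of "range (\<lambda>i. \<bar>x $ i\<bar>)" "\<bar>x $ j\<bar>"] by simp
  have "norm x \<le> (\<Sum>j\<in>UNIV. \<bar>x $ j\<bar>)" by (rule norm_le_l1_cart)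
  also have "\<dots> \<le> real CARD('d) * \<bar>x $ i\<bar>" using sum_bounded_above[of UNIV "\<lambda>j. \<bar>x $ j\<bar>" "\<bar>x $ i\<bar>"] i by simp
  finally have "norm x powr r \<le> (real CARD('d) * \<bar>x $ i\<bar>) powr r" using assms by (intro powr_mono2) auto
  also have "\<dots> = real CARD('d) powr r * \<bar>x $ i\<bar> powr r" by (simp add: powr_mult)
  also have "\<dots> \<le> real CARD('d) powr r * (\<Sum>i\<in>UNIV. \<bar>x $ i\<bar> powr r)"
    by (intro mult_left_mono member_le_sum) auto
  finally show ?thesis .
qed

lemma borel_measurable_vec_componentwise:
  fixes v :: "'a \<Rightarrow> real ^ 'd"
  assumes "\<And>i. (\<lambda>x. v x $ i) \<in> borel_measurable A"
  shows "v \<in> borel_measurable A"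
proof (subst borel_measurable_euclidean_space, intro ballI)
  fix b :: "real ^ 'd" assume "b \<in> Basis"
  then obtain i where b: "b = axis i 1" by (auto simp: Basis_vec_def)
  show "(\<lambda>x. v x \<bullet> b) \<in> borel_measurable A"
    unfolding b inner_axis by (simp add: assms)
qed

locale glm_model =
  fixes M :: "'w measure"
    and Y :: "int \<Rightarrow> 'w \<Rightarrow> real"
    and X :: "int \<Rightarrow> 'w \<Rightarrow> nat \<Rightarrow> real"
    and p k :: nat
    and pos :: "'d::finite \<Rightarrow> nat"
    and S :: "'e measure"
    and \<epsilon> :: "int \<Rightarrow> 'w \<Rightarrow> 'e"
    and f :: "(nat \<Rightarrow> 'e) \<Rightarrow> real \<times> (nat \<Rightarrow> real)"
    and g :: "real \<Rightarrow> real"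
    and \<theta>\<^sub>0 :: "real ^ 'd"
    and q \<delta> C C' :: real
  assumes prob_M: "prob_space M"
    and pos: "bij_betw pos UNIV {..<1 + p + k}"
    and Y_measurable [measurable]: "\<And>t. Y t \<in> measurable M borel"
    and X_measurable [measurable]: "\<And>t. X t \<in> measurable M (covariate_space k)"
    and causal: "causal_representation M (observation_space k) (\<lambda>t w. (Y t w, X t w)) S \<epsilon> f"
    and cond_exp: "\<And>t. AE w in M.
           real_cond_exp M (past M (observation_space k) (\<lambda>t w. (Y t w, X t w)) (t - 1)) (Y t) w
             = g (linear_predictor p pos Y X t \<theta>\<^sub>0 w)"
    and q: "q \<ge> 3" and \<delta>: "0 < \<delta>" "\<delta> \<le> 2 * q"
    and dep_Y: "dep_tail M S \<epsilon> f fst dist Y 0 (q + \<delta>) \<le> ennreal C"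
    and dep_X: "dep_tail M S \<epsilon> f snd (covariate_dist k) X 0 (q + \<delta>) \<le> ennreal C"
    and moment_Y: "integrable M (\<lambda>w. \<bar>Y 0 w\<bar> powr (2 * q * (q + \<delta>) / \<delta>))"
    and moment_X: "integrable M (\<lambda>w. L2_set (X 0 w) {..<k} powr (2 * q * (q + \<delta>) / \<delta>))"
    and g'_cont: "continuous_on UNIV (deriv g)"
    and g_diff: "\<And>u. g differentiable (at u)"
    and C': "C' > 0"
    and g_lip: "\<And>u v. \<bar>g u - g v\<bar> \<le> C' * \<bar>u - v\<bar>"
    and g'_lip: "\<And>u v. \<bar>deriv g u - deriv g v\<bar> \<le> C' * \<bar>u - v\<bar>"
    and identifiable: "\<And>u :: real ^ 'd.
           measure M {w \<in> space M. u \<bullet> regressor p pos Y X 0 w = 0} = 1 \<Longrightarrow> u = 0"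
    and g'_pos: "\<And>u. deriv g u > 0"
begin

abbreviation score :: "nat \<Rightarrow> real ^ 'd \<Rightarrow> 'w \<Rightarrow> real ^ 'd" where
  "score \<equiv> estimating_function p pos Y X g"

sublocale innovations M S \<epsilon>
  using prob_M causal by (auto simp: innovations_def innovations_axioms_def causal_representation_def)

definition s where "s = q + \<delta>"
definition r where "r = 2 * q * (q + \<delta>) / \<delta>"

lemma s2: "s > 2" using q \<delta> by (simp add: s_def)

text \<open>From \<open>\<delta> \<le> 2 * q\<close> one gets
  \<open>2 * (q + \<delta>) / \<delta> \<ge> 3\<close>, hence
  \<open>r \<ge> 3 * q \<ge> 9\<close>.\<close>

lemma r9: "r \<ge> 9"
proof -
  have "9 * \<delta> \<le> (3 * q) * \<delta>" using q \<delta> by (intro mult_right_mono) auto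
  also have "\<dots> = q * (3 * \<delta>)" by simp
  also have "\<dots> \<le> q * (2 * (q + \<delta>))" using q \<delta> by (intro mult_left_mono) auto
  finally show ?thesis using \<delta> by (simp add: r_def field_simps)
qed

text \<open>The conjugate-exponent condition for the cubic Lipschitz factor. Since
  \<open>r = 2 * s * q / \<delta>\<close>, it amounts to
  \<open>3 / (s - 2) \<le> q / \<delta>\<close>, which follows from \<open>q \<ge> 3\<close> and
  \<open>s - 2 \<ge> \<delta>\<close>.\<close>

lemma r_s: "r \<ge> 6 * s / (s - 2)"
proof -
  have "3 * \<delta> \<le> 3 * (s - 2)" using q by (simp add: s_def)
  also have "\<dots> \<le> q * (s - 2)" using q s2 by (intro mult_right_mono) auto
  finally have "3 / (s - 2) \<le> q / \<delta>" using s2 \<delta> by (simp add: field_simps)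
  then have "2 * s * (3 / (s - 2)) \<le> 2 * s * (q / \<delta>)" using s2 by (intro mult_left_mono) auto
  then show ?thesis by (simp add: r_def s_def mult_ac)
qed

lemma f_measurable [measurable]: "f \<in> measurable I.P (observation_space k)"
proof -
  have "f \<in> measurable (PiM UNIV (\<lambda>_. S)) (observation_space k)"
    using causal by (simp add: causal_representation_def)
  moreover have "sets (PiM UNIV (\<lambda>_. S)) = sets I.P" by (intro sets_PiM_cong) auto
  ultimately show ?thesis using measurable_cong_sets by blast
qed

lemma fst_f_measurable [measurable]: "(\<lambda>x. fst (f x)) \<in> borel_measurable I.P"
  using f_measurable unfolding observation_space_def by measurable

lemma snd_f_measurable [measurable]: "(\<lambda>x. snd (f x)) \<in> measurable I.P (covariate_space k)"
  using f_measurable unfolding observation_space_def by measurable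

lemma covariate_component [measurable]: "l < k \<Longrightarrow> (\<lambda>x. x l) \<in> borel_measurable (covariate_space k)"
  unfolding covariate_space_def by (rule measurable_component_singleton) simp

lemma snd_f_component [measurable]: "l < k \<Longrightarrow> (\<lambda>x. snd (f x) l) \<in> borel_measurable I.P"
  by (rule measurable_compose[OF snd_f_measurable covariate_component])

lemma X_component [measurable]: "l < k \<Longrightarrow> (\<lambda>w. X t w l) \<in> borel_measurable M"
  by (rule measurable_compose[OF X_measurable covariate_component])

lemma Y_history: "AE w in M. Y t w = fst (f (history t w))"
  and X_history: "AE w in M. X t w = snd (f (history t w))"
proof -
  have *: "AE w in M. f (history t w) = (Y t w, X t w)"
    using causal by (simp add: causal_representation_def history_def eq_commute)
  show "AE w in M. Y t w = fst (f (history t w))" using * by eventually_elim simp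
  show "AE w in M. X t w = snd (f (history t w))" using * by eventually_elim simp
qed

text \<open>The regressor as a functional of a single history. Position 1 holds the current
  response, so the lag at position \<open>pos i\<close> is a shift by
  \<open>pos i - 1\<close>.\<close>

definition Zf :: "(nat \<Rightarrow> 'e) \<Rightarrow> real ^ 'd" where
  "Zf x = (\<chi> i. if pos i = 0 then 1 else if pos i \<le> p then fst (f (\<lambda>l. x (l + (pos i - 1))))
     else snd (f x) (pos i - p - 1))"

abbreviation Z :: "int \<Rightarrow> 'w \<Rightarrow> real ^ 'd" where "Z t \<equiv> regressor p pos Y X t"

lemma pos_less: "pos i < 1 + p + k"
  using pos by (auto simp: bij_betw_def)

lemma pos_cov: "\<not> pos i \<le> p \<Longrightarrow> pos i - p - 1 < k"
  using pos_less[of i] by linarith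

lemma Zf_measurable [measurable]: "Zf \<in> borel_measurable I.P"
proof (rule borel_measurable_vec_componentwise)
  fix i
  consider "pos i = 0" | "pos i \<noteq> 0" "pos i \<le> p" | "\<not> pos i \<le> p" by linarith
  then show "(\<lambda>x. Zf x $ i) \<in> borel_measurable I.P"
  proof cases
    case 2
    have "(\<lambda>x. fst (f (\<lambda>l. x (l + (pos i - 1))))) \<in> borel_measurable I.P"
      by (rule measurable_compose[OF I.measurable_shift fst_f_measurable])
    then show ?thesis using 2 by (simp add: Zf_def)
  next
    case 3
    then show ?thesis using snd_f_component[OF pos_cov[OF 3]] by (auto simp: Zf_def)
  qed (simp add: Zf_def)
qed

lemma Z_measurable [measurable]: "Z t \<in> borel_measurable M"
proof (rule borel_measurable_vec_componentwise)
  fix i show "(\<lambda>w. Z t w $ i) \<in> borel_measurable M"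
    using X_component[OF pos_cov[of i]] by (cases "pos i = 0"; cases "pos i \<le> p") (auto simp: regressor_def)
qed

lemma Z_history: "AE w in M. Z t w = Zf (history t w)"
proof -
  have "AE w in M. \<forall>m::nat. Y (t - int m) w = fst (f (history (t - int m) w))"
    using Y_history by (simp add: AE_all_countable)
  with X_history[of t] show ?thesis
  proof eventually_elim
    case (elim w)
    show ?case
    proof (subst vec_eq_iff, intro allI)
      fix i
      show "Z t w $ i = Zf (history t w) $ i"
      proof (cases "pos i = 0")
        case False
        then have "t + 1 - int (pos i) = t - int (pos i - 1)" by linarith
        then have "Y (t + 1 - int (pos i)) w = fst (f (\<lambda>l. history t w (l + (pos i - 1))))"
          using elim(2)[rule_format, of "pos i - 1"] by (simp only: history_shift)
        then show ?thesis using False elim(1) by (simp add: regressor_def Zf_def)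
      qed (simp add: regressor_def Zf_def)
    qed
  qed
qed

section \<open>Dependence coefficients and moments of the regressor\<close>

definition bY :: "nat \<Rightarrow> real" where "bY j = enn2real (dep_coeff M S \<epsilon> f fst dist Y s j)"
definition bX :: "nat \<Rightarrow> real" where "bX j = enn2real (dep_coeff M S \<epsilon> f snd (covariate_dist k) X s j)"

lemma summable_enn2real:
  assumes "(\<Sum>t. c (t::nat)) \<le> ennreal B"
  shows "c j \<noteq> \<infinity>" and "summable (\<lambda>j. enn2real (c j))"
proof -
  have "(\<Sum>t. c t) < top" using assms by (simp add: le_less_trans)
  then have *: "(\<Sum>t. c t) \<noteq> top" by simp
  have "c j \<noteq> top" for j
    using sum_le_suminf[of c "{j}"] * by (auto simp: top_unique)
  then have e: "ennreal (enn2real (c j)) = c j" for j by (simp add: less_top)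
  show "c j \<noteq> \<infinity>" using \<open>c j \<noteq> top\<close> by simp
  show "summable (\<lambda>j. enn2real (c j))"
    by (rule summable_suminf_not_top) (simp_all add: e *)
qed

lemma dep_Y_fin: "dep_coeff M S \<epsilon> f fst dist Y s j \<noteq> \<infinity>" and bY_summable: "summable bY"
  using summable_enn2real[OF dep_Y[unfolded dep_tail_def s_def[symmetric]]] by (auto simp: bY_def[abs_def])

lemma dep_X_fin: "dep_coeff M S \<epsilon> f snd (covariate_dist k) X s j \<noteq> \<infinity>" and bX_summable: "summable bX"
  using summable_enn2real[OF dep_X[unfolded dep_tail_def s_def[symmetric]]] by (auto simp: bX_def[abs_def])

lemma bY0: "bY j \<ge> 0" and bX0: "bX j \<ge> 0" by (auto simp: bY_def bX_def)

lemma integral_of_nn_integral: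
  assumes "(\<integral>\<^sup>+\<omega>. ennreal (h \<omega>) \<partial>A) = ennreal c" "\<And>\<omega>. h \<omega> \<ge> 0" "h \<in> borel_measurable A" "c \<ge> 0"
  shows "integrable A h" "integral\<^sup>L A h = c"
  using nn_integral_eq_integrable[of h A c] assms by auto

lemma resample_Y:
  "integrable I.R (\<lambda>\<omega>. \<bar>fst (f (hybrid {} \<omega>)) - fst (f (hybrid {j} \<omega>))\<bar> powr s)"
  "(\<integral>\<omega>. \<bar>fst (f (hybrid {} \<omega>)) - fst (f (hybrid {j} \<omega>))\<bar> powr s \<partial>I.R) = bY j powr s"
proof -
  have "(\<integral>\<^sup>+\<omega>. ennreal (\<bar>dist (fst (f (hybrid {} \<omega>))) (fst (f (hybrid {j} \<omega>)))\<bar> powr s) \<partial>I.R) = ennreal (bY j powr s)"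
    unfolding bY_def
    by (rule nn_integral_dep_coeff) (use s2 dep_Y_fin Y_history in simp_all)
  then have *: "(\<integral>\<^sup>+\<omega>. ennreal (\<bar>fst (f (hybrid {} \<omega>)) - fst (f (hybrid {j} \<omega>))\<bar> powr s) \<partial>I.R) = ennreal (bY j powr s)"
    by (simp add: dist_real_def)
  show "integrable I.R (\<lambda>\<omega>. \<bar>fst (f (hybrid {} \<omega>)) - fst (f (hybrid {j} \<omega>))\<bar> powr s)"
    "(\<integral>\<omega>. \<bar>fst (f (hybrid {} \<omega>)) - fst (f (hybrid {j} \<omega>))\<bar> powr s \<partial>I.R) = bY j powr s"
    using integral_of_nn_integral[OF *] by simp_all
qed

lemma resample_X:
  assumes l: "l < k"
  shows "integrable I.R (\<lambda>\<omega>. \<bar>snd (f (hybrid {} \<omega>)) l - snd (f (hybrid {j} \<omega>)) l\<bar> powr s)"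
    and "(\<integral>\<omega>. \<bar>snd (f (hybrid {} \<omega>)) l - snd (f (hybrid {j} \<omega>)) l\<bar> powr s \<partial>I.R) \<le> bX j powr s"
proof -
  let ?d = "\<lambda>\<omega>. covariate_dist k (snd (f (hybrid {} \<omega>))) (snd (f (hybrid {j} \<omega>)))"
  note snd_f_component[OF l, measurable]
  have m: "(\<lambda>z. covariate_dist k (snd (f (fst z))) (snd (f (snd z)))) \<in> borel_measurable (I.P \<Otimes>\<^sub>M I.P)"
  proof -
    have "(\<lambda>z. snd (f (fst z)) i - snd (f (snd z)) i) \<in> borel_measurable (I.P \<Otimes>\<^sub>M I.P)" if "i < k" for i
      by (intro borel_measurable_diff measurable_compose[OF measurable_fst snd_f_component]
          measurable_compose[OF measurable_snd snd_f_component] that)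
    then have [measurable]: "(\<lambda>z. \<Sum>i<k. (snd (f (fst z)) i - snd (f (snd z)) i)\<^sup>2) \<in> borel_measurable (I.P \<Otimes>\<^sub>M I.P)"
      by (intro borel_measurable_sum borel_measurable_power) auto
    show ?thesis unfolding covariate_dist_def L2_set_def by measurable
  qed
  have m': "?d \<in> borel_measurable I.R"
    using measurable_compose[OF _ m, of "\<lambda>\<omega>. (hybrid {} \<omega>, hybrid {j} \<omega>)" I.R] by simp
  have "(\<integral>\<^sup>+\<omega>. ennreal (\<bar>?d \<omega>\<bar> powr s) \<partial>I.R) = ennreal (bX j powr s)"
    unfolding bX_def
    by (rule nn_integral_dep_coeff[where \<pi>=snd and dst="covariate_dist k" and f=f and U=X, OF m]) (use s2 dep_X_fin X_history in simp_all)
  then have d: "integrable I.R (\<lambda>\<omega>. \<bar>?d \<omega>\<bar> powr s)" "(\<integral>\<omega>. \<bar>?d \<omega>\<bar> powr s \<partial>I.R) = bX j powr s"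
    using m' by (auto intro!: integral_of_nn_integral)
  have le: "\<bar>snd (f (hybrid {} \<omega>)) l - snd (f (hybrid {j} \<omega>)) l\<bar> powr s \<le> \<bar>?d \<omega>\<bar> powr s" for \<omega>
  proof (rule powr_mono2)
    have "\<bar>snd (f (hybrid {} \<omega>)) l - snd (f (hybrid {j} \<omega>)) l\<bar> \<le> ?d \<omega>"
    proof -
      have "L2_set (\<lambda>i. snd (f (hybrid {} \<omega>)) i - snd (f (hybrid {j} \<omega>)) i) {..<k} =
         L2_set (\<lambda>i. \<bar>snd (f (hybrid {} \<omega>)) i - snd (f (hybrid {j} \<omega>)) i\<bar>) {..<k}"
        by (simp add: L2_set_def)
      then show ?thesis
        unfolding covariate_dist_def using l member_le_L2_set[of "{..<k}" l "\<lambda>i. \<bar>snd (f (hybrid {} \<omega>)) i - snd (f (hybrid {j} \<omega>)) i\<bar>"] by simp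
    qed
    then show "\<bar>snd (f (hybrid {} \<omega>)) l - snd (f (hybrid {j} \<omega>)) l\<bar> \<le> \<bar>?d \<omega>\<bar>" by simp
  qed (use s2 in auto)
  have m1: "(\<lambda>\<omega>. \<bar>snd (f (hybrid {} \<omega>)) l - snd (f (hybrid {j} \<omega>)) l\<bar> powr s) \<in> borel_measurable I.R" by measurable
  show i: "integrable I.R (\<lambda>\<omega>. \<bar>snd (f (hybrid {} \<omega>)) l - snd (f (hybrid {j} \<omega>)) l\<bar> powr s)"
    using le by (intro Bochner_Integration.integrable_bound[OF d(1) m1] AE_I2) simp
  show "(\<integral>\<omega>. \<bar>snd (f (hybrid {} \<omega>)) l - snd (f (hybrid {j} \<omega>)) l\<bar> powr s \<partial>I.R) \<le> bX j powr s"
    unfolding d(2)[symmetric] by (rule integral_mono[OF i d(1) le])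
qed

text \<open>A common bound for all components: the sum covers the lagged responses,
  \<open>bX\<close> the covariates. The geometric term only makes the bound strictly positive, as
  the bound is divided by later, without harming summability.\<close>

definition bZ :: "nat \<Rightarrow> real" where
  "bZ j = (1 / 2) ^ j + (\<Sum>m<p. if m \<le> j then bY (j - m) else 0) + bX j"

lemma bZ_pos: "0 < bZ j"
  unfolding bZ_def using bY0 bX0 by (intro add_pos_nonneg) (auto intro!: sum_nonneg)

lemma bZ_summable: "summable bZ"
proof -
  have "summable (\<lambda>j. if m \<le> j then bY (j - m) else 0)" for m
    using bY_summable summable_iff_shift[of "\<lambda>j. if m \<le> j then bY (j - m) else 0" m] by simp
  then show ?thesis unfolding bZ_def
    by (intro summable_add bX_summable summable_sum) (auto intro: summable_geometric)
qed

text \<open>The intercept does not react; a response \<open>m\<close> steps back reacts to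
  coordinate \<open>j\<close> as the current response does to \<open>j - m\<close>, and not at all
  when \<open>j < m\<close>; a covariate component is dominated by the Euclidean distance.\<close>

lemma resample_Z:
  shows "integrable I.R (\<lambda>\<omega>. \<bar>Zf (hybrid {} \<omega>) $ i - Zf (hybrid {j} \<omega>) $ i\<bar> powr s)" (is ?A)
    and "(\<integral>\<omega>. \<bar>Zf (hybrid {} \<omega>) $ i - Zf (hybrid {j} \<omega>) $ i\<bar> powr s \<partial>I.R) \<le> bZ j powr s" (is ?B)
proof -
  consider "pos i = 0" | "pos i \<noteq> 0" "pos i \<le> p" "pos i - 1 \<le> j" | "pos i \<noteq> 0" "pos i \<le> p" "j < pos i - 1" | "pos i \<noteq> 0" "\<not> pos i \<le> p" by linarith
  then have "?A \<and> ?B"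
  proof cases
    case 1
    then show ?thesis using s2 by (simp add: Zf_def)
  next
    case 2
    let ?m = "pos i - 1"
    have m: "(\<lambda>z. \<bar>fst (f (fst z)) - fst (f (snd z))\<bar> powr s) \<in> borel_measurable (I.P \<Otimes>\<^sub>M I.P)" by measurable
    have j: "j - ?m + ?m = j" using 2 by simp
    have "bY (j - ?m) \<le> (\<Sum>m<p. if m \<le> j then bY (j - m) else 0)"
      using 2 bY0 member_le_sum[of ?m "{..<p}" "\<lambda>m. if m \<le> j then bY (j - m) else 0"] by auto
    then have "bY (j - ?m) \<le> bZ j" unfolding bZ_def using bX0[of j] by (intro add_increasing add_increasing2) auto
    then have "bY (j - ?m) powr s \<le> bZ j powr s" using bY0 s2 by (intro powr_mono2) auto
    then show ?thesis
      using 2 I.integral_hybrid_shift[OF m, of ?m "j - ?m"] I.integrable_hybrid_shift[OF m, of ?m "j - ?m"] resample_Y[of "j - ?m"]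
      unfolding fst_conv snd_conv j by (simp add: Zf_def)
  next
    case 3
    have "(\<lambda>l. hybrid {j} \<omega> (l + (pos i - 1))) = (\<lambda>l. hybrid {} \<omega> (l + (pos i - 1)))" for \<omega> :: "nat \<times> bool \<Rightarrow> 'e"
    proof
      fix l
      have "l + (pos i - 1) \<noteq> j" using 3 by linarith
      then show "hybrid {j} \<omega> (l + (pos i - 1)) = hybrid {} \<omega> (l + (pos i - 1))"
        by (simp only: hybrid_def singleton_iff empty_iff)
    qed
    then show ?thesis using 3 s2 by (simp add: Zf_def)
  next
    case 4
    have "bX j \<le> bZ j" unfolding bZ_def using bY0 by (intro add_increasing) (auto intro!: sum_nonneg add_nonneg_nonneg)
    then have "bX j powr s \<le> bZ j powr s" using bX0 s2 by (intro powr_mono2) auto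
    then show ?thesis using resample_X[OF pos_cov[OF 4(2)], of j] 4 by (simp add: Zf_def)
  qed
  then show ?A ?B by auto
qed

lemma moment_fst: "integrable I.P (\<lambda>x. \<bar>fst (f x)\<bar> powr r)"
proof -
  have "integrable M (\<lambda>w. \<bar>fst (f (history 0 w))\<bar> powr r)"
    using moment_Y unfolding r_def[symmetric]
    by (rule integrable_cong_AE[THEN iffD1, rotated -1]) (use Y_history[of 0] in auto)
  then show ?thesis using integrable_history[of "\<lambda>x. \<bar>fst (f x)\<bar> powr r" 0] by simp
qed

lemma moment_snd:
  assumes "l < k" shows "integrable I.P (\<lambda>x. \<bar>snd (f x) l\<bar> powr r)"
proof -
  note snd_f_component[OF assms, measurable] X_component[OF assms, measurable]
  have "integrable M (\<lambda>w. \<bar>X 0 w l\<bar> powr r)"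
  proof (rule Bochner_Integration.integrable_bound[OF moment_X])
    show "AE w in M. norm (\<bar>X 0 w l\<bar> powr r) \<le> norm (L2_set (X 0 w) {..<k} powr (2 * q * (q + \<delta>) / \<delta>))"
    proof (intro AE_I2)
      fix w
      have "\<bar>X 0 w l\<bar> \<le> L2_set (\<lambda>i. \<bar>X 0 w i\<bar>) {..<k}"
        using assms member_le_L2_set[of "{..<k}" l "\<lambda>i. \<bar>X 0 w i\<bar>"] by simp
      also have "\<dots> = L2_set (X 0 w) {..<k}" by (simp add: L2_set_def)
      finally show "norm (\<bar>X 0 w l\<bar> powr r) \<le> norm (L2_set (X 0 w) {..<k} powr (2 * q * (q + \<delta>) / \<delta>))"
        unfolding r_def[symmetric] using r9 by (simp add: powr_mono2)
    qed
  qed measurable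
  then have "integrable M (\<lambda>w. \<bar>snd (f (history 0 w)) l\<bar> powr r)"
    by (rule integrable_cong_AE[THEN iffD1, rotated -1]) (use X_history[of 0] in auto)
  then show ?thesis using integrable_history[of "\<lambda>x. \<bar>snd (f x) l\<bar> powr r" 0] by simp
qed

lemma moment_Zf: "integrable I.P (\<lambda>x. norm (Zf x) powr r)"
proof (rule Bochner_Integration.integrable_bound)
  have "integrable I.P (\<lambda>x. \<bar>Zf x $ i\<bar> powr r)" for i
  proof -
    consider "pos i = 0" | "pos i \<noteq> 0" "pos i \<le> p" | "pos i \<noteq> 0" "\<not> pos i \<le> p" by linarith
    then show ?thesis
    proof cases
      case 1
      then show ?thesis by (simp add: Zf_def)
    next
      case 2
      then show ?thesis using I.integrable_shift[of "\<lambda>x. \<bar>fst (f x)\<bar> powr r" "pos i - 1"] moment_fst by (simp add: Zf_def)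
    next
      case 3
      then show ?thesis using moment_snd[OF pos_cov] by (simp add: Zf_def)
    qed
  qed
  then show "integrable I.P (\<lambda>x. real CARD('d) powr r * (\<Sum>i\<in>UNIV. \<bar>Zf x $ i\<bar> powr r))" by simp
  show "AE x in I.P. norm (norm (Zf x) powr r) \<le> norm (real CARD('d) powr r * (\<Sum>i\<in>UNIV. \<bar>Zf x $ i\<bar> powr r))"
    using r9 by (intro AE_I2) (simp add: sum_nonneg abs_of_nonneg norm_powr_le_sum_components)
qed measurable

section \<open>Rates in the weak law for regressor and response\<close>

lemma weak_law_Z:
  fixes \<phi> :: "real ^ 'd \<Rightarrow> real"
  assumes \<phi>[measurable]: "\<phi> \<in> borel_measurable borel"
    and lip: "\<And>x y. \<bar>\<phi> x - \<phi> y\<bar> \<le> c * (1 + norm x + norm y) ^ 3 * norm (x - y)" and \<eta>: "\<eta> > 0"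
  shows "integrable I.P (\<lambda>x. \<phi> (Zf x))"
    and "\<exists>K. \<forall>n>0. prob {w \<in> space M. \<eta> \<le> \<bar>(\<Sum>t=1..n. \<phi> (Z (int t - 1) w)) / real n - (\<integral>x. \<phi> (Zf x) \<partial>I.P)\<bar>} \<le> K / real n"
proof -
  have B: "(i :: real ^ 'd) \<in> Basis \<Longrightarrow> \<exists>l. i = axis l 1" for i by (auto simp: Basis_vec_def)
  have d: "integrable I.R (\<lambda>\<omega>. \<bar>(Zf (hybrid {} \<omega>) - Zf (hybrid {j} \<omega>)) \<bullet> i\<bar> powr s)"
    "(\<integral>\<omega>. \<bar>(Zf (hybrid {} \<omega>) - Zf (hybrid {j} \<omega>)) \<bullet> i\<bar> powr s \<partial>I.R) \<le> bZ j powr s" if "i \<in> Basis" for i j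
    using B[OF that] resample_Z by (auto simp: inner_axis)
  have r8: "r \<ge> 8" using r9 by simp
  have sq: "integrable I.P (\<lambda>x. (\<phi> (Zf x))\<^sup>2)"
    by (rule I.cubic_lipschitz_square_integrable[OF Zf_measurable \<phi> lip s2 r8 r_s moment_Zf bZ_pos d])
  show "integrable I.P (\<lambda>x. \<phi> (Zf x))" by (rule I.P.square_integrable_imp_integrable[OF _ sq]) measurable
  obtain A where A: "A > 0" "\<And>j. I.resample_sq (\<lambda>x. \<phi> (Zf x)) j \<le> (A * bZ j)\<^sup>2"
    using I.cubic_lipschitz_resample[OF Zf_measurable \<phi> lip s2 r8 r_s moment_Zf bZ_pos d] by auto
  \<comment> \<open>The offset \<open>-1\<close> selects the regressors at times \<open>0\<close> to
    \<open>n - 1\<close>, those paired with the responses at times \<open>1\<close> to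
    \<open>n\<close>.\<close>
  have "prob {w \<in> space M. \<eta> \<le> \<bar>(\<Sum>t=1..n. \<phi> (Z (int t + (-1)) w)) / real n - (\<integral>x. \<phi> (Zf x) \<partial>I.P)\<bar>}
     \<le> (\<Sum>j. A * bZ j)\<^sup>2 / (2 * \<eta>\<^sup>2 * real n)" if "n > 0" for n
  proof (rule weak_law_rate[OF _ sq _ _ A(2) _ _ \<eta> that, where U="\<lambda>t w. \<phi> (Z t w)"])
    show "AE w in M. \<phi> (Z t w) = \<phi> (Zf (history t w))" for t
      using Z_history[of t] by eventually_elim simp
    show "(\<lambda>x. \<phi> (Zf x)) \<in> borel_measurable I.P" by measurable
    show "0 < A * bZ j" for j using A(1) bZ_pos by simp
    show "summable (\<lambda>j. A * bZ j)" by (rule summable_mult[OF bZ_summable])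
    show "(\<lambda>w. \<phi> (Z t w)) \<in> borel_measurable M" for t by measurable
  qed
  then show "\<exists>K. \<forall>n>0. prob {w \<in> space M. \<eta> \<le> \<bar>(\<Sum>t=1..n. \<phi> (Z (int t - 1) w)) / real n - (\<integral>x. \<phi> (Zf x) \<partial>I.P)\<bar>} \<le> K / real n"
    by (intro exI[of _ "(\<Sum>j. A * bZ j)\<^sup>2 / (2 * \<eta>\<^sup>2)"]) simp
qed

text \<open>The response needs its own version: for \<open>p = 0\<close> it is not a component of
  the regressor.\<close>

lemma weak_law_Y:
  fixes \<phi> :: "real \<Rightarrow> real"
  assumes \<phi>[measurable]: "\<phi> \<in> borel_measurable borel"
    and lip: "\<And>x y. \<bar>\<phi> x - \<phi> y\<bar> \<le> c * (1 + norm x + norm y) ^ 3 * norm (x - y)" and \<eta>: "\<eta> > 0"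
  shows "\<exists>K. \<forall>n>0. prob {w \<in> space M. \<eta> \<le> \<bar>(\<Sum>t=1..n. \<phi> (Y (int t) w)) / real n - (\<integral>x. \<phi> (fst (f x)) \<partial>I.P)\<bar>} \<le> K / real n"
proof -
  \<comment> \<open>As for \<open>bZ\<close>, the geometric summand secures strict
    positivity.\<close>
  define b where "b j = bY j + (1 / 2) ^ j" for j
  have b0: "b j > 0" for j unfolding b_def using bY0 by (intro add_nonneg_pos) auto
  have bs: "summable b" unfolding b_def by (intro summable_add bY_summable summable_geometric) simp
  have mom: "integrable I.P (\<lambda>x. norm (fst (f x)) powr r)" using moment_fst by simp
  have bY_b: "bY j powr s \<le> b j powr s" for j unfolding b_def using bY0 s2 by (intro powr_mono2) auto
  have d: "integrable I.R (\<lambda>\<omega>. \<bar>(fst (f (hybrid {} \<omega>)) - fst (f (hybrid {j} \<omega>))) \<bullet> i\<bar> powr s)"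
    "(\<integral>\<omega>. \<bar>(fst (f (hybrid {} \<omega>)) - fst (f (hybrid {j} \<omega>))) \<bullet> i\<bar> powr s \<partial>I.R) \<le> b j powr s" if "i \<in> Basis" for i j
  proof -
    have i: "i = 1" using that by simp
    show "integrable I.R (\<lambda>\<omega>. \<bar>(fst (f (hybrid {} \<omega>)) - fst (f (hybrid {j} \<omega>))) \<bullet> i\<bar> powr s)"
      "(\<integral>\<omega>. \<bar>(fst (f (hybrid {} \<omega>)) - fst (f (hybrid {j} \<omega>))) \<bullet> i\<bar> powr s \<partial>I.R) \<le> b j powr s"
      unfolding i inner_real_def mult_1_right using resample_Y[of j] bY_b[of j] by simp_all
  qed
  have r8: "r \<ge> 8" using r9 by simp
  have sq: "integrable I.P (\<lambda>x. (\<phi> (fst (f x)))\<^sup>2)"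
    by (rule I.cubic_lipschitz_square_integrable[OF fst_f_measurable \<phi> lip s2 r8 r_s mom b0 d])
  obtain A where A: "A > 0" "\<And>j. I.resample_sq (\<lambda>x. \<phi> (fst (f x))) j \<le> (A * b j)\<^sup>2"
    using I.cubic_lipschitz_resample[OF fst_f_measurable \<phi> lip s2 r8 r_s mom b0 d] by auto
  have "prob {w \<in> space M. \<eta> \<le> \<bar>(\<Sum>t=1..n. \<phi> (Y (int t + 0) w)) / real n - (\<integral>x. \<phi> (fst (f x)) \<partial>I.P)\<bar>}
     \<le> (\<Sum>j. A * b j)\<^sup>2 / (2 * \<eta>\<^sup>2 * real n)" if "n > 0" for n
  proof (rule weak_law_rate[OF _ sq _ _ A(2) _ _ \<eta> that, where U="\<lambda>t w. \<phi> (Y t w)"])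
    show "AE w in M. \<phi> (Y t w) = \<phi> (fst (f (history t w)))" for t
      using Y_history[of t] by eventually_elim simp
    show "(\<lambda>x. \<phi> (fst (f x))) \<in> borel_measurable I.P" by measurable
    show "0 < A * b j" for j using A(1) b0 by simp
    show "summable (\<lambda>j. A * b j)" by (rule summable_mult[OF bs])
    show "(\<lambda>w. \<phi> (Y t w)) \<in> borel_measurable M" for t by measurable
  qed
  then show ?thesis
    by (intro exI[of _ "(\<Sum>j. A * b j)\<^sup>2 / (2 * \<eta>\<^sup>2)"]) simp
qed

end

section \<open>The score as a martingale\<close>

lemma sum3_square_le:
  fixes x y z :: real
  shows "(x + y + z)\<^sup>2 \<le> 3 * (x\<^sup>2 + y\<^sup>2 + z\<^sup>2)"
  using zero_le_power2[of "x - y"] zero_le_power2[of "y - z"] zero_le_power2[of "x - z"]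
  by (simp add: power2_eq_square algebra_simps)

lemma sum3_fourth_power_le:
  fixes a b c :: real
  shows "(a + b + c) ^ 4 \<le> 27 * (a ^ 4 + b ^ 4 + c ^ 4)"
proof -
  have "(a + b + c) ^ 4 = ((a + b + c)\<^sup>2)\<^sup>2" by (simp add: power_mult[symmetric])
  also have "\<dots> \<le> (3 * (a\<^sup>2 + b\<^sup>2 + c\<^sup>2))\<^sup>2" by (intro power_mono sum3_square_le) simp
  also have "\<dots> = 9 * (a\<^sup>2 + b\<^sup>2 + c\<^sup>2)\<^sup>2" unfolding power_mult_distrib by simp
  also have "\<dots> \<le> 9 * (3 * ((a\<^sup>2)\<^sup>2 + (b\<^sup>2)\<^sup>2 + (c\<^sup>2)\<^sup>2))" by (intro mult_left_mono sum3_square_le) simp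
  finally show ?thesis by (simp add: power_mult[symmetric])
qed

text \<open>Makes empirical fourth moments admissible in the weak law, whose test functions may have
  a Lipschitz factor of cubic growth.\<close>

lemma fourth_power_lipschitz:
  fixes a b :: real
  assumes "a \<ge> 0" "b \<ge> 0"
  shows "\<bar>a ^ 4 - b ^ 4\<bar> \<le> 1 * (1 + a + b) ^ 3 * \<bar>a - b\<bar>"
proof -
  have "a ^ 4 - b ^ 4 = ((a + b) * (a\<^sup>2 + b\<^sup>2)) * (a - b)" by (simp add: eval_nat_numeral algebra_simps)
  then have "\<bar>a ^ 4 - b ^ 4\<bar> = (a + b) * (a\<^sup>2 + b\<^sup>2) * \<bar>a - b\<bar>"
    using assms by (simp add: abs_mult)
  also have "\<dots> \<le> (1 + a + b) * (1 + a + b)\<^sup>2 * \<bar>a - b\<bar>"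
    using assms by (intro mult_right_mono mult_mono) (auto simp: power2_eq_square algebra_simps add_nonneg_nonneg)
  finally show ?thesis by (simp add: power2_eq_square power3_eq_cube mult.assoc)
qed

context glm_model
begin

section \<open>The observed filtration and the link function\<close>

abbreviation F :: "int \<Rightarrow> 'w measure" where
  "F t \<equiv> past M (observation_space k) (\<lambda>t w. (Y t w, X t w)) t"

lemma V_measurable: "(\<lambda>w. (Y t w, X t w)) \<in> measurable M (observation_space k)"
  unfolding observation_space_def by measurable

lemma space_F: "space (F t) = space M"
  and sets_F: "sets (F t) = sigma_sets (space M) (\<Union>u\<in>{..t}. {(\<lambda>w. (Y u w, X u w)) -` A \<inter> space M |A. A \<in> sets (observation_space k)})"
  unfolding past_def by (subst space_measure_of sets_measure_of; auto)+

lemma subalgebra_F: "subalgebra M (F t)"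
proof -
  have "(\<Union>u\<in>{..t}. {(\<lambda>w. (Y u w, X u w)) -` A \<inter> space M |A. A \<in> sets (observation_space k)}) \<subseteq> sets M"
    by (rule UN_least) (auto intro: measurable_sets[OF V_measurable])
  then show ?thesis unfolding subalgebra_def space_F sets_F by (intro conjI refl sets.sigma_sets_subset)
qed

lemma F_mono: assumes "u \<le> t" shows "sets (F u) \<subseteq> sets (F t)"
  unfolding sets_F by (rule sigma_sets_mono', rule UN_mono) (use assms in simp_all)

lemma V_F: assumes "u \<le> t" shows "(\<lambda>w. (Y u w, X u w)) \<in> measurable (F t) (observation_space k)"
proof (rule measurableI)
  fix w assume "w \<in> space (F t)"
  then show "(Y u w, X u w) \<in> space (observation_space k)"
    unfolding space_F by (rule measurable_space[OF V_measurable])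
next
  fix A assume "A \<in> sets (observation_space k)"
  with assms show "(\<lambda>w. (Y u w, X u w)) -` A \<inter> space (F t) \<in> sets (F t)"
    unfolding space_F sets_F by (intro sigma_sets.Basic UN_I[of u]) auto
qed

lemma Y_F: assumes "u \<le> t" shows "Y u \<in> borel_measurable (F t)"
  using V_F[OF assms] unfolding observation_space_def by (simp add: measurable_pair_iff comp_def)

lemma Z_F: assumes "u \<le> t" shows "Z u \<in> borel_measurable (F t)"
proof (rule borel_measurable_vec_componentwise)
  fix i
  consider "pos i = 0" | "pos i \<noteq> 0" "pos i \<le> p" | "\<not> pos i \<le> p" by linarith
  then show "(\<lambda>w. Z u w $ i) \<in> borel_measurable (F t)"
  proof cases
    case 2
    then have "Y (u + 1 - int (pos i)) \<in> borel_measurable (F t)" using assms by (intro Y_F) linarith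
    then show ?thesis using 2 by (simp add: regressor_def)
  next
    case 3
    have "X u \<in> measurable (F t) (covariate_space k)"
      using V_F[OF assms] unfolding observation_space_def by (simp add: measurable_pair_iff comp_def)
    then have "(\<lambda>w. X u w (pos i - p - 1)) \<in> borel_measurable (F t)"
      by (rule measurable_compose[OF _ covariate_component[OF pos_cov[OF 3]]])
    then show ?thesis using 3 by (auto simp: regressor_def)
  qed (simp add: regressor_def)
qed

lemma g_measurable [measurable]: "g \<in> borel_measurable borel"
  by (intro borel_measurable_continuous_onI continuous_at_imp_continuous_on ballI
      differentiable_imp_continuous_within g_diff)

lemma g'_measurable [measurable]: "deriv g \<in> borel_measurable borel"
  by (rule borel_measurable_continuous_onI[OF g'_cont])

lemma g_deriv: "(g has_real_derivative deriv g u) (at u)"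
  using g_diff[of u] by (simp add: DERIV_deriv_iff_real_differentiable)

text \<open>The difference quotients inherit the Lipschitz constant of \<open>g\<close>.\<close>

lemma g'_le: "\<bar>deriv g u\<bar> \<le> C'"
proof -
  have "(\<lambda>h. (g (u + h) - g u) / h) \<midarrow>0\<rightarrow> deriv g u" using g_deriv[of u] by (simp add: DERIV_def)
  then have "(\<lambda>h. \<bar>(g (u + h) - g u) / h\<bar>) \<midarrow>0\<rightarrow> \<bar>deriv g u\<bar>" by (rule tendsto_rabs)
  moreover have "\<forall>\<^sub>F h in at 0. \<bar>(g (u + h) - g u) / h\<bar> \<le> C'"
  proof (rule eventually_at_filter[THEN iffD2], rule always_eventually, intro allI impI)
    fix h :: real assume "h \<noteq> 0"
    then show "\<bar>(g (u + h) - g u) / h\<bar> \<le> C'" using g_lip[of "u + h" u] by (simp add: abs_divide divide_le_eq)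
  qed
  ultimately show ?thesis by (intro tendsto_upperbound) auto
qed

lemma power8_le_powr:
  assumes "(x::real) \<ge> 0" shows "x ^ 8 \<le> 1 + x powr r"
proof (cases "x \<le> 1")
  case True
  with assms have "x ^ 8 \<le> 1" by (intro power_le_one)
  then show ?thesis by (simp add: add_increasing2)
next
  case False
  then have "x ^ 8 = x powr 8" by (simp add: powr_numeral)
  also have "\<dots> \<le> x powr r" using False r9 by (intro powr_mono) auto
  finally show ?thesis by simp
qed

text \<open>Order 8 because the score increments grow quadratically in the data and the martingale
  bound uses their fourth moments. The value is the same for every pair of times since all histories
  have one law.\<close>

definition m8 :: real where "m8 = (\<integral>x. fst (f x) ^ 8 + norm (Zf x) ^ 8 \<partial>I.P)"

lemma moment8:
  "integrable M (\<lambda>w. Y t w ^ 8)" "integrable M (\<lambda>w. norm (Z u w) ^ 8)"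
  "(\<integral>w. Y t w ^ 8 + norm (Z u w) ^ 8 \<partial>M) = m8"
proof -
  have 1: "integrable I.P (\<lambda>x. fst (f x) ^ 8)"
  proof (rule Bochner_Integration.integrable_bound)
    show "integrable I.P (\<lambda>x. 1 + \<bar>fst (f x)\<bar> powr r)" using moment_fst by simp
    show "AE x in I.P. norm (fst (f x) ^ 8) \<le> norm (1 + \<bar>fst (f x)\<bar> powr r)"
      using power8_le_powr[OF abs_ge_zero] by (intro AE_I2) (simp add: power_abs abs_of_nonneg add_nonneg_nonneg)
  qed measurable
  have 2: "integrable I.P (\<lambda>x. norm (Zf x) ^ 8)"
  proof (rule Bochner_Integration.integrable_bound)
    show "integrable I.P (\<lambda>x. 1 + norm (Zf x) powr r)" using moment_Zf by simp
    show "AE x in I.P. norm (norm (Zf x) ^ 8) \<le> norm (1 + norm (Zf x) powr r)"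
      using power8_le_powr[OF norm_ge_zero] by (intro AE_I2) (simp add: abs_of_nonneg add_nonneg_nonneg)
  qed measurable
  have Yi: "integrable M (\<lambda>w. fst (f (history t w)) ^ 8)" "(\<integral>w. fst (f (history t w)) ^ 8 \<partial>M) = (\<integral>x. fst (f x) ^ 8 \<partial>I.P)"
    using integrable_history[of "\<lambda>x. fst (f x) ^ 8" t] integral_history[of "\<lambda>x. fst (f x) ^ 8" t] 1 by simp_all
  have Zi: "integrable M (\<lambda>w. norm (Zf (history u w)) ^ 8)" "(\<integral>w. norm (Zf (history u w)) ^ 8 \<partial>M) = (\<integral>x. norm (Zf x) ^ 8 \<partial>I.P)"
    using integrable_history[of "\<lambda>x. norm (Zf x) ^ 8" u] integral_history[of "\<lambda>x. norm (Zf x) ^ 8" u] 2 by simp_all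
  have aY: "AE w in M. fst (f (history t w)) ^ 8 = Y t w ^ 8" using Y_history[of t] by eventually_elim simp
  have aZ: "AE w in M. norm (Zf (history u w)) ^ 8 = norm (Z u w) ^ 8" using Z_history[of u] by eventually_elim simp
  show 3: "integrable M (\<lambda>w. Y t w ^ 8)"
    by (rule integrable_cong_AE[THEN iffD1, OF _ _ aY Yi(1)]) measurable
  show 4: "integrable M (\<lambda>w. norm (Z u w) ^ 8)"
    by (rule integrable_cong_AE[THEN iffD1, OF _ _ aZ Zi(1)]) measurable
  have "(\<integral>w. Y t w ^ 8 \<partial>M) = (\<integral>x. fst (f x) ^ 8 \<partial>I.P)"
    unfolding Yi(2)[symmetric] by (rule integral_cong_AE[OF _ _ AE_symmetric[OF aY]]) measurable
  moreover have "(\<integral>w. norm (Z u w) ^ 8 \<partial>M) = (\<integral>x. norm (Zf x) ^ 8 \<partial>I.P)"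
    unfolding Zi(2)[symmetric] by (rule integral_cong_AE[OF _ _ AE_symmetric[OF aZ]]) measurable
  ultimately show "(\<integral>w. Y t w ^ 8 + norm (Z u w) ^ 8 \<partial>M) = m8"
    unfolding m8_def using 1 2 3 4 by simp
qed

text \<open>Component \<open>i\<close> of the score increment at time \<open>t + 1\<close>; the
  index is moved by one so that the increments start at 0 and \<open>D i t\<close> has conditional
  mean zero given \<open>F (int t)\<close>.\<close>

definition D :: "'d \<Rightarrow> nat \<Rightarrow> 'w \<Rightarrow> real" where
  "D i t w = (Y (int t + 1) w - g (\<theta>\<^sub>0 \<bullet> Z (int t) w)) * Z (int t) w $ i"

text \<open>The parenthesis is the linear growth constant of the residual; 27 comes from the bound
  for the fourth power of a sum of three terms.\<close>

definition \<kappa> :: real where "\<kappa> = 27 * (1 + \<bar>g 0\<bar> + C' * norm \<theta>\<^sub>0)\<^sup>2"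

lemma \<kappa>: "\<kappa> \<ge> 0" by (simp add: \<kappa>_def)

lemma score_square_le:
  fixes z :: "real ^ 'd"
  shows "((y - g (\<theta>\<^sub>0 \<bullet> z)) * z $ i)\<^sup>2 \<le> \<kappa> * (1 + y ^ 4 + norm z ^ 4)"
proof -
  define A where "A = 1 + \<bar>g 0\<bar> + C' * norm \<theta>\<^sub>0"
  have A: "A \<ge> 1" unfolding A_def using C' by simp
  let ?n = "1 + \<bar>y\<bar> + norm z"
  have "\<bar>g (\<theta>\<^sub>0 \<bullet> z)\<bar> \<le> \<bar>g 0\<bar> + C' * \<bar>\<theta>\<^sub>0 \<bullet> z\<bar>" using g_lip[of "\<theta>\<^sub>0 \<bullet> z" 0] by simp
  also have "\<dots> \<le> \<bar>g 0\<bar> + C' * (norm \<theta>\<^sub>0 * norm z)"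
    using C' Cauchy_Schwarz_ineq2 by (intro add_left_mono mult_left_mono) auto
  finally have "\<bar>y - g (\<theta>\<^sub>0 \<bullet> z)\<bar> \<le> \<bar>y\<bar> + \<bar>g 0\<bar> * 1 + (C' * norm \<theta>\<^sub>0) * norm z" by simp
  also have "\<dots> \<le> 1 * ?n + \<bar>g 0\<bar> * ?n + (C' * norm \<theta>\<^sub>0) * ?n"
    using C' by (intro add_mono mult_left_mono) auto
  also have "\<dots> = A * ?n" by (simp add: A_def algebra_simps)
  finally have 1: "\<bar>y - g (\<theta>\<^sub>0 \<bullet> z)\<bar> \<le> A * ?n" .
  have 2: "\<bar>z $ i\<bar> \<le> ?n" using component_le_norm_cart[of z i] by linarith
  have "\<bar>(y - g (\<theta>\<^sub>0 \<bullet> z)) * z $ i\<bar> \<le> (A * ?n) * ?n"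
    unfolding abs_mult using A by (intro mult_mono 1 2) auto
  then have "\<bar>(y - g (\<theta>\<^sub>0 \<bullet> z)) * z $ i\<bar>\<^sup>2 \<le> (A * ?n * ?n)\<^sup>2" by (intro power_mono) auto
  also have "\<dots> = A\<^sup>2 * ?n ^ 4" by (simp add: power_mult_distrib eval_nat_numeral)
  also have "\<dots> \<le> A\<^sup>2 * (27 * (1 ^ 4 + \<bar>y\<bar> ^ 4 + norm z ^ 4))" by (intro mult_left_mono sum3_fourth_power_le) simp
  also have "\<dots> = \<kappa> * (1 + y ^ 4 + norm z ^ 4)" by (simp add: \<kappa>_def A_def)
  finally show ?thesis by simp
qed

lemma D_measurable_F: "D i t \<in> borel_measurable (F (int t + 1))"
proof -
  have Y: "Y (int t + 1) \<in> borel_measurable (F (int t + 1))" and Z: "Z (int t) \<in> borel_measurable (F (int t + 1))"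
    by (intro Y_F Z_F; simp)+
  have "(\<lambda>w. Z (int t) w $ i) \<in> borel_measurable (F (int t + 1))" "(\<lambda>w. g (\<theta>\<^sub>0 \<bullet> Z (int t) w)) \<in> borel_measurable (F (int t + 1))"
    using measurable_compose[OF Z, of "\<lambda>z. z $ i" borel] measurable_compose[OF Z, of "\<lambda>z. g (\<theta>\<^sub>0 \<bullet> z)" borel] by simp_all
  then show ?thesis unfolding D_def[abs_def] by (intro borel_measurable_times borel_measurable_diff Y)
qed

lemma D_measurable [measurable]: "D i t \<in> borel_measurable M"
  using measurable_from_subalg[OF subalgebra_F D_measurable_F] .

lemma D_fourth_moment:
  "integrable M (\<lambda>w. D i t w ^ 4)" "(\<integral>w. D i t w ^ 4 \<partial>M) \<le> 3 * \<kappa>\<^sup>2 * (1 + m8)"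
proof -
  have le: "D i t w ^ 4 \<le> 3 * \<kappa>\<^sup>2 * (1 + (Y (int t + 1) w ^ 8 + norm (Z (int t) w) ^ 8))" for w
  proof -
    let ?y = "Y (int t + 1) w" and ?z = "norm (Z (int t) w)"
    have "D i t w ^ 4 = ((D i t w)\<^sup>2)\<^sup>2" by (simp add: power_mult[symmetric])
    also have "\<dots> \<le> (\<kappa> * (1 + ?y ^ 4 + ?z ^ 4))\<^sup>2"
      unfolding D_def by (intro power_mono score_square_le) simp
    also have "\<dots> = \<kappa>\<^sup>2 * (1 + ?y ^ 4 + ?z ^ 4)\<^sup>2" by (simp add: power_mult_distrib)
    also have "(1 + ?y ^ 4 + ?z ^ 4)\<^sup>2 \<le> 3 * (1 + (?y ^ 4)\<^sup>2 + (?z ^ 4)\<^sup>2)"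
      using sum3_square_le[of 1 "?y ^ 4" "?z ^ 4"] by simp
    finally have "D i t w ^ 4 \<le> \<kappa>\<^sup>2 * (3 * (1 + (?y ^ 4)\<^sup>2 + (?z ^ 4)\<^sup>2))" by (simp add: mult_left_mono)
    then show ?thesis by (simp add: power_mult[symmetric] algebra_simps)
  qed
  have i: "integrable M (\<lambda>w. 3 * \<kappa>\<^sup>2 * (1 + (Y (int t + 1) w ^ 8 + norm (Z (int t) w) ^ 8)))"
    using moment8(1)[of "int t + 1"] moment8(2)[of "int t"] by simp
  show D4: "integrable M (\<lambda>w. D i t w ^ 4)"
    using le by (intro Bochner_Integration.integrable_bound[OF i] AE_I2) (auto intro: order_trans[OF _ abs_ge_self])
  have "(\<integral>w. D i t w ^ 4 \<partial>M) \<le> (\<integral>w. 3 * \<kappa>\<^sup>2 * (1 + (Y (int t + 1) w ^ 8 + norm (Z (int t) w) ^ 8)) \<partial>M)"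
    by (rule integral_mono[OF D4 i le])
  also have "\<dots> = 3 * \<kappa>\<^sup>2 * (1 + (\<integral>w. Y (int t + 1) w ^ 8 + norm (Z (int t) w) ^ 8 \<partial>M))"
    using moment8(1)[of "int t + 1"] moment8(2)[of "int t"] by (simp add: prob_space)
  finally show "(\<integral>w. D i t w ^ 4 \<partial>M) \<le> 3 * \<kappa>\<^sup>2 * (1 + m8)" using moment8(3) by simp
qed

text \<open>\<open>Q\<close> times the regressor component is known at time \<open>t\<close>, so the
  model equation for the conditional mean can be tested against it. The work lies in the
  integrability of the product with the response, which comes from second moments and hence from the
  eighth.\<close>

lemma D_martingale:
  assumes Q: "Q \<in> borel_measurable (F (int t))" and K: "\<And>w. \<bar>Q w\<bar> \<le> K"
  shows "(\<integral>w. Q w * D i t w \<partial>M) = 0"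
proof -
  note QM[measurable] = measurable_from_subalg[OF subalgebra_F Q]
  define h where "h w = Q w * Z (int t) w $ i" for w
  have "Z (int t) \<in> borel_measurable (F (int t))" by (rule Z_F) simp
  then have "(\<lambda>w. Z (int t) w $ i) \<in> borel_measurable (F (int t))" by (rule measurable_compose) measurable
  with Q have hF: "h \<in> borel_measurable (F (int t))" unfolding h_def[abs_def] by (rule borel_measurable_times)
  note hM[measurable] = measurable_from_subalg[OF subalgebra_F hF]
  have K0: "K \<ge> 0" using K[of undefined] by linarith
  have hY: "integrable M (\<lambda>w. h w * Y (int t + 1) w)"
  proof (rule Bochner_Integration.integrable_bound)
    show "integrable M (\<lambda>w. K * (2 + Y (int t + 1) w ^ 8 + norm (Z (int t) w) ^ 8))"
      using moment8(1)[of "int t + 1"] moment8(2)[of "int t"] by simp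
    show "AE w in M. norm (h w * Y (int t + 1) w) \<le> norm (K * (2 + Y (int t + 1) w ^ 8 + norm (Z (int t) w) ^ 8))"
    proof (intro AE_I2)
      fix w
      let ?y = "Y (int t + 1) w" and ?z = "Z (int t) w"
      have sq8: "x\<^sup>2 \<le> 1 + x ^ 8" for x :: real using power_le_one_plus_power[of "\<bar>x\<bar>" 2 8] by simp
      have "\<bar>?z $ i * ?y\<bar> \<le> norm ?z * \<bar>?y\<bar>"
        unfolding abs_mult by (intro mult_right_mono component_le_norm_cart) simp
      also have "\<dots> \<le> (norm ?z)\<^sup>2 + ?y\<^sup>2"
        using sum_squares_bound[of "norm ?z" "\<bar>?y\<bar>"] mult_nonneg_nonneg[OF norm_ge_zero[of ?z] abs_ge_zero[of ?y]] unfolding power2_abs by linarith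
      also have "\<dots> \<le> 2 + ?y ^ 8 + norm ?z ^ 8" using sq8[of "norm ?z"] sq8[of ?y] by linarith
      finally have "\<bar>Q w\<bar> * \<bar>?z $ i * ?y\<bar> \<le> K * (2 + ?y ^ 8 + norm ?z ^ 8)"
        using K0 by (intro mult_mono K) auto
      then show "norm (h w * ?y) \<le> norm (K * (2 + ?y ^ 8 + norm ?z ^ 8))"
        unfolding h_def real_norm_def by (intro order_trans[OF _ abs_ge_self]) (simp add: abs_mult mult.assoc)
    qed
  qed measurable
  interpret sigma_finite_subalgebra M "F (int t)"
    by (intro finite_measure_subalgebra_is_sigma_finite finite_measure_subalgebra.intro finite_measure_axioms
        finite_measure_subalgebra_axioms.intro subalgebra_F)
  have ae: "AE w in M. h w * real_cond_exp M (F (int t)) (Y (int t + 1)) w = h w * g (\<theta>\<^sub>0 \<bullet> Z (int t) w)"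
    using cond_exp[of "int t + 1"] by (auto simp: linear_predictor_def)
  have c: "integrable M (\<lambda>w. h w * real_cond_exp M (F (int t)) (Y (int t + 1)) w)"
    "(\<integral>w. h w * real_cond_exp M (F (int t)) (Y (int t + 1)) w \<partial>M) = (\<integral>w. h w * Y (int t + 1) w \<partial>M)"
    using real_cond_exp_intg[OF hY hF] by auto
  have gi: "integrable M (\<lambda>w. h w * g (\<theta>\<^sub>0 \<bullet> Z (int t) w))"
    by (rule integrable_cong_AE[THEN iffD1, OF _ _ ae c(1)]) measurable
  have "(\<integral>w. h w * g (\<theta>\<^sub>0 \<bullet> Z (int t) w) \<partial>M) = (\<integral>w. h w * Y (int t + 1) w \<partial>M)"
    unfolding c(2)[symmetric] by (rule integral_cong_AE[OF _ _ AE_symmetric[OF ae]]) measurable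
  moreover have "(\<integral>w. Q w * D i t w \<partial>M) = (\<integral>w. h w * Y (int t + 1) w - h w * g (\<theta>\<^sub>0 \<bullet> Z (int t) w) \<partial>M)"
    by (rule Bochner_Integration.integral_cong) (auto simp: D_def h_def algebra_simps)
  ultimately show ?thesis using hY gi by simp
qed

text \<open>The sign \<sigma> yields both tails from a one-sided bound; the second and fourth powers
  do not see it.\<close>

lemma D_exponential_tail:
  assumes "\<bar>\<sigma>\<bar> = 1" and l: "l > 0"
  shows "prob {w \<in> space M. L + 1 \<le> (\<Sum>t<n. l * (\<sigma> * D i t w) - 2 * (l * (\<sigma> * D i t w))\<^sup>2)}
     \<le> exp (- L) + 4 * l ^ 4 * (real n * (3 * \<kappa>\<^sup>2 * (1 + m8)))"
proof (rule martingale_exponential_tail[where F="\<lambda>t. F (int t)"])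
  have s4: "\<sigma> ^ 4 = 1" 
  proof -
    have "\<sigma> = 1 \<or> \<sigma> = -1" using assms(1) by linarith
    then show ?thesis by auto
  qed
  fix t
  show "subalgebra M (F (int t))" by (rule subalgebra_F)
  show "sets (F (int t)) \<subseteq> sets (F (int (Suc t)))" by (rule F_mono) simp
  show "(\<lambda>w. \<sigma> * D i t w) \<in> borel_measurable (F (int (Suc t)))"
    using D_measurable_F[of i t] by (simp add: add.commute)
  show "integrable M (\<lambda>w. (\<sigma> * D i t w) ^ 4)" "(\<integral>w. (\<sigma> * D i t w) ^ 4 \<partial>M) \<le> 3 * \<kappa>\<^sup>2 * (1 + m8)"
    using D_fourth_moment[of i t] by (simp_all add: power_mult_distrib s4)
  fix Q :: "'w \<Rightarrow> real" and K
  assume "Q \<in> borel_measurable (F (int t))" "\<And>w. \<bar>Q w\<bar> \<le> K"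
  then have "(\<integral>w. Q w * D i t w \<partial>M) = 0" by (rule D_martingale)
  moreover have "(\<integral>w. Q w * (\<sigma> * D i t w) \<partial>M) = (\<integral>w. \<sigma> * (Q w * D i t w) \<partial>M)"
    by (simp add: mult_ac)
  ultimately show "(\<integral>w. Q w * (\<sigma> * D i t w) \<partial>M) = 0" by simp
qed (rule l)

end

section \<open>Empirical information and the estimating equation\<close>

context glm_model
begin

section \<open>Exceptional events and the size of the score\<close>

definition mZ :: real where "mZ = (\<integral>x. norm (Zf x) ^ 4 \<partial>I.P)"
definition mY :: real where "mY = (\<integral>x. fst (f x) ^ 4 \<partial>I.P)"

definition badZ :: "nat \<Rightarrow> 'w set" where
  "badZ n = {w \<in> space M. 1 \<le> \<bar>(\<Sum>t=1..n. norm (Z (int t - 1) w) ^ 4) / real n - mZ\<bar>}"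
definition badY :: "nat \<Rightarrow> 'w set" where
  "badY n = {w \<in> space M. 1 \<le> \<bar>(\<Sum>t=1..n. Y (int t) w ^ 4) / real n - mY\<bar>}"
text \<open>With tilt \<open>l = sqrt (ln n / n)\<close> and level \<open>ln n\<close>, the
  exponential term of the tail bound is \<open>1 / n\<close> and the quartic cost
  \<open>n * l ^ 4\<close> is \<open>ln^2 n / n\<close>.\<close>

definition badS :: "real \<Rightarrow> 'd \<Rightarrow> nat \<Rightarrow> 'w set" where
  "badS \<sigma> i n = {w \<in> space M. ln (real n) + 1 \<le>
     (\<Sum>t<n. sqrt (ln (real n) / real n) * (\<sigma> * D i t w) - 2 * (sqrt (ln (real n) / real n) * (\<sigma> * D i t w))\<^sup>2)}"

lemma bad_events [measurable]: "badZ n \<in> events" "badY n \<in> events" "badS \<sigma> i n \<in> events"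
  unfolding badZ_def badY_def badS_def by measurable

lemma prob_badZ: "\<exists>K. \<forall>n>0. prob (badZ n) \<le> K / real n"
  unfolding badZ_def mZ_def
proof (rule weak_law_Z(2)[where c=1])
  fix x y :: "real ^ 'd"
  have "\<bar>norm x ^ 4 - norm y ^ 4\<bar> \<le> 1 * (1 + norm x + norm y) ^ 3 * \<bar>norm x - norm y\<bar>"
    by (rule fourth_power_lipschitz) auto
  also have "\<dots> \<le> 1 * (1 + norm x + norm y) ^ 3 * norm (x - y)"
    by (intro mult_left_mono norm_triangle_ineq3) auto
  finally show "\<bar>norm x ^ 4 - norm y ^ 4\<bar> \<le> 1 * (1 + norm x + norm y) ^ 3 * norm (x - y)" .
qed auto

lemma prob_badY: "\<exists>K. \<forall>n>0. prob (badY n) \<le> K / real n"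
  unfolding badY_def mY_def
proof (rule weak_law_Y[where c=1])
  fix x y :: real
  have "\<bar>\<bar>x\<bar> ^ 4 - \<bar>y\<bar> ^ 4\<bar> \<le> 1 * (1 + \<bar>x\<bar> + \<bar>y\<bar>) ^ 3 * \<bar>\<bar>x\<bar> - \<bar>y\<bar>\<bar>"
    by (rule fourth_power_lipschitz) auto
  also have "\<dots> \<le> 1 * (1 + \<bar>x\<bar> + \<bar>y\<bar>) ^ 3 * \<bar>x - y\<bar>"
    by (intro mult_left_mono abs_triangle_ineq3) auto
  finally show "\<bar>x ^ 4 - y ^ 4\<bar> \<le> 1 * (1 + norm x + norm y) ^ 3 * norm (x - y)"
    by simp
qed auto

lemma prob_badS:
  assumes "\<bar>\<sigma>\<bar> = 1" "n \<ge> 3"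
  shows "prob (badS \<sigma> i n) \<le> (1 + 12 * \<kappa>\<^sup>2 * (1 + m8)) * (1 + (ln (real n))\<^sup>2) / real n"
proof -
  have ln: "ln (real n) > 0" using assms(2) by simp
  define l where "l = sqrt (ln (real n) / real n)"
  have l: "l > 0" unfolding l_def using ln assms(2) by simp
  have "l ^ 4 = (l\<^sup>2)\<^sup>2" by (simp add: power_mult[symmetric])
  also have "l\<^sup>2 = ln (real n) / real n" unfolding l_def using ln by simp
  finally have l4: "l ^ 4 = (ln (real n))\<^sup>2 / (real n)\<^sup>2" by (simp add: power_divide)
  have m8: "m8 \<ge> 0" unfolding m8_def by (intro Bochner_Integration.integral_nonneg) simp
  have "prob (badS \<sigma> i n) \<le> exp (- ln (real n)) + 4 * l ^ 4 * (real n * (3 * \<kappa>\<^sup>2 * (1 + m8)))"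
    unfolding badS_def l_def[symmetric] by (rule D_exponential_tail[OF assms(1) l])
  also have "\<dots> = (1 + 12 * \<kappa>\<^sup>2 * (1 + m8) * (ln (real n))\<^sup>2) / real n"
    using assms(2) unfolding l4 by (simp add: exp_minus power2_eq_square field_simps)
  also have "\<dots> \<le> (1 + 12 * \<kappa>\<^sup>2 * (1 + m8)) * (1 + (ln (real n))\<^sup>2) / real n"
  proof (intro divide_right_mono)
    have "1 + m * x \<le> (1 + m) * (1 + x)" if "m \<ge> 0" "x \<ge> 0" for m x :: real
      using that by (simp add: distrib_left distrib_right)
    then show "1 + 12 * \<kappa>\<^sup>2 * (1 + m8) * (ln (real n))\<^sup>2 \<le> (1 + 12 * \<kappa>\<^sup>2 * (1 + m8)) * (1 + (ln (real n))\<^sup>2)"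
      using m8 by simp
  qed simp
  finally show ?thesis .
qed

text \<open>Off the bad events \<open>l\<close> times the score sum is at most
  \<open>ln n + 1 + 2 * l\<^sup>2\<close> times the sum of squares. Here
  \<open>l\<^sup>2 * n = ln n\<close>, and \<open>\<kappa> * (3 + mY + mZ)\<close> bounds the mean
  square; the 2 in front uses \<open>1 \<le> ln n\<close>.\<close>

definition B :: real where "B = 2 + 2 * (\<kappa> * (3 + mY + mZ))"

lemma B_ge: "B \<ge> 2"
proof -
  have "mY \<ge> 0" "mZ \<ge> 0" unfolding mY_def mZ_def by (intro Bochner_Integration.integral_nonneg; simp)+
  then show ?thesis unfolding B_def using \<kappa> by simp
qed

text \<open>The self-normalised bound is made deterministic: the fourth-moment events bound the sum
  of squared increments by a multiple of \<open>n\<close>, and division by the tilt \<open>l\<close>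
  turns \<open>ln n\<close> into \<open>sqrt (n * ln n)\<close>.\<close>

lemma score_component_bound:
  assumes n: "n \<ge> 3" and w: "w \<in> space M" "w \<notin> badZ n" "w \<notin> badY n" "w \<notin> badS 1 i n" "w \<notin> badS (-1) i n"
  shows "\<bar>\<Sum>t<n. D i t w\<bar> \<le> B * sqrt (real n * ln (real n))"
proof -
  have n0: "real n > 0" using n by simp
  \<comment> \<open>The threshold \<open>n \<ge> 3\<close> is chosen because
    \<open>exp 1 \<le> 3\<close>.\<close>
  have ln1: "ln (real n) \<ge> 1"
  proof -
    have "exp 1 \<le> real n" using exp_le n by simp
    then show ?thesis using n0 by (simp add: ln_ge_iff)
  qed
  define l where "l = sqrt (ln (real n) / real n)"
  have l: "l > 0" unfolding l_def using ln1 n by (intro real_sqrt_gt_zero divide_pos_pos) auto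
  have l2: "l\<^sup>2 * real n = ln (real n)" unfolding l_def using ln1 n0 by simp
  have sZ: "(\<Sum>t<n. norm (Z (int t) w) ^ 4) \<le> (mZ + 1) * real n"
  proof -
    have "(\<Sum>t=1..n. norm (Z (int t - 1) w) ^ 4) = (\<Sum>t<n. norm (Z (int t) w) ^ 4)"
      by (rule sum.reindex_bij_witness[of _ Suc "\<lambda>t. t - 1"]) (auto simp: of_nat_diff)
    moreover have "(\<Sum>t=1..n. norm (Z (int t - 1) w) ^ 4) / real n \<le> mZ + 1" using w(1,2) unfolding badZ_def by simp
    ultimately show ?thesis using n0 by (simp add: divide_le_eq)
  qed
  have sY: "(\<Sum>t<n. Y (int t + 1) w ^ 4) \<le> (mY + 1) * real n"
  proof -
    have "(\<Sum>t=1..n. Y (int t) w ^ 4) = (\<Sum>t<n. Y (int t + 1) w ^ 4)"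
      by (rule sum.reindex_bij_witness[of _ Suc "\<lambda>t. t - 1"]) (auto simp: of_nat_diff)
    moreover have "(\<Sum>t=1..n. Y (int t) w ^ 4) / real n \<le> mY + 1" using w(1,3) unfolding badY_def by simp
    ultimately show ?thesis using n0 by (simp add: divide_le_eq)
  qed
  have "(\<Sum>t<n. (D i t w)\<^sup>2) \<le> (\<Sum>t<n. \<kappa> * (1 + Y (int t + 1) w ^ 4 + norm (Z (int t) w) ^ 4))"
    unfolding D_def by (intro sum_mono score_square_le)
  also have "\<dots> = \<kappa> * (real n + (\<Sum>t<n. Y (int t + 1) w ^ 4) + (\<Sum>t<n. norm (Z (int t) w) ^ 4))"
    by (simp add: sum_distrib_left[symmetric] sum.distrib)
  also have "\<dots> \<le> \<kappa> * (real n + (mY + 1) * real n + (mZ + 1) * real n)"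
    by (intro mult_left_mono add_mono sZ sY \<kappa> order_refl)
  also have "\<dots> = \<kappa> * (3 + mY + mZ) * real n" by (simp add: algebra_simps)
  finally have D2: "(\<Sum>t<n. (D i t w)\<^sup>2) \<le> \<kappa> * (3 + mY + mZ) * real n" .
  have bound: "\<sigma> * (\<Sum>t<n. D i t w) \<le> B * sqrt (real n * ln (real n))" if s: "\<sigma>\<^sup>2 = 1" "w \<notin> badS \<sigma> i n" for \<sigma>
  proof -
    have "(\<Sum>t<n. l * (\<sigma> * D i t w) - 2 * (l * (\<sigma> * D i t w))\<^sup>2) = l * (\<sigma> * (\<Sum>t<n. D i t w)) - 2 * l\<^sup>2 * (\<Sum>t<n. (D i t w)\<^sup>2)"
      by (simp add: sum_subtractf sum_distrib_left power_mult_distrib s mult_ac)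
    then have "l * (\<sigma> * (\<Sum>t<n. D i t w)) \<le> ln (real n) + 1 + 2 * l\<^sup>2 * (\<Sum>t<n. (D i t w)\<^sup>2)"
      using s(2) w(1) unfolding badS_def l_def[symmetric] by simp
    also have "\<dots> \<le> ln (real n) + 1 + 2 * l\<^sup>2 * (\<kappa> * (3 + mY + mZ) * real n)"
      by (intro add_left_mono mult_left_mono D2) simp
    also have "\<dots> = ln (real n) + 1 + 2 * (\<kappa> * (3 + mY + mZ)) * (l\<^sup>2 * real n)" by (simp add: mult_ac)
    also have "\<dots> \<le> B * ln (real n)" unfolding l2 B_def using ln1 by (simp add: distrib_right)
    finally have "\<sigma> * (\<Sum>t<n. D i t w) \<le> B * ln (real n) / l" using l by (simp add: pos_le_divide_eq mult.commute)
    also have "\<dots> = B * sqrt (real n * ln (real n))"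
    proof -
      have "sqrt (real n * ln (real n)) * l = sqrt ((ln (real n))\<^sup>2)"
        unfolding l_def real_sqrt_mult[symmetric] using n0 by (simp add: power2_eq_square)
      then have "ln (real n) = sqrt (real n * ln (real n)) * l" using ln1 by simp
      then have "B * ln (real n) / l = B * (sqrt (real n * ln (real n)) * l) / l" by simp
      then show ?thesis using l by simp
    qed
    finally show ?thesis .
  qed
  show ?thesis using bound[of 1] bound[of "-1"] w(4,5) by (simp add: abs_le_iff)
qed

lemma score_bound:
  assumes n: "n \<ge> 3" and w: "w \<in> space M" "w \<notin> badZ n" "w \<notin> badY n"
    and s: "\<And>i. w \<notin> badS 1 i n" "\<And>i. w \<notin> badS (-1) i n"
  shows "norm (score n \<theta>\<^sub>0 w) \<le> real CARD('d) * B * sqrt (ln (real n) / real n)"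
proof -
  let ?S = "score n \<theta>\<^sub>0 w"
  have n0: "real n > 0" using n by simp
  have "?S $ i = (\<Sum>t<n. D i t w) / real n" for i
  proof -
    have "?S $ i = (\<Sum>t=1..n. (Y (int t) w - g (\<theta>\<^sub>0 \<bullet> Z (int t - 1) w)) * Z (int t - 1) w $ i) / real n"
      by (simp add: estimating_function_def linear_predictor_def)
    also have "(\<Sum>t=1..n. (Y (int t) w - g (\<theta>\<^sub>0 \<bullet> Z (int t - 1) w)) * Z (int t - 1) w $ i) = (\<Sum>t<n. D i t w)"
      unfolding D_def by (rule sum.reindex_bij_witness[of _ Suc "\<lambda>t. t - 1"]) (auto simp: of_nat_diff)
    finally show ?thesis .
  qed
  then have "\<bar>?S $ i\<bar> \<le> B * sqrt (ln (real n) / real n)" for i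
  proof -
    have "\<bar>?S $ i\<bar> = \<bar>\<Sum>t<n. D i t w\<bar> / real n" by (simp add: \<open>?S $ i = _\<close>)
    also have "\<dots> \<le> B * sqrt (real n * ln (real n)) / real n"
      by (intro divide_right_mono score_component_bound n w s) simp
    also have "\<dots> = B * sqrt (ln (real n) / real n)"
      using n0 by (simp add: real_sqrt_mult real_sqrt_divide field_simps)
    finally show ?thesis .
  qed
  then have "(\<Sum>i\<in>UNIV. \<bar>?S $ i\<bar>) \<le> (\<Sum>i\<in>(UNIV :: 'd set). B * sqrt (ln (real n) / real n))"
    by (intro sum_mono)
  then show ?thesis using norm_le_l1_cart[of ?S] by simp
qed

section \<open>Positive definiteness of the empirical information\<close>

lemma inner_square_vec: "(h \<bullet> z)\<^sup>2 = (\<Sum>i\<in>UNIV. \<Sum>j\<in>UNIV. (h $ i * h $ j) * (z $ i * z $ j))" for h z :: "real ^ 'd"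
  by (simp add: inner_vec_def power2_eq_square sum_product mult_ac)

text \<open>Product rule for differences: the bound on \<open>g'\<close> meets the Lipschitz factor
  of a quadratic form, and the Lipschitz constant of \<open>g'\<close> meets its quadratic size. The
  second product determines the cubic growth.\<close>

lemma information_component_lipschitz:
  fixes x y :: "real ^ 'd"
  shows "\<bar>deriv g (\<theta>\<^sub>0 \<bullet> x) * (x $ i * x $ j) - deriv g (\<theta>\<^sub>0 \<bullet> y) * (y $ i * y $ j)\<bar>
    \<le> C' * (1 + norm \<theta>\<^sub>0) * (1 + norm x + norm y) ^ 3 * norm (x - y)"
proof -
  let ?N = "1 + norm x + norm y"
  have x: "\<bar>x $ l\<bar> \<le> norm x" and y: "\<bar>y $ l\<bar> \<le> norm y" and xy: "\<bar>x $ l - y $ l\<bar> \<le> norm (x - y)" for l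
    using component_le_norm_cart[of x l] component_le_norm_cart[of y l] component_le_norm_cart[of "x - y" l] by auto
  have pow: "?N \<le> ?N ^ 3" "?N\<^sup>2 \<le> ?N ^ 3"
    using power_increasing[of 1 3 ?N] power_increasing[of 2 3 ?N] by simp_all
  have "x $ i * x $ j - y $ i * y $ j = x $ i * (x $ j - y $ j) + (x $ i - y $ i) * y $ j"
    by (simp add: algebra_simps)
  then have "\<bar>x $ i * x $ j - y $ i * y $ j\<bar> \<le> \<bar>x $ i\<bar> * \<bar>x $ j - y $ j\<bar> + \<bar>x $ i - y $ i\<bar> * \<bar>y $ j\<bar>"
    by (metis abs_mult abs_triangle_ineq)
  also have "\<dots> \<le> norm x * norm (x - y) + norm (x - y) * norm y"
    by (intro add_mono mult_mono x y xy) auto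
  also have "\<dots> \<le> ?N * norm (x - y)" by (simp add: algebra_simps)
  also have "\<dots> \<le> ?N ^ 3 * norm (x - y)" by (intro mult_right_mono pow) simp
  finally have 1: "\<bar>deriv g (\<theta>\<^sub>0 \<bullet> x) * (x $ i * x $ j - y $ i * y $ j)\<bar> \<le> C' * (?N ^ 3 * norm (x - y))"
    unfolding abs_mult using C' by (intro mult_mono g'_le) auto
  have "\<bar>deriv g (\<theta>\<^sub>0 \<bullet> x) - deriv g (\<theta>\<^sub>0 \<bullet> y)\<bar> \<le> C' * \<bar>\<theta>\<^sub>0 \<bullet> (x - y)\<bar>"
    using g'_lip[of "\<theta>\<^sub>0 \<bullet> x" "\<theta>\<^sub>0 \<bullet> y"] by (simp add: inner_diff_right)
  also have "\<dots> \<le> C' * (norm \<theta>\<^sub>0 * norm (x - y))"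
    using C' Cauchy_Schwarz_ineq2 by (intro mult_left_mono) auto
  finally have g2: "\<bar>deriv g (\<theta>\<^sub>0 \<bullet> x) - deriv g (\<theta>\<^sub>0 \<bullet> y)\<bar> \<le> C' * (norm \<theta>\<^sub>0 * norm (x - y))" .
  have "\<bar>y $ i * y $ j\<bar> \<le> ?N * ?N"
    unfolding abs_mult using y[of i] y[of j] norm_ge_zero[of x] by (intro mult_mono) linarith+
  also have "\<dots> \<le> ?N ^ 3" using pow(2) by (simp add: power2_eq_square)
  finally have "\<bar>(deriv g (\<theta>\<^sub>0 \<bullet> x) - deriv g (\<theta>\<^sub>0 \<bullet> y)) * (y $ i * y $ j)\<bar> \<le> (C' * (norm \<theta>\<^sub>0 * norm (x - y))) * ?N ^ 3"
    unfolding abs_mult[of "deriv g (\<theta>\<^sub>0 \<bullet> x) - deriv g (\<theta>\<^sub>0 \<bullet> y)"] using g2 C' by (intro mult_mono) auto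
  moreover have "deriv g (\<theta>\<^sub>0 \<bullet> x) * (x $ i * x $ j) - deriv g (\<theta>\<^sub>0 \<bullet> y) * (y $ i * y $ j) =
     deriv g (\<theta>\<^sub>0 \<bullet> x) * (x $ i * x $ j - y $ i * y $ j) + (deriv g (\<theta>\<^sub>0 \<bullet> x) - deriv g (\<theta>\<^sub>0 \<bullet> y)) * (y $ i * y $ j)"
    by (simp add: algebra_simps)
  ultimately have "\<bar>deriv g (\<theta>\<^sub>0 \<bullet> x) * (x $ i * x $ j) - deriv g (\<theta>\<^sub>0 \<bullet> y) * (y $ i * y $ j)\<bar>
     \<le> C' * (?N ^ 3 * norm (x - y)) + (C' * (norm \<theta>\<^sub>0 * norm (x - y))) * ?N ^ 3"
    using 1 by linarith
  also have "\<dots> = C' * (1 + norm \<theta>\<^sub>0) * ?N ^ 3 * norm (x - y)" by (simp add: algebra_simps)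
  finally show ?thesis .
qed

definition information :: "'d \<Rightarrow> 'd \<Rightarrow> real" where
  "information i j = (\<integral>x. deriv g (\<theta>\<^sub>0 \<bullet> Zf x) * (Zf x $ i * Zf x $ j) \<partial>I.P)"

lemma information_component_measurable [measurable]:
  "(\<lambda>z :: real ^ 'd. deriv g (\<theta>\<^sub>0 \<bullet> z) * (z $ i * z $ j)) \<in> borel_measurable borel"
  by measurable

lemma information_integrable: "integrable I.P (\<lambda>x. deriv g (\<theta>\<^sub>0 \<bullet> Zf x) * (Zf x $ i * Zf x $ j))"
  by (rule weak_law_Z(1)[OF information_component_measurable information_component_lipschitz zero_less_one])

lemma information_form:
  "(\<Sum>i\<in>UNIV. \<Sum>j\<in>UNIV. (h $ i * h $ j) * information i j) = (\<integral>x. deriv g (\<theta>\<^sub>0 \<bullet> Zf x) * (h \<bullet> Zf x)\<^sup>2 \<partial>I.P)"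
  and information_form_integrable: "integrable I.P (\<lambda>x. deriv g (\<theta>\<^sub>0 \<bullet> Zf x) * (h \<bullet> Zf x)\<^sup>2)" for h :: "real ^ 'd"
proof -
  have e: "deriv g (\<theta>\<^sub>0 \<bullet> Zf x) * (h \<bullet> Zf x)\<^sup>2 =
    (\<Sum>i\<in>UNIV. \<Sum>j\<in>UNIV. (h $ i * h $ j) * (deriv g (\<theta>\<^sub>0 \<bullet> Zf x) * (Zf x $ i * Zf x $ j)))" for x
    by (simp add: inner_square_vec sum_distrib_left mult_ac)
  show "integrable I.P (\<lambda>x. deriv g (\<theta>\<^sub>0 \<bullet> Zf x) * (h \<bullet> Zf x)\<^sup>2)"
    unfolding e by (intro Bochner_Integration.integrable_sum integrable_mult_right information_integrable)
  show "(\<Sum>i\<in>UNIV. \<Sum>j\<in>UNIV. (h $ i * h $ j) * information i j) = (\<integral>x. deriv g (\<theta>\<^sub>0 \<bullet> Zf x) * (h \<bullet> Zf x)\<^sup>2 \<partial>I.P)"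
    unfolding e information_def by (simp add: information_integrable)
qed

text \<open>A vanishing quadratic form forces \<open>h \<bullet> Zf x = 0\<close> almost surely
  because \<open>g'\<close> is positive; transported back to the original space this is excluded by
  identifiability.\<close>

lemma information_positive:
  fixes h :: "real ^ 'd"
  assumes "h \<noteq> 0" shows "(\<Sum>i\<in>UNIV. \<Sum>j\<in>UNIV. (h $ i * h $ j) * information i j) > 0"
proof (rule ccontr)
  assume "\<not> ?thesis"
  moreover have nn: "0 \<le> deriv g (\<theta>\<^sub>0 \<bullet> Zf x) * (h \<bullet> Zf x)\<^sup>2" for x using g'_pos by (simp add: less_imp_le)
  then have "(\<integral>x. deriv g (\<theta>\<^sub>0 \<bullet> Zf x) * (h \<bullet> Zf x)\<^sup>2 \<partial>I.P) \<ge> 0" by (intro Bochner_Integration.integral_nonneg)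
  ultimately have "(\<integral>x. deriv g (\<theta>\<^sub>0 \<bullet> Zf x) * (h \<bullet> Zf x)\<^sup>2 \<partial>I.P) = 0" unfolding information_form by linarith
  then have "AE x in I.P. deriv g (\<theta>\<^sub>0 \<bullet> Zf x) * (h \<bullet> Zf x)\<^sup>2 = 0"
    using integral_nonneg_eq_0_iff_AE[OF information_form_integrable[of h]] nn by simp
  then have "AE x in I.P. h \<bullet> Zf x = 0"
    by eventually_elim (use g'_pos in \<open>simp add: less_imp_neq[symmetric]\<close>)
  then have "AE x in distr M I.P (history 0). h \<bullet> Zf x = 0" by (simp only: distr_history)
  then have "AE w in M. h \<bullet> Zf (history 0 w) = 0" by (rule AE_distrD[OF measurable_history])
  with Z_history[of 0] have "AE w in M. h \<bullet> Z 0 w = 0" by eventually_elim simp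
  then have "prob {w \<in> space M. h \<bullet> Z 0 w = 0} = 1" by (intro prob_Collect_eq_1[THEN iffD2]) measurable
  then have "h = 0" by (rule identifiable)
  with assms show False by simp
qed

text \<open>Compactness of the unit sphere and homogeneity of degree two turn pointwise positivity
  into a uniform constant.\<close>

lemma information_coercive:
  "\<exists>c>0. \<forall>h :: real ^ 'd. c * (norm h)\<^sup>2 \<le> (\<Sum>i\<in>UNIV. \<Sum>j\<in>UNIV. (h $ i * h $ j) * information i j)"
proof -
  define Q where "Q h = (\<Sum>i\<in>UNIV. \<Sum>j\<in>UNIV. (h $ i * h $ j) * information i j)" for h :: "real ^ 'd"
  have ne: "sphere 0 1 \<noteq> ({} :: (real ^ 'd) set)"
    using norm_axis_1 by (metis dist_0_norm emptyE mem_sphere)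
  have "continuous_on (sphere 0 1) Q" unfolding Q_def by (intro continuous_intros)
  then obtain h0 where h0: "h0 \<in> sphere 0 1" "\<And>h. h \<in> sphere 0 1 \<Longrightarrow> Q h0 \<le> Q h"
    using continuous_attains_inf[OF compact_sphere ne] by blast
  have "Q h0 > 0" unfolding Q_def using h0(1) by (intro information_positive) auto
  moreover have "Q h0 * (norm h)\<^sup>2 \<le> Q h" for h
  proof (cases "h = 0")
    case False
    have 1: "Q h = Q ((1 / norm h) *\<^sub>R h) * (norm h)\<^sup>2"
      unfolding Q_def sum_distrib_right using False by (intro sum.cong refl) (simp add: power2_eq_square)
    have 2: "Q h0 \<le> Q ((1 / norm h) *\<^sub>R h)" using False by (intro h0(2)) simp
    show ?thesis unfolding 1 by (rule mult_right_mono[OF 2]) simp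
  qed (simp add: Q_def)
  ultimately show ?thesis unfolding Q_def by blast
qed

text \<open>Controlling the finitely many matrix entries makes the exceptional event independent of
  \<open>h\<close>, so coercivity holds in all directions at once.\<close>

lemma empirical_information:
  obtains c E K where "c > 0" "\<And>n. E n \<in> events" "\<And>n. n > 0 \<Longrightarrow> prob (E n) \<le> K / real n"
    "\<And>n w h. w \<in> space M - E n \<Longrightarrow> c * (norm h)\<^sup>2 \<le>
        (\<Sum>t=1..n. deriv g (\<theta>\<^sub>0 \<bullet> Z (int t - 1) w) * (h \<bullet> Z (int t - 1) w)\<^sup>2) / real n"
proof -
  obtain c where c: "c > 0" "\<And>h :: real ^ 'd. c * (norm h)\<^sup>2 \<le> (\<Sum>i\<in>UNIV. \<Sum>j\<in>UNIV. (h $ i * h $ j) * information i j)"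
    using information_coercive by auto
  define d where "d = real CARD('d)"
  have d: "d > 0" unfolding d_def by simp
  \<comment> \<open>With \<open>d * d\<close> entries, each off by at most \<eta>, the quadratic
    form loses at most half of \<open>c\<close>.\<close>
  define \<eta> where "\<eta> = c / (2 * d\<^sup>2)"
  have \<eta>: "\<eta> > 0" unfolding \<eta>_def using c(1) d by simp
  define a where "a n i j w = (\<Sum>t=1..n. deriv g (\<theta>\<^sub>0 \<bullet> Z (int t - 1) w) * (Z (int t - 1) w $ i * Z (int t - 1) w $ j)) / real n" for n i j w
  define E where "E n = (\<Union>i\<in>UNIV. \<Union>j\<in>UNIV. {w \<in> space M. \<eta> \<le> \<bar>a n i j w - information i j\<bar>})" for n
  have em: "{w \<in> space M. \<eta> \<le> \<bar>a n i j w - information i j\<bar>} \<in> events" for n i j unfolding a_def by measurable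
  have "\<forall>i j. \<exists>K. \<forall>n>0. prob {w \<in> space M. \<eta> \<le> \<bar>a n i j w - information i j\<bar>} \<le> K / real n"
    unfolding a_def information_def
    by (intro allI weak_law_Z(2)[OF information_component_measurable information_component_lipschitz \<eta>])
  then obtain K where K: "\<And>i j n. n > 0 \<Longrightarrow> prob {w \<in> space M. \<eta> \<le> \<bar>a n i j w - information i j\<bar>} \<le> K i j / real n"
    by metis
  have "prob (E n) \<le> (\<Sum>i\<in>UNIV. \<Sum>j\<in>UNIV. K i j) / real n" if "n > 0" for n
  proof -
    have "prob (E n) \<le> (\<Sum>i\<in>UNIV. prob (\<Union>j\<in>UNIV. {w \<in> space M. \<eta> \<le> \<bar>a n i j w - information i j\<bar>}))"
      unfolding E_def using em by (intro finite_measure_subadditive_finite) auto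
    also have "\<dots> \<le> (\<Sum>i\<in>UNIV. \<Sum>j\<in>UNIV. prob {w \<in> space M. \<eta> \<le> \<bar>a n i j w - information i j\<bar>})"
      using em by (intro sum_mono finite_measure_subadditive_finite) auto
    also have "\<dots> \<le> (\<Sum>i\<in>UNIV. \<Sum>j\<in>UNIV. K i j / real n)" by (intro sum_mono K that)
    finally show ?thesis by (simp add: sum_divide_distrib)
  qed
  moreover have "E n \<in> events" for n unfolding E_def using em by (intro sets.finite_UN) auto
  moreover have "c / 2 * (norm h)\<^sup>2 \<le> (\<Sum>t=1..n. deriv g (\<theta>\<^sub>0 \<bullet> Z (int t - 1) w) * (h \<bullet> Z (int t - 1) w)\<^sup>2) / real n"
    if w: "w \<in> space M - E n" for n w h
  proof -
    have close: "\<bar>a n i j w - information i j\<bar> \<le> \<eta>" for i j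
      using w unfolding E_def by (auto simp: not_le less_imp_le)
    have "(\<Sum>t=1..n. deriv g (\<theta>\<^sub>0 \<bullet> Z (int t - 1) w) * (h \<bullet> Z (int t - 1) w)\<^sup>2) / real n =
       (\<Sum>i\<in>UNIV. \<Sum>j\<in>UNIV. (h $ i * h $ j) * a n i j w)"
    proof -
      have "(\<Sum>t=1..n. deriv g (\<theta>\<^sub>0 \<bullet> Z (int t - 1) w) * (h \<bullet> Z (int t - 1) w)\<^sup>2) =
        (\<Sum>t=1..n. \<Sum>i\<in>UNIV. \<Sum>j\<in>UNIV. (h $ i * h $ j) * (deriv g (\<theta>\<^sub>0 \<bullet> Z (int t - 1) w) * (Z (int t - 1) w $ i * Z (int t - 1) w $ j)))"
        by (simp add: inner_square_vec sum_distrib_left mult_ac)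
      also have "\<dots> = (\<Sum>i\<in>UNIV. \<Sum>j\<in>UNIV. \<Sum>t=1..n. (h $ i * h $ j) * (deriv g (\<theta>\<^sub>0 \<bullet> Z (int t - 1) w) * (Z (int t - 1) w $ i * Z (int t - 1) w $ j)))"
        by (subst sum.swap, intro sum.cong refl, rule sum.swap)
      finally show ?thesis by (simp add: a_def sum_distrib_left sum_divide_distrib)
    qed
    moreover have "(\<Sum>i\<in>UNIV. \<Sum>j\<in>UNIV. (h $ i * h $ j) * information i j) - (\<Sum>i\<in>UNIV. \<Sum>j\<in>UNIV. (h $ i * h $ j) * a n i j w)
       \<le> (\<Sum>i\<in>(UNIV :: 'd set). \<Sum>j\<in>(UNIV :: 'd set). (norm h)\<^sup>2 * \<eta>)"
      unfolding sum_subtractf[symmetric]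
    proof (intro sum_mono)
      fix i j
      have "(h $ i * h $ j) * information i j - (h $ i * h $ j) * a n i j w \<le> \<bar>(h $ i * h $ j) * (information i j - a n i j w)\<bar>"
        by (simp add: right_diff_distrib)
      also have "\<dots> = (\<bar>h $ i\<bar> * \<bar>h $ j\<bar>) * \<bar>a n i j w - information i j\<bar>" by (simp add: abs_mult abs_minus_commute)
      also have "\<dots> \<le> (norm h * norm h) * \<eta>" using close by (intro mult_mono component_le_norm_cart) auto
      finally show "(h $ i * h $ j) * information i j - (h $ i * h $ j) * a n i j w \<le> (norm h)\<^sup>2 * \<eta>"
        by (simp add: power2_eq_square)
    qed
    moreover have "(\<Sum>i\<in>(UNIV :: 'd set). \<Sum>j\<in>(UNIV :: 'd set). (norm h)\<^sup>2 * \<eta>) = c / 2 * (norm h)\<^sup>2"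
    proof -
      have "(\<Sum>i\<in>(UNIV :: 'd set). \<Sum>j\<in>(UNIV :: 'd set). (norm h)\<^sup>2 * \<eta>) = d * (d * ((norm h)\<^sup>2 * \<eta>))" by (simp add: d_def)
      also have "\<dots> = c / 2 * (norm h)\<^sup>2" unfolding \<eta>_def using d by (simp add: power2_eq_square)
      finally show ?thesis .
    qed
    ultimately show ?thesis using c(2)[of h] by linarith
  qed
  moreover have "c / 2 > 0" using c(1) by simp
  ultimately show ?thesis by (intro that[of "c / 2" E "\<Sum>i\<in>UNIV. \<Sum>j\<in>UNIV. K i j"])
qed

section \<open>The deterministic argument on a good sample\<close>

lemma link_taylor: "(g u - g v) * (u - v) \<ge> deriv g v * (u - v)\<^sup>2 - C' * \<bar>u - v\<bar> ^ 3"
proof -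
  \<comment> \<open>Mean value theorem, stated so as to cover both orders of \<open>u\<close> and
    \<open>v\<close>; replacing the derivative at \<xi> by that at \<open>v\<close> costs the cubic
    remainder.\<close>
  have "\<exists>\<xi>. \<bar>\<xi> - v\<bar> \<le> \<bar>u - v\<bar> \<and> g u - g v = (u - v) * deriv g \<xi>"
  proof -
    consider "u = v" | "v < u" | "u < v" by linarith
    then show ?thesis
    proof cases
      case 2
      then obtain \<xi> where "v < \<xi>" "\<xi> < u" "g u - g v = (u - v) * deriv g \<xi>"
        using MVT2[OF 2 g_deriv] by auto
      then show ?thesis by (intro exI[of _ \<xi>]) auto
    next
      case 3
      then obtain \<xi> where "u < \<xi>" "\<xi> < v" "g v - g u = (v - u) * deriv g \<xi>"
        using MVT2[OF 3 g_deriv] by auto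
      then have "\<bar>\<xi> - v\<bar> \<le> \<bar>u - v\<bar>" "g u - g v = (u - v) * deriv g \<xi>"
        by (simp_all add: left_diff_distrib)
      then show ?thesis by blast
    qed auto
  qed
  then obtain \<xi> where \<xi>: "\<bar>\<xi> - v\<bar> \<le> \<bar>u - v\<bar>" "g u - g v = (u - v) * deriv g \<xi>" by auto
  have "deriv g v - deriv g \<xi> \<le> C' * \<bar>\<xi> - v\<bar>" using g'_lip[of v \<xi>] by (simp add: abs_minus_commute)
  also have "\<dots> \<le> C' * \<bar>u - v\<bar>" using C' \<xi>(1) by (intro mult_left_mono) auto
  finally have "(deriv g v - C' * \<bar>u - v\<bar>) * (u - v)\<^sup>2 \<le> deriv g \<xi> * (u - v)\<^sup>2"
    by (intro mult_right_mono) auto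
  moreover have "\<bar>u - v\<bar> ^ 3 = \<bar>u - v\<bar> * (u - v)\<^sup>2"
  proof -
    have "\<bar>u - v\<bar> ^ 3 = \<bar>u - v\<bar> * \<bar>u - v\<bar>\<^sup>2" by (simp only: power3_eq_cube power2_eq_square mult.assoc)
    then show ?thesis by (simp only: power2_abs)
  qed
  moreover have "(g u - g v) * (u - v) = deriv g \<xi> * (u - v)\<^sup>2"
    unfolding \<xi>(2) by (simp only: power2_eq_square mult_ac)
  ultimately show ?thesis by (simp only: left_diff_distrib mult.assoc)
qed

lemma g_strict_mono: "u < v \<Longrightarrow> g u < g v"
  by (rule DERIV_pos_imp_increasing, assumption, intro exI conjI, rule g_deriv, rule g'_pos)

lemma estimating_function_continuous:
  "continuous_on UNIV (\<lambda>\<theta>. score n \<theta> w)"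
proof -
  have cg: "continuous_on UNIV g"
    by (intro continuous_at_imp_continuous_on ballI differentiable_imp_continuous_within g_diff)
  have "continuous_on UNIV (\<lambda>\<theta>. g (\<theta> \<bullet> z))" for z :: "real ^ 'd"
    by (rule continuous_on_compose2[OF cg continuous_on_inner[OF continuous_on_id continuous_on_const]]) simp
  then show ?thesis
    unfolding estimating_function_def linear_predictor_def
    by (intro continuous_on_scaleR continuous_on_sum continuous_on_diff continuous_on_const)
qed

text \<open>The radius \<open>2 * \<beta> / c\<close> balances both sides on the sphere: the
  quadratic term is at least \<open>c * r\<^sup>2\<close>, the smallness condition lets the cubic
  remainder use at most half of it, and the score contributes at most \<open>\<beta> * r\<close>,
  which equals the other half. Monotonicity is global since \<open>g\<close> is increasing, so no
  zero can exist outside the ball either.\<close>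

lemma good_sample:
  assumes n: "n > 0" and c: "c > 0" and \<beta>: "\<beta> > 0"
    and H: "\<And>h. c * (norm h)\<^sup>2 \<le> (\<Sum>t=1..n. deriv g (\<theta>\<^sub>0 \<bullet> Z (int t - 1) w) * (h \<bullet> Z (int t - 1) w)\<^sup>2) / real n"
    and third: "(\<Sum>t=1..n. norm (Z (int t - 1) w) ^ 3) / real n \<le> v"
    and score: "norm (score n \<theta>\<^sub>0 w) \<le> \<beta>"
    and small: "C' * v * (2 * \<beta> / c) \<le> c / 2"
  shows "(\<exists>!\<theta>. score n \<theta> w = 0) \<and>
    (\<forall>\<theta>. score n \<theta> w = 0 \<longrightarrow> norm (\<theta> - \<theta>\<^sub>0) \<le> 2 * \<beta> / c)"
proof -
  define z where "z t = Z (int t - 1) w" for t :: nat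
  define y where "y t = Y (int t) w" for t :: nat
  define S where "S \<theta> = score n \<theta> w" for \<theta>
  have S: "S \<theta> = (1 / real n) *\<^sub>R (\<Sum>t=1..n. (y t - g (\<theta> \<bullet> z t)) *\<^sub>R z t)" for \<theta>
    by (simp add: S_def estimating_function_def linear_predictor_def z_def y_def)
  have diff: "(S \<theta> - S \<theta>') \<bullet> (\<theta> - \<theta>') = - ((\<Sum>t=1..n. (g (\<theta> \<bullet> z t) - g (\<theta>' \<bullet> z t)) * (\<theta> \<bullet> z t - \<theta>' \<bullet> z t)) / real n)" for \<theta> \<theta>'
  proof -
    have "S \<theta> - S \<theta>' = (1 / real n) *\<^sub>R (\<Sum>t=1..n. (g (\<theta>' \<bullet> z t) - g (\<theta> \<bullet> z t)) *\<^sub>R z t)"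
      unfolding S by (simp add: scaleR_right_diff_distrib[symmetric] sum_subtractf[symmetric] scaleR_left_diff_distrib[symmetric])
    then have "(S \<theta> - S \<theta>') \<bullet> (\<theta> - \<theta>') = (\<Sum>t=1..n. (g (\<theta>' \<bullet> z t) - g (\<theta> \<bullet> z t)) * (z t \<bullet> (\<theta> - \<theta>'))) / real n"
      by (simp add: inner_sum_left)
    also have "\<dots> = (\<Sum>t=1..n. - ((g (\<theta> \<bullet> z t) - g (\<theta>' \<bullet> z t)) * (\<theta> \<bullet> z t - \<theta>' \<bullet> z t))) / real n"
    proof (intro arg_cong[of _ _ "\<lambda>s. s / real n"] sum.cong refl)
      fix t
      have "z t \<bullet> (\<theta> - \<theta>') = \<theta> \<bullet> z t - \<theta>' \<bullet> z t" by (simp add: inner_diff_right inner_commute)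
      then show "(g (\<theta>' \<bullet> z t) - g (\<theta> \<bullet> z t)) * (z t \<bullet> (\<theta> - \<theta>')) = - ((g (\<theta> \<bullet> z t) - g (\<theta>' \<bullet> z t)) * (\<theta> \<bullet> z t - \<theta>' \<bullet> z t))"
        by (simp only: minus_mult_left minus_diff_eq)
    qed
    finally show ?thesis by (simp add: sum_negf)
  qed
  have mono: "(g u - g u') * (u - u') > 0" if "u \<noteq> u'" for u u'
    using g_strict_mono[of u u'] g_strict_mono[of u' u] that 
    by (cases u u' rule: linorder_cases) (simp_all add: mult_neg_neg)
  have mono0: "(g u - g u') * (u - u') \<ge> 0" for u u' using mono[of u u'] by (cases "u = u'") (simp_all add: less_imp_le)
  define r where "r = 2 * \<beta> / c"
  have r: "r > 0" and \<beta>r: "\<beta> = c / 2 * r" using \<beta> c by (simp_all add: r_def)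
  have small': "C' * v * r \<le> c / 2" using small by (simp only: r_def)
  have "(\<exists>!\<theta>. S \<theta> = 0) \<and> (\<forall>\<theta>. S \<theta> = 0 \<longrightarrow> norm (\<theta> - \<theta>\<^sub>0) \<le> r)"
  proof (rule unique_zero_of_strictly_monotone[OF _ r])
    show "continuous_on UNIV S" unfolding S_def[abs_def] by (rule estimating_function_continuous)
  next
    fix \<theta> \<theta>' :: "real ^ 'd" assume ne: "\<theta> \<noteq> \<theta>'"
    \<comment> \<open>Coercivity at \<open>\<theta>\<^sub>0\<close> means that the regressors span
      the whole space, so two different parameters differ in some linear predictor. This gives
      strict monotonicity at all parameters, not only near \<open>\<theta>\<^sub>0\<close>.\<close>
    have "\<exists>t\<in>{1..n}. \<theta> \<bullet> z t \<noteq> \<theta>' \<bullet> z t"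
    proof (rule ccontr)
      assume "\<not> ?thesis"
      then have "(\<theta> - \<theta>') \<bullet> z t = 0" if "t \<in> {1..n}" for t using that by (simp add: inner_diff_left)
      then have "(\<Sum>t=1..n. deriv g (\<theta>\<^sub>0 \<bullet> Z (int t - 1) w) * ((\<theta> - \<theta>') \<bullet> Z (int t - 1) w)\<^sup>2) = 0"
        unfolding z_def[symmetric] by simp
      then have "c * (norm (\<theta> - \<theta>'))\<^sup>2 \<le> 0" using H[of "\<theta> - \<theta>'"] by simp
      moreover have "c * (norm (\<theta> - \<theta>'))\<^sup>2 > 0" using c ne by simp
      ultimately show False by linarith
    qed
    then obtain t where t: "t \<in> {1..n}" "\<theta> \<bullet> z t \<noteq> \<theta>' \<bullet> z t" by auto
    have "(\<Sum>t=1..n. (g (\<theta> \<bullet> z t) - g (\<theta>' \<bullet> z t)) * (\<theta> \<bullet> z t - \<theta>' \<bullet> z t)) > 0"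
      using t mono mono0 by (intro sum_pos2[of _ t]) auto
    then show "(S \<theta> - S \<theta>') \<bullet> (\<theta> - \<theta>') < 0" unfolding diff using n by simp
  next
    fix \<theta> :: "real ^ 'd" assume nr: "norm (\<theta> - \<theta>\<^sub>0) = r"
    define h where "h = \<theta> - \<theta>\<^sub>0"
    define T where "T = (\<Sum>t=1..n. (g (\<theta> \<bullet> z t) - g (\<theta>\<^sub>0 \<bullet> z t)) * (\<theta> \<bullet> z t - \<theta>\<^sub>0 \<bullet> z t))"
    define I where "I = (\<Sum>t=1..n. deriv g (\<theta>\<^sub>0 \<bullet> z t) * (h \<bullet> z t)\<^sup>2)"
    define N where "N = (\<Sum>t=1..n. norm (z t) ^ 3)"
    have nh: "norm h = r" using nr by (simp only: h_def)
    have "I - C' * r ^ 3 * N = (\<Sum>t=1..n. deriv g (\<theta>\<^sub>0 \<bullet> z t) * (h \<bullet> z t)\<^sup>2 - C' * r ^ 3 * norm (z t) ^ 3)"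
      unfolding I_def N_def by (simp only: sum_subtractf sum_distrib_left)
    also have "\<dots> \<le> T"
      unfolding T_def
    proof (rule sum_mono)
      fix t
      have "\<bar>h \<bullet> z t\<bar> ^ 3 \<le> (r * norm (z t)) ^ 3"
        using Cauchy_Schwarz_ineq2[of h "z t"] unfolding nh by (intro power_mono) auto
      then have "C' * \<bar>h \<bullet> z t\<bar> ^ 3 \<le> C' * (r ^ 3 * norm (z t) ^ 3)"
        using C' unfolding power_mult_distrib by (intro mult_left_mono) auto
      then show "deriv g (\<theta>\<^sub>0 \<bullet> z t) * (h \<bullet> z t)\<^sup>2 - C' * r ^ 3 * norm (z t) ^ 3
          \<le> (g (\<theta> \<bullet> z t) - g (\<theta>\<^sub>0 \<bullet> z t)) * (\<theta> \<bullet> z t - \<theta>\<^sub>0 \<bullet> z t)"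
        using link_taylor[of "\<theta>\<^sub>0 \<bullet> z t" "\<theta> \<bullet> z t"] unfolding h_def inner_diff_left mult.assoc by linarith
    qed
    finally have "(I - C' * r ^ 3 * N) / real n \<le> T / real n" by (rule divide_right_mono) simp
    then have "I / real n - C' * r ^ 3 * (N / real n) \<le> T / real n" by (simp only: diff_divide_distrib times_divide_eq_right)
    moreover have "C' * r ^ 3 * (N / real n) \<le> C' * r ^ 3 * v"
      using third C' r unfolding N_def z_def by (intro mult_left_mono) auto
    moreover have "C' * r ^ 3 * v \<le> c / 2 * r\<^sup>2"
    proof -
      have "C' * r ^ 3 * v = (C' * v * r) * r\<^sup>2" by (simp only: power2_eq_square power3_eq_cube mult_ac)
      also have "\<dots> \<le> c / 2 * r\<^sup>2" by (intro mult_right_mono small') simp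
      finally show ?thesis .
    qed
    moreover have "c * r\<^sup>2 \<le> I / real n"
      using H[of h] unfolding nh I_def z_def .
    ultimately have T: "c / 2 * r\<^sup>2 \<le> T / real n" by linarith
    have "S \<theta>\<^sub>0 \<bullet> h \<le> norm (S \<theta>\<^sub>0) * norm h" by (rule norm_cauchy_schwarz)
    also have "\<dots> \<le> \<beta> * r" unfolding nh using score r unfolding S_def by (intro mult_right_mono) auto
    also have "\<dots> = c / 2 * r\<^sup>2" unfolding \<beta>r by (simp only: power2_eq_square mult.assoc)
    finally have "S \<theta>\<^sub>0 \<bullet> h \<le> c / 2 * r\<^sup>2" .
    moreover have "(S \<theta> - S \<theta>\<^sub>0) \<bullet> h = - (T / real n)" unfolding h_def T_def by (rule diff)
    moreover have "S \<theta> \<bullet> h = S \<theta>\<^sub>0 \<bullet> h + (S \<theta> - S \<theta>\<^sub>0) \<bullet> h" by (simp add: inner_diff_left)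
    ultimately have "S \<theta> \<bullet> h \<le> 0" using T by linarith
    then show "S \<theta> \<bullet> (\<theta> - \<theta>\<^sub>0) \<le> 0" by (simp only: h_def)
  qed
  then show ?thesis unfolding S_def r_def .
qed

definition success :: "real \<Rightarrow> nat \<Rightarrow> 'w set" where
  "success a n = {w \<in> space M. (\<exists>!\<theta>. score n \<theta> w = 0) \<and>
     (\<forall>\<theta>. score n \<theta> w = 0 \<longrightarrow> norm (\<theta> - \<theta>\<^sub>0) \<le> a * sqrt (ln (real n) / real n))}"

lemma success_event: "success a n \<in> events"
  unfolding success_def
proof (rule unique_zero_event_measurable)
  show "continuous_on UNIV (\<lambda>\<theta>. score n \<theta> w)" for w
    by (rule estimating_function_continuous)
  show "(\<lambda>w. score n \<theta> w) \<in> borel_measurable M" for \<theta>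
    unfolding estimating_function_def linear_predictor_def by measurable
qed

end

context glm_model
begin

section \<open>Failure probability and final rate\<close>

lemma failure_probability:
  obtains a K where "a > 0"
    "\<forall>\<^sub>F n in sequentially. prob (space M - success a n) \<le> K * (1 + (ln (real n))\<^sup>2) / real n"
proof -
  obtain c E K1 where c: "c > 0" and E: "\<And>n. E n \<in> events" "\<And>n. n > 0 \<Longrightarrow> prob (E n) \<le> K1 / real n"
    and H: "\<And>n w h. w \<in> space M - E n \<Longrightarrow> c * (norm h)\<^sup>2 \<le>
        (\<Sum>t=1..n. deriv g (\<theta>\<^sub>0 \<bullet> Z (int t - 1) w) * (h \<bullet> Z (int t - 1) w)\<^sup>2) / real n"
    by (rule empirical_information) blast
  obtain K2 where K2: "\<And>n. n > 0 \<Longrightarrow> prob (badZ n) \<le> K2 / real n" using prob_badZ by blast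
  obtain K3 where K3: "\<And>n. n > 0 \<Longrightarrow> prob (badY n) \<le> K3 / real n" using prob_badY by blast
  define b where "b = real CARD('d) * B"
  have b: "b > 0" unfolding b_def using B_ge by simp
  \<comment> \<open>Empirical third moments are bounded by \<open>1\<close> plus fourth moments, and
    off \<open>badZ n\<close> these are at most \<open>mZ + 1\<close>.\<close>
  define v where "v = 2 + mZ"
  define \<tau> where "\<tau> n = sqrt (ln (real n) / real n)" for n
  define K4 where "K4 = 1 + 12 * \<kappa>\<^sup>2 * (1 + m8)"
  define Bad where "Bad n = E n \<union> badZ n \<union> badY n \<union> (\<Union>i\<in>UNIV. badS 1 i n) \<union> (\<Union>i\<in>UNIV. badS (-1) i n)" for n
  define K where "K = \<bar>K1\<bar> + \<bar>K2\<bar> + \<bar>K3\<bar> + 2 * real CARD('d) * K4"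
  \<comment> \<open>The radius shrinks to zero, so the smallness condition on the cubic remainder
    holds for all large \<open>n\<close>; this is why the bound is only eventual.\<close>
  have "\<tau> \<longlonglongrightarrow> sqrt 0" unfolding \<tau>_def by (intro tendsto_real_sqrt lim_ln_over_n)
  then have "(\<lambda>n. C' * v * (2 * (b * \<tau> n) / c)) \<longlonglongrightarrow> C' * v * (2 * (b * sqrt 0) / c)"
    using c by (intro tendsto_mult tendsto_divide tendsto_const) simp_all
  then have "\<forall>\<^sub>F n in sequentially. C' * v * (2 * (b * \<tau> n) / c) < c / 2"
    by (rule order_tendstoD(2)) (use c in simp)
  then have "\<forall>\<^sub>F n in sequentially. prob (space M - success (2 * b / c) n) \<le> K * (1 + (ln (real n))\<^sup>2) / real n"
    using eventually_ge_at_top[of 3]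
  proof eventually_elim
    case (elim n)
    have n0: "n > 0" using elim(2) by simp
    have \<tau>: "\<tau> n > 0" unfolding \<tau>_def using elim(2) by simp
    let ?G = "success (2 * b / c) n"
    have "space M - ?G \<subseteq> Bad n"
    proof
      fix w assume w: "w \<in> space M - ?G"
      show "w \<in> Bad n"
      proof (rule ccontr)
        assume "w \<notin> Bad n"
        then have nb: "w \<notin> E n" "w \<notin> badZ n" "w \<notin> badY n" "w \<notin> badS 1 i n" "w \<notin> badS (-1) i n" for i
          by (simp_all add: Bad_def)
        have wM: "w \<in> space M" using w by simp
        have third: "(\<Sum>t=1..n. norm (Z (int t - 1) w) ^ 3) / real n \<le> v"
        proof -
          have "(\<Sum>t=1..n. norm (Z (int t - 1) w) ^ 3) \<le> (\<Sum>t=1..n. 1 + norm (Z (int t - 1) w) ^ 4)"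
            by (intro sum_mono power_le_one_plus_power) simp_all
          also have "\<dots> = real n + (\<Sum>t=1..n. norm (Z (int t - 1) w) ^ 4)" by (simp add: sum.distrib)
          finally have "(\<Sum>t=1..n. norm (Z (int t - 1) w) ^ 3) / real n \<le> 1 + (\<Sum>t=1..n. norm (Z (int t - 1) w) ^ 4) / real n"
            using n0 by (simp add: field_simps)
          also have "(\<Sum>t=1..n. norm (Z (int t - 1) w) ^ 4) / real n \<le> mZ + 1"
            using nb(2) wM unfolding badZ_def by simp
          finally show ?thesis by (simp add: v_def)
        qed
        have score: "norm (score n \<theta>\<^sub>0 w) \<le> b * \<tau> n"
          unfolding b_def \<tau>_def by (rule score_bound[OF elim(2) wM nb(2,3,4,5)])
        have "b * \<tau> n > 0" using b \<tau> by simp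
        moreover have "w \<in> space M - E n" using nb(1) wM by simp
        moreover note third score less_imp_le[OF elim(1)]
        ultimately have "(\<exists>!\<theta>. score n \<theta> w = 0) \<and>
            (\<forall>\<theta>. score n \<theta> w = 0 \<longrightarrow> norm (\<theta> - \<theta>\<^sub>0) \<le> 2 * (b * \<tau> n) / c)"
          by (intro good_sample[OF n0 c _ H])
        moreover have e: "2 * (b * \<tau> n) / c = (2 * b / c) * \<tau> n" by simp
        ultimately have "w \<in> ?G" unfolding e unfolding \<tau>_def success_def by (intro CollectI conjI[OF wM])
        with w show False by (simp only: Diff_iff simp_thms)
      qed
    qed
    moreover have Bm: "Bad n \<in> events" unfolding Bad_def by (intro sets.Un sets.finite_UN E(1) bad_events finite)
    ultimately have "prob (space M - ?G) \<le> prob (Bad n)" by (rule finite_measure_mono)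
    also have "\<dots> \<le> prob (E n) + prob (badZ n) + prob (badY n) + prob (\<Union>i\<in>UNIV. badS 1 i n) + prob (\<Union>i\<in>UNIV. badS (-1) i n)"
    proof -
      have U: "(\<Union>i\<in>UNIV. badS \<sigma> i n) \<in> events" for \<sigma> by (intro sets.finite_UN bad_events finite)
      have un: "prob (A1 \<union> A2 \<union> A3 \<union> A4 \<union> A5) \<le> prob A1 + prob A2 + prob A3 + prob A4 + prob A5"
        if "A1 \<in> events" "A2 \<in> events" "A3 \<in> events" "A4 \<in> events" "A5 \<in> events" for A1 A2 A3 A4 A5
        using measure_Un_le[of "A1 \<union> A2 \<union> A3 \<union> A4" M A5] measure_Un_le[of "A1 \<union> A2 \<union> A3" M A4]
          measure_Un_le[of "A1 \<union> A2" M A3] measure_Un_le[of A1 M A2] sets.Un[OF that(1,2)] sets.Un[OF sets.Un[OF that(1,2)] that(3)]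
          sets.Un[OF sets.Un[OF sets.Un[OF that(1,2)] that(3)] that(4)] that by linarith
      show ?thesis unfolding Bad_def by (rule un[OF E(1) bad_events(1,2) U U])
    qed
    also have "\<dots> \<le> K1 / real n + K2 / real n + K3 / real n + (\<Sum>i\<in>UNIV. prob (badS 1 i n)) + (\<Sum>i\<in>UNIV. prob (badS (-1) i n))"
      by (intro add_mono E(2) K2 K3 n0 finite_measure_subadditive_finite finite image_subsetI bad_events)
    also have "\<dots> \<le> K1 / real n + K2 / real n + K3 / real n + (\<Sum>i\<in>(UNIV::'d set). K4 * (1 + (ln (real n))\<^sup>2) / real n) + (\<Sum>i\<in>(UNIV::'d set). K4 * (1 + (ln (real n))\<^sup>2) / real n)"
      unfolding K4_def by (intro add_mono sum_mono prob_badS order_refl elim(2)) simp_all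
    also have "\<dots> = (K1 + K2 + K3 + 2 * real CARD('d) * K4 * (1 + (ln (real n))\<^sup>2)) / real n"
      by (simp add: add_divide_distrib)
    also have "\<dots> \<le> K * (1 + (ln (real n))\<^sup>2) / real n"
    proof (intro divide_right_mono)
      have "K1 + K2 + K3 \<le> (\<bar>K1\<bar> + \<bar>K2\<bar> + \<bar>K3\<bar>) * 1" by simp
      also have "\<dots> \<le> (\<bar>K1\<bar> + \<bar>K2\<bar> + \<bar>K3\<bar>) * (1 + (ln (real n))\<^sup>2)" by (intro mult_left_mono) auto
      moreover have "K * (1 + (ln (real n))\<^sup>2) = (\<bar>K1\<bar> + \<bar>K2\<bar> + \<bar>K3\<bar>) * (1 + (ln (real n))\<^sup>2) + 2 * real CARD('d) * K4 * (1 + (ln (real n))\<^sup>2)"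
        unfolding K_def by (rule distrib_right)
      ultimately show "K1 + K2 + K3 + 2 * real CARD('d) * K4 * (1 + (ln (real n))\<^sup>2) \<le> K * (1 + (ln (real n))\<^sup>2)"
        by linarith
    qed simp
    finally show ?case .
  qed
  moreover have "2 * b / c > 0" using b c by simp
  ultimately show ?thesis by (intro that[of "2 * b / c" K])
qed

text \<open>The exponent \<open>1/8\<close> makes the squared logarithm at most
  \<open>64 * n powr (1/4)\<close>; the remaining 1 gives 65. Any decay strictly faster than
  \<open>n powr (-1/2)\<close> would serve.\<close>

lemma log_square_over_n_le:
  assumes "n > 0"
  shows "(1 + (ln (real n))\<^sup>2) / real n \<le> 65 * real n powr (- 3 / 4)"
proof -
  have n1: "real n \<ge> 1" using assms by simp
  have "ln (real n) \<le> real n powr (1 / 8) / (1 / 8)" by (rule ln_powr_bound[OF n1]) simp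
  then have "(ln (real n))\<^sup>2 \<le> (8 * real n powr (1 / 8))\<^sup>2" using n1 by (intro power_mono) auto
  also have "\<dots> = 64 * real n powr (1 / 4)"
    using n1 by (simp add: power_mult_distrib powr_power)
  finally have "1 + (ln (real n))\<^sup>2 \<le> 65 * real n powr (1 / 4)"
    using ge_one_powr_ge_zero[OF n1, of "1 / 4"] by simp
  then have "(1 + (ln (real n))\<^sup>2) / real n \<le> 65 * real n powr (1 / 4) / real n powr 1"
    using n1 by (simp add: divide_right_mono)
  also have "\<dots> = 65 * (real n powr (1 / 4) / real n powr 1)" by simp
  also have "real n powr (1 / 4) / real n powr 1 = real n powr (- 3 / 4)"
    by (simp only: powr_diff[symmetric]) simp
  finally show ?thesis .
qed

lemma consistency_rate:
  "\<exists>a>0. (\<lambda>n. 1 - prob {w \<in> space M.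
             (\<exists>!\<theta>. score n \<theta> w = 0) \<and>
             (\<forall>\<theta>. score n \<theta> w = 0 \<longrightarrow>
                  norm (\<theta> - \<theta>\<^sub>0) \<le> a * sqrt (ln (real n) / real n))})
           \<in> o(\<lambda>n. real n powr (- 1 / 2))"
proof -
  obtain a K where a: "a > 0" and K: "\<forall>\<^sub>F n in sequentially. prob (space M - success a n) \<le> K * (1 + (ln (real n))\<^sup>2) / real n"
    by (rule failure_probability)
  have "(\<lambda>n. 1 - prob (success a n)) \<in> O(\<lambda>n. real n powr (- 3 / 4))"
  proof (rule bigoI)
    show "\<forall>\<^sub>F n in sequentially. norm (1 - prob (success a n)) \<le> (\<bar>K\<bar> * 65) * norm (real n powr (- 3 / 4))"
      using K eventually_gt_at_top[of 0]
    proof eventually_elim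
      case (elim n)
      have "norm (1 - prob (success a n)) = prob (space M - success a n)"
        using prob_compl[OF success_event[of a n]] prob_le_1[of "success a n"] by simp
      also have "\<dots> \<le> K * ((1 + (ln (real n))\<^sup>2) / real n)" using elim(1) by simp
      also have "\<dots> \<le> \<bar>K\<bar> * ((1 + (ln (real n))\<^sup>2) / real n)" by (intro mult_right_mono) auto
      also have "\<dots> \<le> \<bar>K\<bar> * (65 * real n powr (- 3 / 4))"
        by (intro mult_left_mono log_square_over_n_le elim(2)) simp
      finally show ?case by simp
    qed
  qed
  moreover have "(\<lambda>n. real n powr (- 3 / 4)) \<in> o(\<lambda>n. real n powr (- 1 / 2))"
    by (subst powr_smallo_iff[OF filterlim_real_sequentially]) auto
  ultimately have "(\<lambda>n. 1 - prob (success a n)) \<in> o(\<lambda>n. real n powr (- 1 / 2))" by (rule landau_o.big_small_trans)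
  then show ?thesis using a unfolding success_def by blast
qed

end

theorem theorem1:
  fixes M :: "'w measure"
    and Y :: "int \<Rightarrow> 'w \<Rightarrow> real"
    and X :: "int \<Rightarrow> 'w \<Rightarrow> nat \<Rightarrow> real"
    and p k :: nat
    and pos :: "'d::finite \<Rightarrow> nat"
    and S :: "'e measure"
    and \<epsilon> :: "int \<Rightarrow> 'w \<Rightarrow> 'e"
    and f :: "(nat \<Rightarrow> 'e) \<Rightarrow> real \<times> (nat \<Rightarrow> real)"
    and g :: "real \<Rightarrow> real"
    and \<theta>\<^sub>0 :: "real ^ 'd"
    and q \<delta> \<rho> C C' :: real
  assumes "prob_space M"
    and "bij_betw pos UNIV {..<1 + p + k}"
    and "\<And>t. Y t \<in> measurable M borel"
    and "\<And>t. X t \<in> measurable M (covariate_space k)"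
    and "causal_representation M (observation_space k) (\<lambda>t w. (Y t w, X t w)) S \<epsilon> f"
    and "\<And>t. AE w in M.
           real_cond_exp M (past M (observation_space k) (\<lambda>t w. (Y t w, X t w)) (t - 1)) (Y t) w
             = g (linear_predictor p pos Y X t \<theta>\<^sub>0 w)"
    and "stationary_process M (observation_space k) (\<lambda>t w. (Y t w, X t w))"
    and "ergodic_process M (observation_space k) (\<lambda>t w. (Y t w, X t w))"
    and "q \<ge> 3" and "0 < \<delta>" and "\<delta> \<le> 2 * q" and "0 < \<rho>" and "\<rho> < 1"
    and "\<And>m. dep_tail M S \<epsilon> f fst dist Y m (q + \<delta>) \<le> ennreal (C * \<rho> ^ m)"
    and "\<And>m. dep_tail M S \<epsilon> f snd (covariate_dist k) X m (q + \<delta>) \<le> ennreal (C * \<rho> ^ m)"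
    and "integrable M (\<lambda>w. \<bar>Y 0 w\<bar> powr (2 * q * (q + \<delta>) / \<delta>))"
    and "integrable M (\<lambda>w. L2_set (X 0 w) {..<k} powr (2 * q * (q + \<delta>) / \<delta>))"
    and "\<And>u. g differentiable (at u)"
    and "continuous_on UNIV (deriv g)"
    and "C' > 0"
    and "\<And>u v. \<bar>g u - g v\<bar> \<le> C' * \<bar>u - v\<bar>"
    and "\<And>u v. \<bar>deriv g u - deriv g v\<bar> \<le> C' * \<bar>u - v\<bar>"
    and "\<And>u :: real ^ 'd.
           measure M {w \<in> space M. u \<bullet> regressor p pos Y X 0 w = 0} = 1 \<Longrightarrow> u = 0"
    and "\<And>u. deriv g u > 0"
  shows "\<exists>a>0. (\<lambda>n. 1 - measure M {w \<in> space M.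
             (\<exists>!\<theta>. estimating_function p pos Y X g n \<theta> w = 0) \<and>
             (\<forall>\<theta>. estimating_function p pos Y X g n \<theta> w = 0 \<longrightarrow>
                  norm (\<theta> - \<theta>\<^sub>0) \<le> a * sqrt (ln (real n) / real n))})
           \<in> o(\<lambda>n. real n powr (- 1 / 2))"
proof -
  have dep: "dep_tail M S \<epsilon> f fst dist Y 0 (q + \<delta>) \<le> ennreal C"
    "dep_tail M S \<epsilon> f snd (covariate_dist k) X 0 (q + \<delta>) \<le> ennreal C"
    using assms(14)[of 0] assms(15)[of 0] by simp_all
  interpret glm_model M Y X p k pos S \<epsilon> f g \<theta>\<^sub>0 q \<delta> C C'
    by (rule glm_model.intro) (fact assms dep)+
  show ?thesis by (rule consistency_rate)
qed

end
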